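(* Let $f$ satisfy the following: $f\in L^{\alpha(\cdot)}(\Omega)$ with $\alpha\in C_+(\overline\Omega)$, $\frac1{\alpha(x)}+\frac1{p^\star(x)}<1$ for all $x\in\Omega$, and $\alpha_-:=\min_{\overline\Omega}\alpha$ satisfies $\alpha_->1$ if $d=2$ and $\alpha_-\ge\frac65$ if $d=3$. Then, for any given closed, finite dimensional subspace $X_N\subset W_0^{1,\infty}(\Omega)$, $$\lim_{\epsilon\to\infty}\mathsf{E}_\epsilon(u_{N,\epsilon}^\star)=\mathsf{E}(u_N^\star),$$ where the limit is that of a net indexed by the cut-off pairs $\epsilon=(\epsilon_-,\epsilon_+)$, $u_{N,\epsilon}^\star\in X_N$ is the unique solution of the discrete relaxed problem $$\int_\Omega\mu_\epsilon(x,|\nabla u|^2)\nabla u\cdot\nabla v\,dx=\int_\Omega fv\,dx\qquad\text{for all }v\in X_N,$$ and $u_N^\star\in X_N$ is the unique solution of the discrete unrelaxed problem $$\int_\Omega|\nabla u|^{p(x)-2}\nabla u\cdot\nabla v\,dx=\int_\Omega fv\,dx\qquad\text{for all }v\in X_N.$$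
   Context: Setting: $\Omega\subset\mathbb{R}^d$, $d\in\{2,3\}$, is open and bounded with Lipschitz boundary. $C_+(\overline\Omega)=\{g\in C(\overline\Omega):\inf_{\overline\Omega} g>1\}$, and $p\in C_+(\overline\Omega)$ is given. $p^\star(x)=\frac{d\,p(x)}{d-p(x)}$ if $p(x)<d$ and $p^\star(x)=\infty$ if $p(x)\ge d$ (with $1/\infty=0$). $L^{\alpha(\cdot)}(\Omega)$ is the set of measurable $g:\Omega\to\mathbb{R}$ with $\int_\Omega|g(x)|^{\alpha(x)}dx<\infty$. $W_0^{1,\infty}(\Omega)$ is the space of $W^{1,\infty}$ functions with zero trace on $\partial\Omega$. Cut-off parameters: $\mathcal{A}=\{\epsilon=(\epsilon_-,\epsilon_+):0<\epsilon_-<1<\epsilon_+<\infty\}$ is a directed set under $\epsilon_1\le\epsilon_2$ iff $[\epsilon_{1,-},\epsilon_{1,+}]\subseteq[\epsilon_{2,-},\epsilon_{2,+}]$; "$\epsilon\to\infty$" means $\epsilon_-\to0$ and $\epsilon_+\to\infty$, i.e. convergence of nets indexed by $\mathcal{A}$. Relaxed coefficient: for $x\in\Omega$, $t\ge0$, $$\mu_\epsilon(x,t)=\begin{cases}\epsilon_-^{p(x)-2}& t<\epsilon_-^2,\\ t^{(p(x)-2)/2}&\epsilon_-^2\le t\le\epsilon_+^2,\\ \epsilon_+^{p(x)-2}&t>\epsilon_+^2.\end{cases}$$ Energies: $\mathsf{E}(u)=\int_\Omega\frac1{p(x)}|\nabla u|^{p(x)}dx-\int_\Omega fu\,dx$ and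 $\mathsf{E}_\epsilon(u)=\int_\Omega\varphi_\epsilon(x,|\nabla u|^2)\,dx-\int_\Omega fu\,dx$, where $$\varphi_\epsilon(x,t)=\begin{cases}\frac12\epsilon_-^{p(x)-2}t+\left(\frac1{p(x)}-\frac12\right)\epsilon_-^{p(x)}&0\le t<\epsilon_-^2,\\ \frac1{p(x)}t^{p(x)/2}&\epsilon_-^2\le t\le\epsilon_+^2,\\ \frac12\epsilon_+^{p(x)-2}t+\left(\frac1{p(x)}-\frac12\right)\epsilon_+^{p(x)}&t>\epsilon_+^2.\end{cases}$$ The solutions $u_N^\star$ and $u_{N,\epsilon}^\star$ are, equivalently, the unique minimisers over $X_N$ of $\mathsf{E}$ and $\mathsf{E}_\epsilon$, respectively. *)

theory Defs
  imports "HOL-Analysis.Analysis" "HOL-Probability.Essential_Supremum"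
begin

section \<open>Lipschitz domains\<close>

text \<open>In a suitable orthonormal frame with last axis \<open>e\<close>, the set is locally the strict epigraph of
  a Lipschitz function of the remaining coordinates \<open>x - (x \<bullet> e) *\<^sub>R e\<close>.\<close>

definition lipschitz_boundary :: "'a::euclidean_space set \<Rightarrow> bool" where
  "lipschitz_boundary \<Omega> \<longleftrightarrow>
     (\<forall>x0\<in>frontier \<Omega>. \<exists>r>0. \<exists>e. norm e = 1 \<and>
        (\<exists>(\<gamma>::'a \<Rightarrow> real) L. L-lipschitz_on {y. y \<bullet> e = 0} \<gamma> \<and>
           \<Omega> \<inter> ball x0 r = {x \<in> ball x0 r. \<gamma> (x - (x \<bullet> e) *\<^sub>R e) < x \<bullet> e}))"


section \<open>Variable exponents\<close>

definition C_plus :: "'a::euclidean_space set \<Rightarrow> ('a \<Rightarrow> real) set" where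
  "C_plus \<Omega> = {g. continuous_on (closure \<Omega>) g \<and> (INF x\<in>closure \<Omega>. g x) > 1}"

definition sobolev_conjugate :: "('a::euclidean_space \<Rightarrow> real) \<Rightarrow> 'a \<Rightarrow> ereal" where
  "sobolev_conjugate p x =
     (if p x < real DIM('a) then ereal (real DIM('a) * p x / (real DIM('a) - p x)) else \<infinity>)"

definition Lvar :: "'a::euclidean_space set \<Rightarrow> ('a \<Rightarrow> real) \<Rightarrow> ('a \<Rightarrow> real) set" where
  "Lvar \<Omega> \<alpha> = {g \<in> borel_measurable (lebesgue_on \<Omega>).
     (\<integral>\<^sup>+x. ennreal (\<bar>g x\<bar> powr \<alpha> x) \<partial>lebesgue_on \<Omega>) < \<infinity>}"


section \<open>Sobolev functions\<close>

text \<open>Elements of Lebesgue and Sobolev spaces are represented by functions on the whole type; only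
  their values almost everywhere on \<open>\<Omega>\<close> matter.\<close>

definition ae_eq :: "'a::euclidean_space set \<Rightarrow> ('a \<Rightarrow> 'b) \<Rightarrow> ('a \<Rightarrow> 'b) \<Rightarrow> bool" where
  "ae_eq \<Omega> u v \<longleftrightarrow> (AE x in lebesgue_on \<Omega>. u x = v x)"

primrec C_k :: "nat \<Rightarrow> ('a::euclidean_space \<Rightarrow> real) \<Rightarrow> bool" where
  "C_k 0 f \<longleftrightarrow> continuous_on UNIV f"
| "C_k (Suc k) f \<longleftrightarrow>
     (\<forall>x. f differentiable (at x)) \<and> (\<forall>i\<in>Basis. C_k k (\<lambda>x. frechet_derivative f (at x) i))"

definition test_functions :: "'a::euclidean_space set \<Rightarrow> ('a \<Rightarrow> real) set" where
  "test_functions \<Omega> =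
     {\<phi>. (\<forall>k. C_k k \<phi>) \<and> compact (closure {x. \<phi> x \<noteq> 0}) \<and> closure {x. \<phi> x \<noteq> 0} \<subseteq> \<Omega>}"

definition locally_integrable ::
  "'a::euclidean_space set \<Rightarrow> ('a \<Rightarrow> 'b::euclidean_space) \<Rightarrow> bool" where
  "locally_integrable \<Omega> u \<longleftrightarrow> (\<forall>K. compact K \<and> K \<subseteq> \<Omega> \<longrightarrow> integrable (lebesgue_on K) u)"

definition has_weak_gradient ::
  "'a::euclidean_space set \<Rightarrow> ('a \<Rightarrow> real) \<Rightarrow> ('a \<Rightarrow> 'a) \<Rightarrow> bool" where
  "has_weak_gradient \<Omega> u g \<longleftrightarrow> locally_integrable \<Omega> u \<and> locally_integrable \<Omega> g \<and>
     (\<forall>\<phi>\<in>test_functions \<Omega>. \<forall>i\<in>Basis.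
        (\<integral>x. u x * frechet_derivative \<phi> (at x) i \<partial>lebesgue_on \<Omega>) =
        - (\<integral>x. (g x \<bullet> i) * \<phi> x \<partial>lebesgue_on \<Omega>))"

text \<open>A weak gradient is determined only almost everywhere on \<open>\<Omega>\<close>; an arbitrary representative is
  chosen.\<close>

definition weak_grad :: "'a::euclidean_space set \<Rightarrow> ('a \<Rightarrow> real) \<Rightarrow> 'a \<Rightarrow> 'a" where
  "weak_grad \<Omega> u = (SOME g. has_weak_gradient \<Omega> u g)"

definition Linf_norm ::
  "'a::euclidean_space set \<Rightarrow> ('a \<Rightarrow> 'b::euclidean_space) \<Rightarrow> ereal" where
  "Linf_norm \<Omega> u = esssup (lebesgue_on \<Omega>) (\<lambda>x. ereal (norm (u x)))"

definition Linf :: "'a::euclidean_space set \<Rightarrow> ('a \<Rightarrow> 'b::euclidean_space) set" where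
  "Linf \<Omega> = {u \<in> borel_measurable (lebesgue_on \<Omega>). Linf_norm \<Omega> u < \<infinity>}"

definition W1inf :: "'a::euclidean_space set \<Rightarrow> ('a \<Rightarrow> real) set" where
  "W1inf \<Omega> = {u \<in> Linf \<Omega>. \<exists>g. has_weak_gradient \<Omega> u g \<and> g \<in> Linf \<Omega>}"

definition W1inf_norm :: "'a::euclidean_space set \<Rightarrow> ('a \<Rightarrow> real) \<Rightarrow> ereal" where
  "W1inf_norm \<Omega> u = Linf_norm \<Omega> u + Linf_norm \<Omega> (weak_grad \<Omega> u)"

text \<open>On a bounded Lipschitz domain every \<open>W\<^sup>1\<^sup>,\<^sup>\<infinity>\<close> function has a unique representative that is
  continuous up to the boundary, and its trace is the restriction of that representative.\<close>

definition has_trace :: "'a::euclidean_space set \<Rightarrow> ('a \<Rightarrow> real) \<Rightarrow> ('a \<Rightarrow> real) \<Rightarrow> bool" where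
  "has_trace \<Omega> u h \<longleftrightarrow>
     (\<exists>w. continuous_on (closure \<Omega>) w \<and> ae_eq \<Omega> w u \<and> (\<forall>x\<in>frontier \<Omega>. w x = h x))"

definition W01inf :: "'a::euclidean_space set \<Rightarrow> ('a \<Rightarrow> real) set" where
  "W01inf \<Omega> = {u \<in> W1inf \<Omega>. has_trace \<Omega> u (\<lambda>_. 0)}"


section \<open>Closed finite-dimensional subspaces\<close>

definition linear_subspace :: "('a \<Rightarrow> real) set \<Rightarrow> bool" where
  "linear_subspace X \<longleftrightarrow> (\<lambda>_. 0) \<in> X \<and>
     (\<forall>u\<in>X. \<forall>v\<in>X. (\<lambda>x. u x + v x) \<in> X) \<and> (\<forall>c. \<forall>u\<in>X. (\<lambda>x. c * u x) \<in> X)"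

text \<open>The dimension is that of the space of classes modulo equality almost everywhere.\<close>

definition finite_dim :: "'a::euclidean_space set \<Rightarrow> ('a \<Rightarrow> real) set \<Rightarrow> bool" where
  "finite_dim \<Omega> X \<longleftrightarrow>
     (\<exists>B. finite B \<and> B \<subseteq> X \<and> (\<forall>u\<in>X. \<exists>c. ae_eq \<Omega> u (\<lambda>x. \<Sum>b\<in>B. c b * b x)))"

text \<open>As the norm does not see null sets, a closed set contains with a function every other function
  equal to it almost everywhere on \<open>\<Omega>\<close>, so it is a union of full equivalence classes.\<close>

definition closed_in_W01inf :: "'a::euclidean_space set \<Rightarrow> ('a \<Rightarrow> real) set \<Rightarrow> bool" where
  "closed_in_W01inf \<Omega> X \<longleftrightarrow>
     (\<forall>U. \<forall>u\<in>W01inf \<Omega>. (\<forall>n::nat. U n \<in> X) \<and>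
        (\<lambda>n. W1inf_norm \<Omega> (\<lambda>x. U n x - u x)) \<longlonglongrightarrow> 0 \<longrightarrow> u \<in> X)"

definition closed_fin_dim_subspace :: "'a::euclidean_space set \<Rightarrow> ('a \<Rightarrow> real) set \<Rightarrow> bool" where
  "closed_fin_dim_subspace \<Omega> X \<longleftrightarrow>
     X \<subseteq> W01inf \<Omega> \<and> linear_subspace X \<and> finite_dim \<Omega> X \<and> closed_in_W01inf \<Omega> X"


section \<open>Cut-off parameters\<close>

definition cutoffs :: "(real \<times> real) set" where
  "cutoffs = {\<epsilon>. 0 < fst \<epsilon> \<and> fst \<epsilon> < 1 \<and> 1 < snd \<epsilon>}"

definition cutoff_le :: "real \<times> real \<Rightarrow> real \<times> real \<Rightarrow> bool" where
  "cutoff_le \<epsilon>1 \<epsilon>2 \<longleftrightarrow> {fst \<epsilon>1..snd \<epsilon>1} \<subseteq> {fst \<epsilon>2..snd \<epsilon>2}"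

text \<open>Filter of tails: convergence along it is convergence of nets indexed by \<open>cutoffs\<close>.\<close>

definition cutoff_net :: "(real \<times> real) filter" where
  "cutoff_net = (INF \<epsilon>0\<in>cutoffs. principal {\<epsilon>\<in>cutoffs. cutoff_le \<epsilon>0 \<epsilon>})"

lemma eventually_cutoff_net:
  "eventually P cutoff_net \<longleftrightarrow> (\<exists>\<epsilon>0\<in>cutoffs. \<forall>\<epsilon>\<in>cutoffs. cutoff_le \<epsilon>0 \<epsilon> \<longrightarrow> P \<epsilon>)"
proof -
  have "(1/2, 2) \<in> cutoffs"
    by (simp add: cutoffs_def)
  then have ne: "cutoffs \<noteq> {}"
    by blast
  have dir: "\<exists>c\<in>cutoffs. principal {\<epsilon>\<in>cutoffs. cutoff_le c \<epsilon>} \<le>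
      inf (principal {\<epsilon>\<in>cutoffs. cutoff_le a \<epsilon>}) (principal {\<epsilon>\<in>cutoffs. cutoff_le b \<epsilon>})"
    if "a \<in> cutoffs" "b \<in> cutoffs" for a b
    by (rule bexI[of _ "(min (fst a) (fst b), max (snd a) (snd b))"])
      (use that in \<open>auto simp: cutoffs_def cutoff_le_def\<close>)
  show ?thesis
    unfolding cutoff_net_def
    by (simp add: eventually_INF_base[OF ne dir] eventually_principal Ball_def imp_conjL)
qed


section \<open>Relaxed problem and energies\<close>

definition mu :: "('a \<Rightarrow> real) \<Rightarrow> real \<times> real \<Rightarrow> 'a \<Rightarrow> real \<Rightarrow> real" where
  "mu p \<epsilon> x t =
     (if t < (fst \<epsilon>)\<^sup>2 then fst \<epsilon> powr (p x - 2)
      else if t \<le> (snd \<epsilon>)\<^sup>2 then t powr ((p x - 2) / 2)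
      else snd \<epsilon> powr (p x - 2))"

definition varphi :: "('a \<Rightarrow> real) \<Rightarrow> real \<times> real \<Rightarrow> 'a \<Rightarrow> real \<Rightarrow> real" where
  "varphi p \<epsilon> x t =
     (if t < (fst \<epsilon>)\<^sup>2
      then 1 / 2 * fst \<epsilon> powr (p x - 2) * t + (1 / p x - 1 / 2) * fst \<epsilon> powr p x
      else if t \<le> (snd \<epsilon>)\<^sup>2 then 1 / p x * t powr (p x / 2)
      else 1 / 2 * snd \<epsilon> powr (p x - 2) * t + (1 / p x - 1 / 2) * snd \<epsilon> powr p x)"

definition energy ::
  "'a::euclidean_space set \<Rightarrow> ('a \<Rightarrow> real) \<Rightarrow> ('a \<Rightarrow> real) \<Rightarrow> ('a \<Rightarrow> real) \<Rightarrow> real" where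
  "energy \<Omega> p f u =
     (\<integral>x. 1 / p x * norm (weak_grad \<Omega> u x) powr p x \<partial>lebesgue_on \<Omega>)
     - (\<integral>x. f x * u x \<partial>lebesgue_on \<Omega>)"

definition relaxed_energy ::
  "'a::euclidean_space set \<Rightarrow> ('a \<Rightarrow> real) \<Rightarrow> ('a \<Rightarrow> real) \<Rightarrow> real \<times> real \<Rightarrow> ('a \<Rightarrow> real) \<Rightarrow> real"
  where
  "relaxed_energy \<Omega> p f \<epsilon> u =
     (\<integral>x. varphi p \<epsilon> x ((norm (weak_grad \<Omega> u x))\<^sup>2) \<partial>lebesgue_on \<Omega>)
     - (\<integral>x. f x * u x \<partial>lebesgue_on \<Omega>)"

text \<open>Where the gradient vanishes, \<open>norm 0 powr (p x - 2) = 0\<close> in HOL, so that the flux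
  \<open>|z|\<^sup>p\<^sup>-\<^sup>2 z\<close> takes its usual value \<open>0\<close> at \<open>z = 0\<close> also if \<open>p x < 2\<close>.\<close>

definition unrelaxed_solution ::
  "'a::euclidean_space set \<Rightarrow> ('a \<Rightarrow> real) \<Rightarrow> ('a \<Rightarrow> real) \<Rightarrow> ('a \<Rightarrow> real) set \<Rightarrow> ('a \<Rightarrow> real) \<Rightarrow> bool"
  where
  "unrelaxed_solution \<Omega> p f X u \<longleftrightarrow> u \<in> X \<and>
     (\<forall>v\<in>X. (\<integral>x. norm (weak_grad \<Omega> u x) powr (p x - 2) * (weak_grad \<Omega> u x \<bullet> weak_grad \<Omega> v x)
                \<partial>lebesgue_on \<Omega>) = (\<integral>x. f x * v x \<partial>lebesgue_on \<Omega>))"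

definition relaxed_solution ::
  "'a::euclidean_space set \<Rightarrow> ('a \<Rightarrow> real) \<Rightarrow> ('a \<Rightarrow> real) \<Rightarrow> ('a \<Rightarrow> real) set \<Rightarrow> real \<times> real \<Rightarrow>
     ('a \<Rightarrow> real) \<Rightarrow> bool"
  where
  "relaxed_solution \<Omega> p f X \<epsilon> u \<longleftrightarrow> u \<in> X \<and>
     (\<forall>v\<in>X. (\<integral>x. mu p \<epsilon> x ((norm (weak_grad \<Omega> u x))\<^sup>2) * (weak_grad \<Omega> u x \<bullet> weak_grad \<Omega> v x)
                \<partial>lebesgue_on \<Omega>) = (\<integral>x. f x * v x \<partial>lebesgue_on \<Omega>))"

definition ex1_ae :: "'a::euclidean_space set \<Rightarrow> (('a \<Rightarrow> real) \<Rightarrow> bool) \<Rightarrow> bool" where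
  "ex1_ae \<Omega> P \<longleftrightarrow> (\<exists>u. P u \<and> (\<forall>v. P v \<longrightarrow> ae_eq \<Omega> v u))"

end

theory Submission
  imports Defs "HOL-Computational_Algebra.Polynomial"
begin

text \<open>
  On the finite-dimensional space \<open>X\<close> both problems are the Euler-Lagrange equations of strictly convex
  energies, and the relaxed energy coincides with the unrelaxed one up to \<open>2 \<epsilon>\<^sub>-\<close> per unit of volume on
  functions whose gradient is bounded by \<open>\<epsilon>\<^sub>+\<close>. Bounded sets of \<open>X\<close> have uniformly bounded gradients, so
  the relaxed energies converge uniformly on bounded sets. It remains to know that the relaxed
  minimisers stay bounded. A uniform coercivity estimate is avoided here: strict convexity gives
  a gap between the minimum of the unrelaxed energy and its values on the unit sphere around the
  minimiser; for \<open>\<epsilon>\<close> far out in the net the relaxed energy has such a gap too, and by convexity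
  its minimiser cannot lie outside the unit ball. This is \<open>minimal_energy_tendsto\<close>.

  Existence and uniqueness follow the same lines. Both densities satisfy a strict subgradient
  inequality for their fluxes and grow faster than linearly (locale \<open>convex_density\<close>). This
  makes the energy coercive on coefficient vectors, so minimisers exist by compactness, and the
  subgradient inequality with continuity of the flux identifies them with the solutions of the discrete
  equation.

  What connects this with functions on \<open>\<Omega>\<close> is the injectivity of the gradient on \<open>X\<close>: the weak
  gradient is unique almost everywhere (\<open>weak_gradient_unique\<close>), and a function with vanishing
  weak gradient and zero boundary values vanishes (\<open>zero_gradient_zero_boundary_imp_zero\<close>).
  Then the \<open>L\<^sup>1\<close> norm of the gradient is a norm on the coefficients of a basis of \<open>X\<close>, and solutions are
  determined up to null sets. The load \<open>f\<close> acts as a linear form on these coefficients; its integrals are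
  finite because \<open>f\<close> is integrable and the elements of \<open>X\<close> are essentially bounded.
\<close>

section \<open>Smooth bump functions\<close>

lemma C_k_SucI:
  assumes "\<And>x. (f has_derivative f' x) (at x)" "\<And>i. i \<in> Basis \<Longrightarrow> C_k k (\<lambda>x. f' x i)"
  shows "C_k (Suc k) f"
proof -
  have "frechet_derivative f (at x) = f' x" for x
    using frechet_derivative_at[OF assms(1)] by simp
  then show ?thesis
    using assms by (auto simp: differentiable_def)
qed

lemma C_k_has_derivative: "C_k (Suc k) f \<Longrightarrow> (f has_derivative frechet_derivative f (at x)) (at x)"
  by (simp add: frechet_derivative_works)

lemma C_k_Suc_imp: "C_k (Suc k) f \<Longrightarrow> C_k k f"
proof (induction k arbitrary: f)
  case 0
  then show ?case
    by (auto intro!: continuous_at_imp_continuous_on differentiable_imp_continuous_within)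
next
  case (Suc k)
  then show ?case
    by (metis C_k.simps(2))
qed

lemma C_k_const: "C_k k (\<lambda>_. c)"
proof (induction k arbitrary: c)
  case (Suc k)
  show ?case
    by (rule C_k_SucI[where f'="\<lambda>_ _. 0"]) (auto simp: Suc)
qed simp

lemma C_k_add: "C_k k f \<Longrightarrow> C_k k g \<Longrightarrow> C_k k (\<lambda>x. f x + g x)"
proof (induction k arbitrary: f g)
  case (Suc k)
  show ?case
    by (rule C_k_SucI[OF has_derivative_add[OF C_k_has_derivative[OF Suc.prems(1)] C_k_has_derivative[OF Suc.prems(2)]]])
      (use Suc in simp)
qed (auto intro: continuous_intros)

lemma C_k_mult: "C_k k f \<Longrightarrow> C_k k g \<Longrightarrow> C_k k (\<lambda>x. f x * g x)"
proof (induction k arbitrary: f g)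
  case (Suc k)
  show ?case
    by (rule C_k_SucI[OF has_derivative_mult[OF C_k_has_derivative[OF Suc.prems(1)] C_k_has_derivative[OF Suc.prems(2)]]])
      (intro C_k_add Suc.IH C_k_Suc_imp[OF Suc.prems(1)] C_k_Suc_imp[OF Suc.prems(2)], use Suc.prems in auto)
qed (auto intro: continuous_intros)

lemma C_k_prod: "(\<And>i. i \<in> I \<Longrightarrow> C_k k (f i)) \<Longrightarrow> C_k k (\<lambda>x. \<Prod>i\<in>I. f i x)"
  by (induction I rule: infinite_finite_induct) (simp_all add: C_k_const C_k_mult)

lemma C_k_realI:
  assumes "\<And>t. (f has_real_derivative f' t) (at t)" "C_k k f'"
  shows "C_k (Suc k) f"
  by (rule C_k_SucI[OF assms(1)[unfolded has_field_derivative_def]]) (use assms(2) in simp)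

lemma C_k_real_derivative:
  fixes b :: "real \<Rightarrow> real"
  assumes "C_k (Suc k) b"
  obtains b' where "\<And>t. (b has_real_derivative b' t) (at t)" "C_k k b'"
proof (rule that)
  show "C_k k (\<lambda>t. frechet_derivative b (at t) 1)"
    using assms by simp
  fix t
  obtain l where l: "(b has_real_derivative l) (at t)"
    using assms by (auto simp: real_differentiable_def)
  have "frechet_derivative b (at t) = (*) l"
    using frechet_derivative_at[OF l[unfolded has_field_derivative_def]] by simp
  then show "(b has_real_derivative frechet_derivative b (at t) 1) (at t)"
    using l by simp
qed

lemma C_k_coordinate: "C_k k b \<Longrightarrow> C_k k (\<lambda>x::'a::euclidean_space. b (x \<bullet> i))"
proof (induction k arbitrary: b)
  case 0
  then show ?case
    by (auto intro!: continuous_on_compose2[of UNIV b] continuous_intros)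
next
  case (Suc k)
  obtain b' where b': "\<And>t. (b has_real_derivative b' t) (at t)" "C_k k b'"
    using C_k_real_derivative[OF Suc.prems] by metis
  show ?case
  proof (rule C_k_SucI)
    show "((\<lambda>x. b (x \<bullet> i)) has_derivative (\<lambda>h. (h \<bullet> i) * b' (x \<bullet> i))) (at x)" for x :: 'a
      by (rule has_derivative_eq_rhs[OF has_derivative_compose[OF _ b'(1)[unfolded has_field_derivative_def]]])
        (auto intro!: derivative_eq_intros simp: mult.commute)
    show "C_k k (\<lambda>x. (j \<bullet> i) * b' (x \<bullet> i))" for j
      by (intro C_k_mult C_k_const Suc.IH b')
  qed
qed

lemma C_k_affine: "C_k k b \<Longrightarrow> C_k k (\<lambda>t::real. b (s * t + c))"
proof (induction k arbitrary: b)
  case 0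
  then show ?case
    by (auto intro!: continuous_on_compose2[of UNIV b] continuous_intros)
next
  case (Suc k)
  obtain b' where b': "\<And>t. (b has_real_derivative b' t) (at t)" "C_k k b'"
    using C_k_real_derivative[OF Suc.prems] by metis
  show ?case
  proof (rule C_k_realI)
    show "((\<lambda>t. b (s * t + c)) has_real_derivative (s * b' (s * t + c))) (at t)" for t
      by (rule DERIV_cong[OF DERIV_chain2[OF b'(1)]]) (auto intro!: derivative_eq_intros)
    show "C_k k (\<lambda>t. s * b' (s * t + c))"
      by (intro C_k_mult C_k_const Suc.IH b')
  qed
qed

text \<open>This class contains \<open>exp (- 1 / t)\<close> extended by zero and is closed under differentiation, so one
  computation of a derivative gives smoothness of all orders.\<close>

definition flat :: "real poly \<Rightarrow> real \<Rightarrow> real" where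
  "flat P t = (if t > 0 then poly P (inverse t) * exp (- inverse t) else 0)"

lemma poly_over_exp_tendsto_0: "((\<lambda>u::real. poly P u / exp u) \<longlongrightarrow> 0) at_top"
proof -
  have "((\<lambda>u::real. \<Sum>i\<le>degree P. coeff P i * (u ^ i / exp u)) \<longlongrightarrow> (\<Sum>i\<le>degree P. coeff P i * 0)) at_top"
    by (intro tendsto_intros tendsto_power_div_exp_0)
  then show ?thesis
    by (simp add: poly_altdef sum_divide_distrib)
qed

text \<open>Away from \<open>0\<close> this is the chain rule with \<open>u = 1 / t\<close>, where \<open>u' = - u\<^sup>2\<close>; at \<open>0\<close> the difference
  quotient is a polynomial in \<open>u\<close> divided by \<open>exp u\<close>.\<close>

lemma has_derivative_flat:
  "(flat P has_real_derivative flat ([:0, 0, 1:] * (P - pderiv P)) t) (at t)"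
proof -
  consider "t > 0" | "t < 0" | "t = 0"
    by linarith
  then show ?thesis
  proof cases
    case 1
    have "((\<lambda>t. poly P (inverse t) * exp (- inverse t)) has_real_derivative
        flat ([:0, 0, 1:] * (P - pderiv P)) t) (at t)"
      using 1 by (auto intro!: derivative_eq_intros DERIV_chain2[OF poly_DERIV]
          simp: flat_def power2_eq_square algebra_simps)
    moreover have ev: "\<forall>\<^sub>F s in nhds t. flat P s = poly P (inverse s) * exp (- inverse s)"
      using eventually_nhds_in_open[of "{0<..}" t] 1 by (auto elim!: eventually_mono simp: flat_def)
    ultimately show ?thesis
      unfolding DERIV_cong_ev[OF refl ev refl] by simp
  next
    case 2
    have ev: "\<forall>\<^sub>F s in nhds t. flat P s = 0"
      using eventually_nhds_in_open[of "{..<0}" t] 2 by (auto elim!: eventually_mono simp: flat_def)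
    moreover have "((\<lambda>_. 0) has_real_derivative flat ([:0, 0, 1:] * (P - pderiv P)) t) (at t)"
      using 2 by (simp add: flat_def)
    ultimately show ?thesis
      unfolding DERIV_cong_ev[OF refl ev refl] by simp
  next
    case 3
    have "((\<lambda>s. poly (pCons 0 P) (inverse s) / exp (inverse s)) \<longlongrightarrow> 0) (at_right 0)"
      by (rule filterlim_compose[OF poly_over_exp_tendsto_0 filterlim_inverse_at_top_right])
    moreover have "\<forall>\<^sub>F s in at_right 0. poly (pCons 0 P) (inverse s) / exp (inverse s) = flat P s / s"
      unfolding eventually_at_right_field by (auto simp: flat_def exp_minus field_simps intro!: exI[of _ 1])
    ultimately have right: "((\<lambda>s. flat P s / s) \<longlongrightarrow> 0) (at_right 0)"
      by (rule Lim_transform_eventually)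
    have "\<forall>\<^sub>F s in at_left 0. 0 = flat P s / s"
      unfolding eventually_at_left_field by (auto simp: flat_def intro!: exI[of _ "-1"])
    then have left: "((\<lambda>s. flat P s / s) \<longlongrightarrow> 0) (at_left 0)"
      by (rule Lim_transform_eventually[OF tendsto_const])
    have "((\<lambda>s. flat P s / s) \<longlongrightarrow> 0) (at 0)"
      using left right by (simp add: filterlim_split_at)
    then show ?thesis
      using 3 by (simp add: has_field_derivative_iff flat_def)
  qed
qed

lemma C_k_flat: "C_k k (flat P)"
proof (induction k arbitrary: P)
  case 0
  show ?case
    using has_derivative_flat by (auto intro!: continuous_at_imp_continuous_on DERIV_isCont)
next
  case (Suc k)
  show ?case
    by (rule C_k_realI[OF has_derivative_flat Suc])
qed

definition smooth_step :: "real \<Rightarrow> real" where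
  "smooth_step = flat 1"

lemma smooth_step_simps: "smooth_step t = (if t > 0 then exp (- inverse t) else 0)"
  by (simp add: smooth_step_def flat_def)

lemma smooth_step_bounds: "0 \<le> smooth_step t" "smooth_step t \<le> 1"
  by (auto simp: smooth_step_simps)

lemma smooth_step_tendsto:
  "(\<lambda>n. smooth_step (real (Suc n) * t)) \<longlonglongrightarrow> (if t > 0 then 1 else 0)"
proof (cases "t > 0")
  case True
  have "(\<lambda>n. exp (- (inverse (real (Suc n)) * inverse t))) \<longlonglongrightarrow> exp (- (0 * inverse t))"
    by (intro tendsto_intros LIMSEQ_inverse_real_of_nat)
  then show ?thesis
    using True by (simp add: smooth_step_simps del: of_nat_Suc)
next
  case False
  then have "smooth_step (real (Suc n) * t) = 0" for n
    by (simp add: smooth_step_simps zero_less_mult_iff del: of_nat_Suc)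
  then show ?thesis
    using False by simp
qed

text \<open>Dilating the step increases it to the indicator of the positive half-line while its zero set stays
  fixed. Hence the bumps converge pointwise to the indicator of the open interval without ever
  leaving it.\<close>

definition interval_bump :: "nat \<Rightarrow> real \<Rightarrow> real \<Rightarrow> real \<Rightarrow> real" where
  "interval_bump n a b t = smooth_step (real (Suc n) * (t - a)) * smooth_step (real (Suc n) * (b - t))"

lemma C_k_interval_bump: "C_k k (interval_bump n a b)"
proof -
  have "C_k k (\<lambda>t. smooth_step (real (Suc n) * t + (- real (Suc n) * a)) *
      smooth_step ((- real (Suc n)) * t + real (Suc n) * b))"
    unfolding smooth_step_def by (intro C_k_mult C_k_affine C_k_flat)
  moreover have "interval_bump n a b = (\<lambda>t. smooth_step (real (Suc n) * t + (- real (Suc n) * a)) *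
      smooth_step ((- real (Suc n)) * t + real (Suc n) * b))"
    by (simp add: interval_bump_def fun_eq_iff algebra_simps)
  ultimately show ?thesis
    by simp
qed

lemma interval_bump_bounds: "0 \<le> interval_bump n a b t" "interval_bump n a b t \<le> 1"
  by (auto simp: interval_bump_def smooth_step_bounds mult_le_one)

lemma interval_bump_eq_0: "t \<le> a \<or> b \<le> t \<Longrightarrow> interval_bump n a b t = 0"
  by (auto simp: interval_bump_def smooth_step_simps zero_less_mult_iff simp del: of_nat_Suc)

lemma interval_bump_tendsto:
  "(\<lambda>n. interval_bump n a b t) \<longlonglongrightarrow> (if a < t \<and> t < b then 1 else 0)"
  using tendsto_mult[OF smooth_step_tendsto[of "t - a"] smooth_step_tendsto[of "b - t"]]
  by (simp add: interval_bump_def if_distrib cong: if_cong split: if_splits)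

definition box_bump :: "nat \<Rightarrow> 'a \<Rightarrow> 'a \<Rightarrow> 'a::euclidean_space \<Rightarrow> real" where
  "box_bump n a b x = (\<Prod>i\<in>Basis. interval_bump n (a \<bullet> i) (b \<bullet> i) (x \<bullet> i))"

lemma box_bump_bounds: "0 \<le> box_bump n a b x" "box_bump n a b x \<le> 1"
  unfolding box_bump_def by (auto intro!: prod_nonneg prod_le_1 simp: interval_bump_bounds)

lemma box_bump_eq_0: "x \<notin> box a b \<Longrightarrow> box_bump n a b x = 0"
  unfolding box_bump_def by (force simp: mem_box not_less intro!: prod_zero interval_bump_eq_0)

lemma box_bump_tendsto: "(\<lambda>n. box_bump n a b x) \<longlonglongrightarrow> indicator (box a b) x"
proof -
  have "(\<lambda>n. box_bump n a b x) \<longlonglongrightarrow> (\<Prod>i\<in>Basis. if a \<bullet> i < x \<bullet> i \<and> x \<bullet> i < b \<bullet> i then 1 else 0)"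
    unfolding box_bump_def by (intro tendsto_prod interval_bump_tendsto)
  moreover have "(\<Prod>i\<in>Basis. if a \<bullet> i < x \<bullet> i \<and> x \<bullet> i < b \<bullet> i then 1 else 0) = indicat_real (box a b) x"
    by (auto simp: indicator_def mem_box intro!: prod.neutral)
  ultimately show ?thesis
    by simp
qed

text \<open>All test functions needed below are products of functions of one coordinate each; their partial
  derivatives reduce to derivatives on the line.\<close>

lemma product_test_function:
  fixes b :: "'a::euclidean_space \<Rightarrow> real \<Rightarrow> real"
  assumes smooth: "\<And>i k. i \<in> Basis \<Longrightarrow> C_k k (b i)"
    and supp: "\<And>i t. i \<in> Basis \<Longrightarrow> b i t \<noteq> 0 \<Longrightarrow> lo \<bullet> i \<le> t \<and> t \<le> hi \<bullet> i"
    and sub: "cbox lo hi \<subseteq> \<Omega>"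
  shows "(\<lambda>x. \<Prod>i\<in>Basis. b i (x \<bullet> i)) \<in> test_functions \<Omega>"
proof -
  let ?\<phi> = "\<lambda>x. \<Prod>i\<in>Basis. b i (x \<bullet> i)"
  have "{x. ?\<phi> x \<noteq> 0} \<subseteq> cbox lo hi"
    using supp by (auto simp: mem_box)
  then have cl: "closure {x. ?\<phi> x \<noteq> 0} \<subseteq> cbox lo hi"
    by (simp add: closure_minimal closed_cbox)
  have "compact (closure {x. ?\<phi> x \<noteq> 0})"
    using cl bounded_subset[OF bounded_cbox] by (simp add: compact_eq_bounded_closed)
  moreover have "C_k k ?\<phi>" for k
    by (intro C_k_prod C_k_coordinate smooth)
  ultimately show ?thesis
    using cl sub by (auto simp: test_functions_def)
qed

lemma box_bump_test_function: "cbox a b \<subseteq> \<Omega> \<Longrightarrow> box_bump n a b \<in> test_functions \<Omega>"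
proof -
  assume "cbox a b \<subseteq> \<Omega>"
  have "interval_bump n (a \<bullet> i) (b \<bullet> i) t \<noteq> 0 \<Longrightarrow> a \<bullet> i \<le> t \<and> t \<le> b \<bullet> i" for i t
    using interval_bump_eq_0 by (meson linear)
  then have "(\<lambda>x. \<Prod>i\<in>Basis. interval_bump n (a \<bullet> i) (b \<bullet> i) (x \<bullet> i)) \<in> test_functions \<Omega>"
    by (intro product_test_function[OF C_k_interval_bump _ \<open>cbox a b \<subseteq> \<Omega>\<close>])
  then show ?thesis
    by (simp add: box_bump_def[abs_def])
qed


section \<open>Weak gradients\<close>

lemma borel_measurable_continuous_lebesgue_on:
  fixes f :: "'a::euclidean_space \<Rightarrow> real"
  assumes "continuous_on UNIV f"
  shows "f \<in> borel_measurable (lebesgue_on S)"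
  by (intro measurable_restrict_space1 measurable_completion)
    (simp add: assms borel_measurable_continuous_onI)

lemma integrable_mult_continuous_compact:
  fixes u \<psi> :: "'a::euclidean_space \<Rightarrow> real"
  assumes \<Omega>: "open \<Omega>" and u: "locally_integrable \<Omega> u"
    and \<psi>: "continuous_on UNIV \<psi>" and K: "compact K" "K \<subseteq> \<Omega>" "\<And>x. x \<notin> K \<Longrightarrow> \<psi> x = 0"
  shows "integrable (lebesgue_on \<Omega>) (\<lambda>x. u x * \<psi> x)"
    and "integrable (lebesgue_on K) (\<lambda>x. u x * \<psi> x)"
    and "(\<integral>x. u x * \<psi> x \<partial>lebesgue_on \<Omega>) = (\<integral>x. u x * \<psi> x \<partial>lebesgue_on K)"
proof -
  have sets: "K \<in> sets lebesgue" "\<Omega> \<in> sets lebesgue"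
    using \<Omega> K(1) by (auto intro: lmeasurable_compact fmeasurableD)
  have intu: "integrable (lebesgue_on K) u"
    using u K by (simp add: locally_integrable_def)
  obtain C where C: "\<And>x. x \<in> K \<Longrightarrow> \<bar>\<psi> x\<bar> \<le> C"
    using compact_imp_bounded[OF compact_continuous_image[OF continuous_on_subset[OF \<psi> subset_UNIV] K(1)]]
    by (auto simp: bounded_iff)
  show int: "integrable (lebesgue_on K) (\<lambda>x. u x * \<psi> x)"
  proof (rule Bochner_Integration.integrable_bound)
    show "integrable (lebesgue_on K) (\<lambda>x. C * u x)"
      using intu by simp
    show "(\<lambda>x. u x * \<psi> x) \<in> borel_measurable (lebesgue_on K)"
      by (intro borel_measurable_times borel_measurable_integrable[OF intu]
          borel_measurable_continuous_lebesgue_on[OF \<psi>])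
    show "AE x in lebesgue_on K. norm (u x * \<psi> x) \<le> norm (C * u x)"
    proof (rule AE_I2)
      fix x assume "x \<in> space (lebesgue_on K)"
      then have "\<bar>\<psi> x\<bar> \<le> \<bar>C\<bar>"
        using C[of x] by simp
      then show "norm (u x * \<psi> x) \<le> norm (C * u x)"
        by (simp add: abs_mult mult.commute mult_right_mono)
    qed
  qed
  have eq: "indicator \<Omega> x *\<^sub>R (u x * \<psi> x) = indicator K x *\<^sub>R (u x * \<psi> x)" for x
    using K(2,3) by (auto simp: indicator_def)
  show "integrable (lebesgue_on \<Omega>) (\<lambda>x. u x * \<psi> x)"
    using int sets by (simp add: integrable_restrict_space eq del: scaleR_scaleR real_scaleR_def)
  show "(\<integral>x. u x * \<psi> x \<partial>lebesgue_on \<Omega>) = (\<integral>x. u x * \<psi> x \<partial>lebesgue_on K)"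
    using sets by (simp add: integral_restrict_space eq del: scaleR_scaleR real_scaleR_def)
qed

lemma test_functionD:
  assumes "\<phi> \<in> test_functions \<Omega>"
  shows "compact (closure {x. \<phi> x \<noteq> 0})" "closure {x. \<phi> x \<noteq> 0} \<subseteq> \<Omega>"
    and "continuous_on UNIV \<phi>" "x \<notin> closure {x. \<phi> x \<noteq> 0} \<Longrightarrow> \<phi> x = 0"
    and "i \<in> Basis \<Longrightarrow> continuous_on UNIV (\<lambda>x. frechet_derivative \<phi> (at x) i)"
    and "i \<in> Basis \<Longrightarrow> x \<notin> closure {x. \<phi> x \<noteq> 0} \<Longrightarrow> frechet_derivative \<phi> (at x) i = 0"
proof -
  have smooth: "C_k k \<phi>" for k
    using assms by (simp add: test_functions_def)
  show "compact (closure {x. \<phi> x \<noteq> 0})" "closure {x. \<phi> x \<noteq> 0} \<subseteq> \<Omega>"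
    using assms by (auto simp: test_functions_def)
  show "continuous_on UNIV \<phi>"
    using smooth[of 0] by simp
  show "x \<notin> closure {x. \<phi> x \<noteq> 0} \<Longrightarrow> \<phi> x = 0"
    using closure_subset[of "{x. \<phi> x \<noteq> 0}"] by auto
  show "i \<in> Basis \<Longrightarrow> continuous_on UNIV (\<lambda>x. frechet_derivative \<phi> (at x) i)"
    using smooth[of "Suc 0"] by simp
  show "frechet_derivative \<phi> (at x) i = 0" if "x \<notin> closure {x. \<phi> x \<noteq> 0}"
  proof -
    have "(\<phi> has_derivative (\<lambda>_. 0)) (at x)"
      by (rule has_derivative_transform_within_open[of "\<lambda>_. 0" _ _ _ "- closure {x. \<phi> x \<noteq> 0}"])
        (use that closure_subset[of "{x. \<phi> x \<noteq> 0}"] in auto)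
    then show ?thesis
      using frechet_derivative_at by metis
  qed
qed

lemma locally_integrable_inner:
  "locally_integrable \<Omega> g \<Longrightarrow> locally_integrable \<Omega> (\<lambda>x. g x \<bullet> i)"
  by (simp add: locally_integrable_def)

lemma locally_integrable_diff:
  "locally_integrable \<Omega> g \<Longrightarrow> locally_integrable \<Omega> h \<Longrightarrow> locally_integrable \<Omega> (\<lambda>x. g x - h x)"
  by (simp add: locally_integrable_def)

lemma locally_integrable_add:
  "locally_integrable \<Omega> g \<Longrightarrow> locally_integrable \<Omega> h \<Longrightarrow> locally_integrable \<Omega> (\<lambda>x. g x + h x)"
  by (simp add: locally_integrable_def)

lemma integrable_test_function:
  fixes u :: "'a::euclidean_space \<Rightarrow> real"
  assumes "open \<Omega>" "locally_integrable \<Omega> u" "\<phi> \<in> test_functions \<Omega>"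
  shows "integrable (lebesgue_on \<Omega>) (\<lambda>x. u x * \<phi> x)"
    and "i \<in> Basis \<Longrightarrow> integrable (lebesgue_on \<Omega>) (\<lambda>x. u x * frechet_derivative \<phi> (at x) i)"
  using integrable_mult_continuous_compact(1)[OF assms(1,2) test_functionD(3)[OF assms(3)] test_functionD(1,2,4)[OF assms(3)]]
    integrable_mult_continuous_compact(1)[OF assms(1,2) test_functionD(5)[OF assms(3)] test_functionD(1,2,6)[OF assms(3)]]
  by blast+

text \<open>Boxes are closed under intersection and generate the Borel sets, so the integral vanishes over
  every Borel set; the integral over the whole space enters for complements. A Borel representative of \<open>H\<close> carries this over to Lebesgue measure.\<close>

lemma zero_of_zero_box_integrals:
  fixes H :: "'a::euclidean_space \<Rightarrow> real"
  assumes H: "integrable lebesgue H"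
    and zero: "\<And>c d. (\<integral>x. indicator (box c d) x * H x \<partial>lebesgue) = 0"
    and total: "(\<integral>x. H x \<partial>lebesgue) = 0"
  shows "AE x in lebesgue. H x = 0"
proof -
  have si: "set_integrable lebesgue A H" if "A \<in> sets borel" for A
    unfolding set_integrable_def using H that
    by (intro integrable_mult_indicator) auto
  have borel0: "set_lebesgue_integral lebesgue A H = 0" if "A \<in> sets borel" for A
  proof -
    have "Int_stable (range (\<lambda>(a, b). box a b :: 'a set))"
      by (auto simp: Int_stable_def box_Int_box)
    moreover have "range (\<lambda>(a, b). box a b :: 'a set) \<subseteq> Pow UNIV"
      by auto
    moreover have "A \<in> sigma_sets UNIV (range (\<lambda>(a, b). box a b))"
      using that unfolding borel_eq_box by simp
    ultimately show ?thesis
    proof (induction rule: sigma_sets_induct_disjoint)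
      case (basic A)
      then show ?case
        using zero by (auto simp: set_lebesgue_integral_def)
    next
      case empty
      then show ?case
        by (simp add: set_lebesgue_integral_def)
    next
      case (compl A)
      then have A: "A \<in> sets borel"
        by (simp add: borel_eq_box)
      have "set_lebesgue_integral lebesgue (UNIV - A) H = (\<integral>x. H x - indicator A x * H x \<partial>lebesgue)"
        unfolding set_lebesgue_integral_def
        by (intro Bochner_Integration.integral_cong) (auto simp: indicator_def)
      also have "\<dots> = (\<integral>x. H x \<partial>lebesgue) - set_lebesgue_integral lebesgue A H"
        using si[OF A] H unfolding set_lebesgue_integral_def set_integrable_def
        by (simp add: Bochner_Integration.integral_diff)
      finally show ?case
        using total compl by simp
    next
      case (union F)
      then have F: "F i \<in> sets borel" for i
        by (auto simp: borel_eq_box)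
      have "(\<Union>i. F i) \<in> sets borel"
        using F by blast
      then have "set_lebesgue_integral lebesgue (\<Union>i. F i) H = (\<Sum>i. set_lebesgue_integral lebesgue (F i) H)"
        using union(1) F si
        by (intro lebesgue_integral_countable_add) (auto simp: disjoint_family_on_def)
      then show ?case
        using union by simp
    qed
  qed
  obtain H' where H': "H' \<in> borel_measurable lborel" "AE x in lborel. H x = H' x"
    using completion_ex_borel_measurable_real[of H lborel] H by auto
  have ae: "AE x in lebesgue. H x = H' x"
    using H'(2) by (rule AE_completion)
  have m: "H' \<in> borel_measurable lebesgue"
    using H'(1) by (rule measurable_completion)
  have "integrable lebesgue H'"
    using H ae m integrable_cong_AE[of H lebesgue H'] by auto
  then have int: "integrable lborel H'"
    using H'(1) by (simp add: integrable_completion)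
  have "AE x in lborel. H' x = 0"
  proof (rule sigma_finite_measure.density_zero[OF sigma_finite_lborel int])
    fix A assume A: "A \<in> sets (lborel :: 'a measure)"
    have "set_lebesgue_integral lborel A H' = set_lebesgue_integral lebesgue A H'"
      unfolding set_lebesgue_integral_def using A H'(1)
      by (intro integral_completion[symmetric]) auto
    also have "\<dots> = set_lebesgue_integral lebesgue A H"
      unfolding set_lebesgue_integral_def using A H m ae
      by (intro integral_cong_AE borel_measurable_scaleR borel_measurable_indicator) auto
    also have "\<dots> = 0"
      using borel0 A by simp
    finally show "set_lebesgue_integral lborel A H' = 0" .
  qed
  then have "AE x in lebesgue. H' x = 0"
    by (rule AE_completion)
  with ae show ?thesis
    by eventually_elim simp
qed

lemma AE_lebesgue_on_iff: "S \<in> sets lebesgue \<Longrightarrow> (AE x in lebesgue_on S. P x) \<longleftrightarrow> (AE x in lebesgue. x \<in> S \<longrightarrow> P x)"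
  by (rule AE_restrict_space_iff) simp

text \<open>In the limit the bumps become indicators of boxes. An open box inside the open box \<open>box a b\<close> may
  touch its boundary, but its closure stays in \<open>cbox a b\<close>, which is why the hypothesis
  speaks of closed boxes in the closed box.\<close>

lemma zero_of_zero_bump_integrals:
  fixes h :: "'a::euclidean_space \<Rightarrow> real"
  assumes h: "integrable (lebesgue_on (cbox a b)) h"
    and zero: "\<And>c d n. box c d \<noteq> {} \<Longrightarrow> cbox c d \<subseteq> cbox a b \<Longrightarrow>
      (\<integral>x. h x * box_bump n c d x \<partial>lebesgue_on (cbox a b)) = 0"
  shows "AE x in lebesgue. x \<in> cbox a b \<longrightarrow> h x = 0"
proof -
  let ?Q = "cbox a b"
  have Q: "?Q \<in> sets lebesgue"
    by simp
  have cont: "continuous_on UNIV (box_bump n c d)" for n and c d :: 'a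
    using test_functionD(3)[OF box_bump_test_function[of c d UNIV n]] by simp
  have lim: "(\<integral>x. h x * indicator (box c d) x \<partial>lebesgue_on ?Q) = 0"
    if cd: "box c d \<noteq> {}" "cbox c d \<subseteq> ?Q" for c d
  proof -
    have "(\<lambda>n. \<integral>x. h x * box_bump n c d x \<partial>lebesgue_on ?Q)
        \<longlonglongrightarrow> (\<integral>x. h x * indicator (box c d) x \<partial>lebesgue_on ?Q)"
    proof (rule integral_dominated_convergence[where w="\<lambda>x. \<bar>h x\<bar>"])
      show "(\<lambda>x. h x * indicator (box c d) x) \<in> borel_measurable (lebesgue_on ?Q)"
        by (intro borel_measurable_times borel_measurable_integrable[OF h] measurable_restrict_space1
            borel_measurable_indicator) simp
      show "(\<lambda>x. h x * box_bump n c d x) \<in> borel_measurable (lebesgue_on ?Q)" for n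
        by (intro borel_measurable_times borel_measurable_integrable[OF h]
            borel_measurable_continuous_lebesgue_on[OF cont])
      show "integrable (lebesgue_on ?Q) (\<lambda>x. \<bar>h x\<bar>)"
        using h by simp
      show "AE x in lebesgue_on ?Q. (\<lambda>n. h x * box_bump n c d x) \<longlonglongrightarrow> h x * indicator (box c d) x"
        by (intro AE_I2 tendsto_intros box_bump_tendsto)
      show "AE x in lebesgue_on ?Q. norm (h x * box_bump n c d x) \<le> \<bar>h x\<bar>" for n
        by (intro AE_I2) (simp add: abs_mult box_bump_bounds mult_left_le)
    qed
    moreover have "(\<lambda>n. \<integral>x. h x * box_bump n c d x \<partial>lebesgue_on ?Q) = (\<lambda>n. 0)"
      using zero[OF cd] by (simp add: fun_eq_iff)
    ultimately show ?thesis
      by (simp add: LIMSEQ_const_iff)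
  qed
  define H where "H x = indicator (box a b) x * h x" for x
  have HQ: "indicator (box c d) x * H x = indicator ?Q x *\<^sub>R (h x * indicator (box c d \<inter> box a b) x)" for c d x
    using box_subset_cbox[of a b] by (auto simp: H_def indicator_def)
  have box0: "(\<integral>x. indicator (box c d) x * H x \<partial>lebesgue) = 0" for c d
  proof -
    have "(\<integral>x. indicator (box c d) x * H x \<partial>lebesgue) =
        (\<integral>x. h x * indicator (box c d \<inter> box a b) x \<partial>lebesgue_on ?Q)"
      unfolding HQ by (subst integral_restrict_space) auto
    also have "\<dots> = 0"
    proof (cases "box c d \<inter> box a b = {}")
      case False
      have "\<exists>c' d'. box c d \<inter> box a b = box c' d'"
        unfolding box_Int_box by blast
      then obtain c' d' where cd: "box c d \<inter> box a b = box c' d'"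
        by blast
      have ne: "box c' d' \<noteq> {}"
        using False cd by simp
      have "closure (box c' d') \<subseteq> ?Q"
        using cd box_subset_cbox[of a b] by (intro closure_minimal) auto
      then have "cbox c' d' \<subseteq> ?Q"
        using closure_box[OF ne] by simp
      then show ?thesis
        using lim[OF ne] cd by simp
    qed simp
    finally show ?thesis .
  qed
  have "integrable lebesgue (\<lambda>x. indicator ?Q x *\<^sub>R h x)"
    using h by (simp add: integrable_restrict_space)
  then have "integrable lebesgue (\<lambda>x. indicator (box a b) x *\<^sub>R (indicator ?Q x *\<^sub>R h x))"
    by (rule integrable_mult_indicator[rotated]) simp
  moreover have "(\<lambda>x. indicator (box a b) x *\<^sub>R (indicator ?Q x *\<^sub>R h x)) = H"
    using box_subset_cbox[of a b] by (auto simp: H_def indicator_def fun_eq_iff)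
  ultimately have int: "integrable lebesgue H"
    by simp
  have "(\<integral>x. H x \<partial>lebesgue) = (\<integral>x. indicator (box a b) x * H x \<partial>lebesgue)"
    by (intro Bochner_Integration.integral_cong) (auto simp: H_def indicator_def)
  then have "(\<integral>x. H x \<partial>lebesgue) = 0"
    using box0 by simp
  with int box0 have "AE x in lebesgue. H x = 0"
    by (rule zero_of_zero_box_integrals)
  moreover have "AE x in lebesgue. x \<notin> cbox a b - box a b"
    using negligible_frontier_interval[of a b] by (intro AE_not_in) (simp add: negligible_iff_null_sets)
  ultimately show ?thesis
    by eventually_elim (auto simp: H_def indicator_def split: if_splits)
qed

text \<open>An open set is a countable union of closed boxes, on each of which \<open>h\<close> is integrable.\<close>

lemma fundamental_lemma_variations:
  fixes h :: "'a::euclidean_space \<Rightarrow> real"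
  assumes \<Omega>: "open \<Omega>" and h: "locally_integrable \<Omega> h"
    and zero: "\<And>\<phi>. \<phi> \<in> test_functions \<Omega> \<Longrightarrow> (\<integral>x. h x * \<phi> x \<partial>lebesgue_on \<Omega>) = 0"
  shows "AE x in lebesgue_on \<Omega>. h x = 0"
proof -
  obtain \<D> where D: "countable \<D>" "\<D> \<subseteq> Pow \<Omega>" "\<And>X. X \<in> \<D> \<Longrightarrow> \<exists>a b. X = cbox a b" "\<Union>\<D> = \<Omega>"
    using open_countable_Union_open_cbox[OF \<Omega>] by metis
  have box: "AE x in lebesgue. x \<in> X \<longrightarrow> h x = 0" if X: "X \<in> \<D>" for X
  proof -
    obtain a b where ab: "X = cbox a b" "cbox a b \<subseteq> \<Omega>"
      using D X by blast
    show ?thesis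
      unfolding ab(1)
    proof (rule zero_of_zero_bump_integrals)
      show "integrable (lebesgue_on (cbox a b)) h"
        using h ab(2) by (simp add: locally_integrable_def)
      fix c d n assume cd: "cbox c d \<subseteq> cbox a b"
      have \<phi>: "box_bump n c d \<in> test_functions \<Omega>"
        using cd ab by (intro box_bump_test_function) auto
      have "(\<integral>x. h x * box_bump n c d x \<partial>lebesgue_on \<Omega>) = (\<integral>x. h x * box_bump n c d x \<partial>lebesgue_on (cbox a b))"
        by (rule integrable_mult_continuous_compact(3)[OF \<Omega> h test_functionD(3)[OF \<phi>] compact_cbox ab(2)])
          (use cd box_subset_cbox box_bump_eq_0 in blast)
      then show "(\<integral>x. h x * box_bump n c d x \<partial>lebesgue_on (cbox a b)) = 0"
        using zero[OF \<phi>] by simp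
    qed
  qed
  have "AE x in lebesgue. \<forall>X\<in>\<D>. x \<in> X \<longrightarrow> h x = 0"
    using D(1) box by (subst AE_ball_countable) auto
  then have "AE x in lebesgue. x \<in> \<Omega> \<longrightarrow> h x = 0"
    by eventually_elim (use D(4) in auto)
  then show ?thesis
    using \<Omega> by (subst AE_lebesgue_on_iff) auto
qed

text \<open>Since \<open>weak_grad\<close> picks an arbitrary weak gradient, every computation with it rests on this
  uniqueness.\<close>

lemma weak_gradient_unique:
  assumes \<Omega>: "open \<Omega>" and g: "has_weak_gradient \<Omega> u g" and g': "has_weak_gradient \<Omega> u g'"
  shows "AE x in lebesgue_on \<Omega>. g x = g' x"
proof -
  have loc: "locally_integrable \<Omega> g" "locally_integrable \<Omega> g'"
    using g g' by (auto simp: has_weak_gradient_def)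
  have "AE x in lebesgue_on \<Omega>. g x \<bullet> i - g' x \<bullet> i = 0" if i: "i \<in> Basis" for i
  proof (rule fundamental_lemma_variations[OF \<Omega>])
    show "locally_integrable \<Omega> (\<lambda>x. g x \<bullet> i - g' x \<bullet> i)"
      by (intro locally_integrable_diff locally_integrable_inner loc)
    fix \<phi> assume \<phi>: "\<phi> \<in> test_functions \<Omega>"
    have "(\<integral>x. (g x \<bullet> i - g' x \<bullet> i) * \<phi> x \<partial>lebesgue_on \<Omega>) =
        (\<integral>x. (g x \<bullet> i) * \<phi> x \<partial>lebesgue_on \<Omega>) - (\<integral>x. (g' x \<bullet> i) * \<phi> x \<partial>lebesgue_on \<Omega>)"
      unfolding left_diff_distrib
      by (intro Bochner_Integration.integral_diff integrable_test_function \<Omega> \<phi> locally_integrable_inner loc)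
    also have "\<dots> = 0"
    proof -
      have "- (\<integral>x. (g x \<bullet> i) * \<phi> x \<partial>lebesgue_on \<Omega>) = - (\<integral>x. (g' x \<bullet> i) * \<phi> x \<partial>lebesgue_on \<Omega>)"
        using g g' \<phi> i by (simp add: has_weak_gradient_def)
      then show ?thesis
        by simp
    qed
    finally show "(\<integral>x. (g x \<bullet> i - g' x \<bullet> i) * \<phi> x \<partial>lebesgue_on \<Omega>) = 0" .
  qed
  then have "AE x in lebesgue_on \<Omega>. \<forall>i\<in>Basis. g x \<bullet> i - g' x \<bullet> i = 0"
    by (subst AE_ball_countable) (auto simp: countable_finite)
  then show ?thesis
    by eventually_elim (auto intro: euclidean_eqI)
qed

lemma has_weak_gradient_zero: "has_weak_gradient \<Omega> (\<lambda>_. 0) (\<lambda>_. 0)"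
  by (simp add: has_weak_gradient_def locally_integrable_def)

lemma has_weak_gradient_add:
  assumes \<Omega>: "open \<Omega>" and u: "has_weak_gradient \<Omega> u g" and v: "has_weak_gradient \<Omega> v h"
  shows "has_weak_gradient \<Omega> (\<lambda>x. u x + v x) (\<lambda>x. g x + h x)"
  unfolding has_weak_gradient_def
proof (intro conjI ballI)
  have loc: "locally_integrable \<Omega> u" "locally_integrable \<Omega> v" "locally_integrable \<Omega> g" "locally_integrable \<Omega> h"
    using u v by (auto simp: has_weak_gradient_def)
  show "locally_integrable \<Omega> (\<lambda>x. u x + v x)" "locally_integrable \<Omega> (\<lambda>x. g x + h x)"
    by (intro locally_integrable_add loc)+
  fix \<phi> and i :: 'a assume \<phi>: "\<phi> \<in> test_functions \<Omega>" and i: "i \<in> Basis"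
  have "(\<integral>x. (u x + v x) * frechet_derivative \<phi> (at x) i \<partial>lebesgue_on \<Omega>) =
      (\<integral>x. u x * frechet_derivative \<phi> (at x) i \<partial>lebesgue_on \<Omega>) +
      (\<integral>x. v x * frechet_derivative \<phi> (at x) i \<partial>lebesgue_on \<Omega>)"
    unfolding distrib_right
    by (intro Bochner_Integration.integral_add integrable_test_function \<Omega> \<phi> i loc)
  also have "\<dots> = - ((\<integral>x. (g x \<bullet> i) * \<phi> x \<partial>lebesgue_on \<Omega>) + (\<integral>x. (h x \<bullet> i) * \<phi> x \<partial>lebesgue_on \<Omega>))"
    using u v \<phi> i by (simp add: has_weak_gradient_def)
  also have "\<dots> = - (\<integral>x. (g x \<bullet> i) * \<phi> x + (h x \<bullet> i) * \<phi> x \<partial>lebesgue_on \<Omega>)"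
    by (subst Bochner_Integration.integral_add)
      (intro integrable_test_function \<Omega> \<phi> locally_integrable_inner loc refl)+
  finally show "(\<integral>x. (u x + v x) * frechet_derivative \<phi> (at x) i \<partial>lebesgue_on \<Omega>) =
      - (\<integral>x. ((g x + h x) \<bullet> i) * \<phi> x \<partial>lebesgue_on \<Omega>)"
    by (simp add: inner_add_left distrib_right)
qed

lemma has_weak_gradient_scale:
  assumes u: "has_weak_gradient \<Omega> u g"
  shows "has_weak_gradient \<Omega> (\<lambda>x. c * u x) (\<lambda>x. c *\<^sub>R g x)"
  using assms by (auto simp: has_weak_gradient_def locally_integrable_def mult.assoc)

lemma has_weak_gradient_sum:
  assumes \<Omega>: "open \<Omega>" and u: "\<And>b. b \<in> B \<Longrightarrow> has_weak_gradient \<Omega> (u b) (g b)"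
  shows "has_weak_gradient \<Omega> (\<lambda>x. \<Sum>b\<in>B. c b * u b x) (\<lambda>x. \<Sum>b\<in>B. c b *\<^sub>R g b x)"
  using u
  by (induction B rule: infinite_finite_induct)
    (simp_all add: has_weak_gradient_zero has_weak_gradient_add[OF \<Omega>] has_weak_gradient_scale)

text \<open>Completeness of Lebesgue measure: null sets do not affect measurability.\<close>

lemma ae_eq_borel_measurable:
  fixes u v :: "'a::euclidean_space \<Rightarrow> 'b::euclidean_space"
  assumes S: "S \<in> sets lebesgue" and u: "u \<in> borel_measurable (lebesgue_on S)"
    and ae: "AE x in lebesgue_on S. u x = v x"
  shows "v \<in> borel_measurable (lebesgue_on S)"
proof -
  have m: "(\<lambda>x. indicator S x *\<^sub>R u x) \<in> borel_measurable lebesgue"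
    using u S by (simp add: borel_measurable_restrict_space_iff)
  have "AE x in lebesgue. x \<in> S \<longrightarrow> u x = v x"
    using ae S by (simp add: AE_lebesgue_on_iff)
  then have "AE x in lebesgue. indicator S x *\<^sub>R u x = indicator S x *\<^sub>R v x"
    by eventually_elim (auto simp: indicator_def)
  then have "(\<lambda>x. indicator S x *\<^sub>R v x) \<in> borel_measurable lebesgue"
    by (rule borel_measurable_AE[OF m])
  then show ?thesis
    using S by (simp add: borel_measurable_restrict_space_iff)
qed


section \<open>Functions with vanishing gradient\<close>

lemma antiderivative_exists:
  fixes \<theta> :: "real \<Rightarrow> real"
  assumes "continuous_on UNIV \<theta>"
  obtains H where "\<And>t. (H has_real_derivative \<theta> t) (at t)"
proof
  fix t :: real
  let ?a = "- \<bar>t\<bar> - 1" and ?b = "\<bar>t\<bar> + 1"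
  have "((\<lambda>u. LBINT y=ereal 0..u. \<theta> y) has_vector_derivative \<theta> t) (at t within {?a..?b})"
    using interval_integral_FTC2[of ?a 0 ?b \<theta> t] continuous_on_subset[OF assms] by auto
  moreover have "at t within {?a..?b} = at t"
    by (rule at_within_interior) (auto simp: interior_atLeastAtMost_real)
  ultimately show "((\<lambda>u. LBINT y=ereal 0..u. \<theta> y) has_real_derivative \<theta> t) (at t)"
    by (simp add: has_real_derivative_iff_has_vector_derivative)
qed

text \<open>The difference of a bump and its translate along a coordinate axis has integral zero on every line
  parallel to that axis, so its antiderivative \<open>\<Psi>\<close> in that variable has compact support again.\<close>

lemma translation_test_function:
  fixes c d i :: "'a::euclidean_space"
  assumes i: "i \<in> Basis" and sub: "cbox lo hi \<subseteq> \<Omega>"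
    and cd: "cbox c d \<subseteq> cbox lo hi" "cbox (c + \<tau> *\<^sub>R i) (d + \<tau> *\<^sub>R i) \<subseteq> cbox lo hi"
    and ne: "box c d \<noteq> {}"
  obtains \<phi> where "\<phi> \<in> test_functions \<Omega>"
    "\<And>x. frechet_derivative \<phi> (at x) i = box_bump n c d x - box_bump n c d (x - \<tau> *\<^sub>R i)"
proof -
  let ?\<theta> = "\<lambda>j. interval_bump n (c \<bullet> j) (d \<bullet> j)"
  have lt: "c \<bullet> j < d \<bullet> j" if "j \<in> Basis" for j
    using ne that by (simp add: box_ne_empty)
  have range: "lo \<bullet> j \<le> c \<bullet> j" "d \<bullet> j \<le> hi \<bullet> j"
    "lo \<bullet> j \<le> (c + \<tau> *\<^sub>R i) \<bullet> j" "(d + \<tau> *\<^sub>R i) \<bullet> j \<le> hi \<bullet> j" if "j \<in> Basis" for j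
    using cd that lt unfolding subset_box by (simp_all add: inner_add_left less_imp_le)
  obtain H where H: "\<And>t. (H has_real_derivative ?\<theta> i t) (at t)"
    using antiderivative_exists[of "?\<theta> i"] C_k_interval_bump[of 0] by (metis C_k.simps(1))
  (* H is constant on both sides of the interval, so the difference vanishes outside the hull of the
     interval and its translate. *)
  define \<Psi> where "\<Psi> t = H t - H (t - \<tau>)" for t
  have \<Psi>: "(\<Psi> has_real_derivative ?\<theta> i t - ?\<theta> i (t - \<tau>)) (at t)" for t
  proof -
    have "((\<lambda>t. H (t - \<tau>)) has_real_derivative ?\<theta> i (t - \<tau>) * 1) (at t)"
      by (rule DERIV_chain2[OF H]) (auto intro!: derivative_eq_intros)
    then show ?thesis
      unfolding \<Psi>_def by (intro derivative_intros H) simp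
  qed
  have \<Psi>_smooth: "C_k k \<Psi>" for k
  proof -
    have "C_k k (\<lambda>t. ?\<theta> i (1 * t + 0) + (-1) * ?\<theta> i (1 * t + (- \<tau>)))" for k
      by (intro C_k_add C_k_mult C_k_const C_k_affine C_k_interval_bump)
    then have "C_k k (\<lambda>t. ?\<theta> i t - ?\<theta> i (t - \<tau>))" for k
      by simp
    then show ?thesis
      by (rule C_k_Suc_imp[OF C_k_realI[OF \<Psi>]])
  qed
  have const: "H s = H t" if "\<And>r. r \<in> S \<Longrightarrow> ?\<theta> i r = 0" "convex S" "s \<in> S" "t \<in> S" for S s t
  proof -
    have "(H has_real_derivative 0) (at r within S)" if "r \<in> S" for r
      using has_field_derivative_at_within[OF H[of r], of S] \<open>r \<in> S\<close> \<open>\<And>r. r \<in> S \<Longrightarrow> ?\<theta> i r = 0\<close> by simp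
    from has_field_derivative_zero_constant[OF \<open>convex S\<close> this]
    obtain C where "\<And>r. r \<in> S \<Longrightarrow> H r = C"
      by blast
    then show ?thesis
      using that(3,4) by simp
  qed
  have \<Psi>_supp: "lo \<bullet> i \<le> t \<and> t \<le> hi \<bullet> i" if "\<Psi> t \<noteq> 0" for t
  proof (rule ccontr)
    assume "\<not> ?thesis"
    then consider "t < lo \<bullet> i" | "hi \<bullet> i < t"
      by linarith
    then have "H t = H (t - \<tau>)"
    proof cases
      case 1
      then have "t \<in> {..c \<bullet> i}" "t - \<tau> \<in> {..c \<bullet> i}"
        using range[OF i] i by (auto simp: inner_add_left)
      then show ?thesis
        by (rule const[rotated 2]) (auto intro: interval_bump_eq_0)
    next
      case 2
      then have "t \<in> {d \<bullet> i..}" "t - \<tau> \<in> {d \<bullet> i..}"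
        using range[OF i] i by (auto simp: inner_add_left)
      then show ?thesis
        by (rule const[rotated 2]) (auto intro: interval_bump_eq_0)
    qed
    then show False
      using that by (simp add: \<Psi>_def)
  qed
  define b where "b j = (if j = i then \<Psi> else ?\<theta> j)" for j
  define \<phi> where "\<phi> x = (\<Prod>j\<in>Basis. b j (x \<bullet> j))" for x :: 'a
  have "\<phi> \<in> test_functions \<Omega>"
    unfolding \<phi>_def
  proof (rule product_test_function[OF _ _ sub])
    show "C_k k (b j)" for j k
      using \<Psi>_smooth C_k_interval_bump by (simp add: b_def)
    show "lo \<bullet> j \<le> t \<and> t \<le> hi \<bullet> j" if "j \<in> Basis" "b j t \<noteq> 0" for j t
    proof (cases "j = i")
      case False
      then have "\<not> (t \<le> c \<bullet> j \<or> d \<bullet> j \<le> t)"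
        using that(2) interval_bump_eq_0[of t "c \<bullet> j" "d \<bullet> j" n] by (auto simp only: b_def if_False)
      then show ?thesis
        using range[OF that(1)] by simp
    qed (use that \<Psi>_supp in \<open>simp add: b_def\<close>)
  qed
  moreover have "frechet_derivative \<phi> (at x) i = box_bump n c d x - box_bump n c d (x - \<tau> *\<^sub>R i)" for x
  proof -
    let ?R = "\<Prod>j\<in>Basis - {i}. ?\<theta> j (x \<bullet> j)"
    define b' where "b' j t = (if j = i then ?\<theta> i t - ?\<theta> i (t - \<tau>) else frechet_derivative (?\<theta> j) (at t) 1)" for j t
    have b': "(b j has_real_derivative b' j t) (at t)" for j t
    proof (cases "j = i")
      case False
      have "C_k (Suc 0) (?\<theta> j)"
        by (rule C_k_interval_bump)
      then obtain l where l: "(?\<theta> j has_real_derivative l) (at t)"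
        by (auto simp: real_differentiable_def)
      have "frechet_derivative (?\<theta> j) (at t) = (*) l"
        using frechet_derivative_at[OF l[unfolded has_field_derivative_def]] by simp
      then show ?thesis
        using l False by (simp add: b_def b'_def)
    qed (use \<Psi> in \<open>simp add: b_def b'_def\<close>)
    have one: "((\<lambda>x. b j (x \<bullet> j)) has_derivative (\<lambda>h. b' j (x \<bullet> j) * (h \<bullet> j))) (at x)" for j
      by (rule has_derivative_eq_rhs[OF has_derivative_compose[OF _ b'[unfolded has_field_derivative_def]]])
        (auto intro!: derivative_eq_intros)
    have "(\<phi> has_derivative (\<lambda>h. \<Sum>k\<in>Basis. b' k (x \<bullet> k) * (h \<bullet> k) * (\<Prod>j\<in>Basis - {k}. b j (x \<bullet> j)))) (at x)"
      unfolding \<phi>_def by (intro has_derivative_prod one)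
    from frechet_derivative_at[OF this, symmetric]
    have "frechet_derivative \<phi> (at x) i =
        (\<Sum>k\<in>Basis. b' k (x \<bullet> k) * (i \<bullet> k) * (\<Prod>j\<in>Basis - {k}. b j (x \<bullet> j)))"
      by simp
    also have "\<dots> = (\<Sum>k\<in>Basis. if k = i then b' i (x \<bullet> i) * (\<Prod>j\<in>Basis - {i}. b j (x \<bullet> j)) else 0)"
      using i by (intro sum.cong) (auto simp: inner_not_same_Basis inner_Basis)
    also have "\<dots> = b' i (x \<bullet> i) * (\<Prod>j\<in>Basis - {i}. b j (x \<bullet> j))"
      using i by simp
    also have "(\<Prod>j\<in>Basis - {i}. b j (x \<bullet> j)) = ?R"
      by (intro prod.cong) (auto simp: b_def)
    also have "b' i (x \<bullet> i) * ?R = ?\<theta> i (x \<bullet> i) * ?R - ?\<theta> i (x \<bullet> i - \<tau>) * ?R"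
      by (simp add: b'_def left_diff_distrib)
    also have "?\<theta> i (x \<bullet> i) * ?R = box_bump n c d x"
      unfolding box_bump_def using i by (subst prod.remove[of _ i]) auto
    also have "?\<theta> i (x \<bullet> i - \<tau>) * ?R = box_bump n c d (x - \<tau> *\<^sub>R i)"
    proof -
      have "box_bump n c d (x - \<tau> *\<^sub>R i) = ?\<theta> i ((x - \<tau> *\<^sub>R i) \<bullet> i) * (\<Prod>j\<in>Basis - {i}. ?\<theta> j ((x - \<tau> *\<^sub>R i) \<bullet> j))"
        unfolding box_bump_def using i by (subst prod.remove[of _ i]) auto
      moreover have "(\<Prod>j\<in>Basis - {i}. ?\<theta> j ((x - \<tau> *\<^sub>R i) \<bullet> j)) = ?R"
        using i by (intro prod.cong) (auto simp: inner_diff_left inner_not_same_Basis)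
      ultimately show ?thesis
        using i by (simp add: inner_diff_left)
    qed
    finally show ?thesis .
  qed
  ultimately show ?thesis
    using that by blast
qed

text \<open>Testing the weak gradient with the function of \<open>translation_test_function\<close> shows that \<open>w\<close> and its
  translate have the same integral against every bump. They agree almost everywhere, hence at
  \<open>x0\<close> by continuity.\<close>

lemma translation_invariance_of_zero_gradient:
  fixes w :: "'a::euclidean_space \<Rightarrow> real"
  assumes \<Omega>: "open \<Omega>" and w: "continuous_on \<Omega> w" and grad: "has_weak_gradient \<Omega> w (\<lambda>_. 0)"
    and i: "i \<in> Basis" and sub: "cbox (x0 - r *\<^sub>R One) (x0 + r *\<^sub>R One) \<subseteq> \<Omega>" and \<tau>: "\<bar>\<tau>\<bar> < r"
  shows "w (x0 + \<tau> *\<^sub>R i) = w x0"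
proof -
  let ?e = "\<tau> *\<^sub>R i"
  let ?lo = "x0 - r *\<^sub>R One" and ?hi = "x0 + r *\<^sub>R One"
  (* The closed cube of half-width delta and its translate both lie in the given cube. *)
  define \<delta> where "\<delta> = r - \<bar>\<tau>\<bar>"
  define a where "a = x0 - \<delta> *\<^sub>R One"
  define b where "b = x0 + \<delta> *\<^sub>R One"
  have \<delta>: "\<delta> > 0"
    using \<tau> by (simp add: \<delta>_def)
  have Q: "cbox a b \<subseteq> cbox ?lo ?hi"
    using \<delta> unfolding a_def b_def \<delta>_def
    by (auto simp: subset_box inner_diff_left inner_add_left)
  have shift: "x + ?e \<in> cbox ?lo ?hi" if "x \<in> cbox a b" for x
    unfolding mem_box
  proof
    fix j :: 'a assume j: "j \<in> Basis"
    have "\<bar>?e \<bullet> j\<bar> \<le> \<bar>\<tau>\<bar>"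
      using i j by (simp add: inner_Basis)
    then show "?lo \<bullet> j \<le> (x + ?e) \<bullet> j \<and> (x + ?e) \<bullet> j \<le> ?hi \<bullet> j"
      using that j unfolding a_def b_def mem_box \<delta>_def
      by (auto simp: inner_diff_left inner_add_left abs_le_iff dest!: bspec[of _ _ j])
  qed
  define W where "W x = indicator \<Omega> x * w x" for x
  have W_meas [measurable]: "W \<in> borel_measurable borel"
    using borel_measurable_continuous_on_indicator[OF _ w] \<Omega> by (simp add: W_def[abs_def])
  define h where "h x = W x - W (x + ?e)" for x
  have h_meas [measurable]: "h \<in> borel_measurable borel"
    unfolding h_def by measurable
  have h_eq: "h x = w x - w (x + ?e)" if "x \<in> cbox a b" for x
  proof -
    have "x \<in> \<Omega>" "x + ?e \<in> \<Omega>"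
      using that shift[OF that] Q sub by blast+
    then show ?thesis
      by (simp add: h_def W_def)
  qed
  have h_cont: "continuous_on (cbox a b) h"
  proof (subst continuous_on_cong[OF refl h_eq])
    show "continuous_on (cbox a b) (\<lambda>x. w x - w (x + ?e))"
      using Q sub shift
      by (intro continuous_intros continuous_on_subset[OF w] continuous_on_compose2[OF w]) auto
  qed
  have "AE x in lebesgue. x \<in> cbox a b \<longrightarrow> h x = 0"
  proof (rule zero_of_zero_bump_integrals)
    have "h integrable_on cbox a b" "continuous_on (cbox a b) h"
      using h_cont integrable_continuous by blast+
    then show "integrable (lebesgue_on (cbox a b)) h"
      using continuous_imp_integrable h_cont by blast
    fix c d n assume ne: "box c d \<noteq> {}" and cd: "cbox c d \<subseteq> cbox a b"
    let ?\<eta> = "box_bump n c d"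
    have \<eta>_test: "?\<eta> \<in> test_functions \<Omega>"
      using cd Q sub by (intro box_bump_test_function) auto
    have \<eta>_cont: "continuous_on UNIV ?\<eta>"
      using test_functionD(3)[OF \<eta>_test] .
    then have [measurable]: "?\<eta> \<in> borel_measurable borel"
      by (rule borel_measurable_continuous_onI)
    have \<eta>_supp: "?\<eta> x = 0" if "x \<notin> cbox a b" for x
      using that cd box_subset_cbox[of c d] box_bump_eq_0[of x c d n] by blast
    have "cbox (c + ?e) (d + ?e) \<subseteq> cbox ?lo ?hi"
    proof
      fix y assume "y \<in> cbox (c + ?e) (d + ?e)"
      then have "y - ?e \<in> cbox c d"
        by (auto simp: mem_box inner_add_left inner_diff_left algebra_simps)
      then show "y \<in> cbox ?lo ?hi"
        using shift[of "y - ?e"] cd by auto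
    qed
    then obtain \<phi> where \<phi>: "\<phi> \<in> test_functions \<Omega>"
      "\<And>x. frechet_derivative \<phi> (at x) i = ?\<eta> x - ?\<eta> (x - ?e)"
      using translation_test_function[OF i sub _ _ ne] cd Q by (metis order_trans)
    have zero: "(\<integral>x. w x * (?\<eta> x - ?\<eta> (x - ?e)) \<partial>lebesgue_on \<Omega>) = 0"
      using grad \<phi> i unfolding has_weak_gradient_def by force
    have loc: "locally_integrable \<Omega> w"
      using grad by (simp add: has_weak_gradient_def)
    have lb: "integral\<^sup>L (lebesgue_on \<Omega>) (\<lambda>x. w x * g x) = integral\<^sup>L lborel (\<lambda>x. W x * g x)"
      "integrable (lebesgue_on \<Omega>) (\<lambda>x. w x * g x) \<longleftrightarrow> integrable lborel (\<lambda>x. W x * g x)"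
      if [measurable]: "g \<in> borel_measurable borel" for g
    proof -
      have "(\<lambda>x. indicator \<Omega> x *\<^sub>R (w x * g x)) = (\<lambda>x. W x * g x)"
        by (simp add: W_def mult.assoc)
      then show "integral\<^sup>L (lebesgue_on \<Omega>) (\<lambda>x. w x * g x) = integral\<^sup>L lborel (\<lambda>x. W x * g x)"
        "integrable (lebesgue_on \<Omega>) (\<lambda>x. w x * g x) \<longleftrightarrow> integrable lborel (\<lambda>x. W x * g x)"
        using \<Omega> by (simp_all add: integral_restrict_space integrable_restrict_space
            integral_completion integrable_completion)
    qed
    have int1: "integrable lborel (\<lambda>x. W x * ?\<eta> x)"
      using integrable_test_function(1)[OF \<Omega> loc \<eta>_test] by (simp add: lb(2))
    have "integrable lborel (\<lambda>x. W x * (?\<eta> x - ?\<eta> (x - ?e)))"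
      using integrable_test_function(2)[OF \<Omega> loc \<phi>(1) i] unfolding \<phi>(2) by (simp add: lb(2))
    then have int2: "integrable lborel (\<lambda>x. W x * ?\<eta> (x - ?e))"
      using Bochner_Integration.integrable_diff[OF int1, of "\<lambda>x. W x * (?\<eta> x - ?\<eta> (x - ?e))"]
      by (simp add: algebra_simps)
    have distr: "integral\<^sup>L lborel G = integral\<^sup>L lborel (\<lambda>x. G (?e + x))"
      "integrable lborel G \<longleftrightarrow> integrable lborel (\<lambda>x. G (?e + x))"
      if [measurable]: "G \<in> borel_measurable borel" for G :: "'a \<Rightarrow> real"
    proof -
      show "integral\<^sup>L lborel G = integral\<^sup>L lborel (\<lambda>x. G (?e + x))"
        by (subst lborel_distr_plus[of ?e, symmetric], subst integral_distr) auto
      show "integrable lborel G \<longleftrightarrow> integrable lborel (\<lambda>x. G (?e + x))"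
        by (subst lborel_distr_plus[of ?e, symmetric], subst integrable_distr_eq) auto
    qed
    have int3: "integrable lborel (\<lambda>x. W (x + ?e) * ?\<eta> x)"
      using int2 by (subst (asm) distr(2)) (auto simp: add.commute)
    have "0 = (\<integral>x. W x * (?\<eta> x - ?\<eta> (x - ?e)) \<partial>lborel)"
      using zero by (simp add: lb(1))
    also have "\<dots> = (\<integral>x. W x * ?\<eta> x \<partial>lborel) - (\<integral>x. W x * ?\<eta> (x - ?e) \<partial>lborel)"
      using int1 int2 by (simp add: right_diff_distrib)
    also have "(\<integral>x. W x * ?\<eta> (x - ?e) \<partial>lborel) = (\<integral>x. W (x + ?e) * ?\<eta> x \<partial>lborel)"
      by (subst distr(1)) (auto simp: add.commute)
    also have "(\<integral>x. W x * ?\<eta> x \<partial>lborel) - \<dots> = (\<integral>x. h x * ?\<eta> x \<partial>lborel)"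
      using int1 int3 by (simp add: h_def left_diff_distrib)
    also have "\<dots> = (\<integral>x. h x * ?\<eta> x \<partial>lebesgue)"
      by (rule integral_completion[symmetric]) simp
    also have "\<dots> = (\<integral>x. h x * ?\<eta> x \<partial>lebesgue_on (cbox a b))"
    proof -
      have "(\<lambda>x. indicator (cbox a b) x *\<^sub>R (h x * ?\<eta> x)) = (\<lambda>x. h x * ?\<eta> x)"
        using \<eta>_supp by (auto simp: indicator_def fun_eq_iff)
      then show ?thesis
        by (subst integral_restrict_space) simp_all
    qed
    finally show "(\<integral>x. h x * ?\<eta> x \<partial>lebesgue_on (cbox a b)) = 0" by simp
  qed
  then have ae: "AE x in lebesgue. x \<notin> {x \<in> box a b. h x \<noteq> 0}"
    by eventually_elim (use box_subset_cbox[of a b] in auto)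
  have "open {x \<in> box a b. h x \<noteq> 0}"
  proof -
    have "continuous_on (box a b) h"
      using continuous_on_subset[OF h_cont box_subset_cbox] .
    then have "open (box a b \<inter> h -` (- {0}))"
      by (intro continuous_open_preimage) auto
    moreover have "box a b \<inter> h -` (- {0}) = {x \<in> box a b. h x \<noteq> 0}"
      by auto
    ultimately show ?thesis
      by simp
  qed
  moreover have "negligible {x \<in> box a b. h x \<noteq> 0}"
    using ae by (simp add: negligible_iff_null_sets completion.null_sets_iff_AE)
  ultimately have "{x \<in> box a b. h x \<noteq> 0} = {}"
    using open_not_negligible by blast
  moreover have "x0 \<in> box a b"
    using \<delta> by (auto simp: mem_box a_def b_def inner_diff_left inner_add_left)
  ultimately have "h x0 = 0"
    by blast
  then show ?thesis
    using h_eq[of x0] \<open>x0 \<in> box a b\<close> box_subset_cbox[of a b] by auto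
qed

text \<open>Along a line in a coordinate direction through \<open>x\<close>, the set where \<open>w\<close> takes the value \<open>w x\<close> is
  closed. If \<open>w x\<close> is not zero, this set avoids the frontier and is also open, by
  translation invariance. So it is the whole line, which does not fit into a bounded set.\<close>

lemma zero_gradient_zero_boundary_imp_zero:
  fixes w :: "'a::euclidean_space \<Rightarrow> real"
  assumes \<Omega>: "open \<Omega>" "bounded \<Omega>" and w: "continuous_on (closure \<Omega>) w"
    and grad: "has_weak_gradient \<Omega> w (\<lambda>_. 0)" and bd: "\<And>x. x \<in> frontier \<Omega> \<Longrightarrow> w x = 0"
    and x: "x \<in> \<Omega>"
  shows "w x = 0"
proof (rule ccontr)
  assume nz: "w x \<noteq> 0"
  obtain i :: 'a where i: "i \<in> Basis"
    using nonempty_Basis by blast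
  define T where "T = {t. x + t *\<^sub>R i \<in> closure \<Omega> \<and> w (x + t *\<^sub>R i) = w x}"
  have inside: "x + t *\<^sub>R i \<in> \<Omega>" if "t \<in> T" for t
    using that bd[of "x + t *\<^sub>R i"] nz \<Omega>(1) by (auto simp: T_def frontier_def interior_open)
  have line: "continuous_on UNIV (\<lambda>t. x + t *\<^sub>R i)"
    by (intro continuous_intros)
  have "closed T"
  proof -
    have cl: "closed ((\<lambda>t. x + t *\<^sub>R i) -` closure \<Omega>)"
      by (rule closed_vimage[OF closed_closure line])
    have "continuous_on ((\<lambda>t. x + t *\<^sub>R i) -` closure \<Omega>) (\<lambda>t. w (x + t *\<^sub>R i))"
      by (rule continuous_on_compose2[OF w continuous_on_subset[OF line]]) auto
    from continuous_closed_preimage_constant[OF this cl, of "w x"]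
    show ?thesis
      by (simp add: T_def vimage_def)
  qed
  moreover have "open T"
    unfolding open_dist
  proof
    fix t assume t: "t \<in> T"
    let ?y = "x + t *\<^sub>R i"
    obtain s where s: "s > 0" "ball ?y s \<subseteq> \<Omega>"
      using \<Omega>(1) inside[OF t] open_contains_ball by blast
    define r where "r = s / (2 * real DIM('a))"
    have r: "r > 0"
      using s(1) by (simp add: r_def)
    have sub: "cbox (?y - r *\<^sub>R One) (?y + r *\<^sub>R One) \<subseteq> \<Omega>"
    proof
      fix z assume z: "z \<in> cbox (?y - r *\<^sub>R One) (?y + r *\<^sub>R One)"
      have "norm (z - ?y) \<le> (\<Sum>j\<in>Basis. \<bar>(z - ?y) \<bullet> j\<bar>)"
        by (rule norm_le_l1)
      also have "\<dots> \<le> (\<Sum>j\<in>(Basis::'a set). r)"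
        using z by (intro sum_mono) (auto simp: mem_box inner_diff_left inner_add_left abs_le_iff algebra_simps)
      also have "\<dots> < s"
        using s(1) by (simp add: r_def)
      finally show "z \<in> \<Omega>"
        using s(2) by (auto simp: dist_norm norm_minus_commute)
    qed
    have "t' \<in> T" if "dist t' t < r" for t'
    proof -
      have \<tau>: "\<bar>t' - t\<bar> < r"
        using that by (simp add: dist_real_def)
      have eq: "?y + (t' - t) *\<^sub>R i = x + t' *\<^sub>R i"
        by (simp add: algebra_simps)
      have "w (x + t' *\<^sub>R i) = w ?y"
        using translation_invariance_of_zero_gradient[OF \<Omega>(1) _ grad i sub \<tau>]
          continuous_on_subset[OF w closure_subset] eq by simp
      moreover have "x + t' *\<^sub>R i \<in> cbox (?y - r *\<^sub>R One) (?y + r *\<^sub>R One)"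
        unfolding eq[symmetric] mem_box
      proof
        fix j :: 'a assume "j \<in> Basis"
        then have "\<bar>((t' - t) *\<^sub>R i) \<bullet> j\<bar> \<le> r"
          using \<tau> r i by (simp add: inner_Basis)
        then show "(?y - r *\<^sub>R One) \<bullet> j \<le> (?y + (t' - t) *\<^sub>R i) \<bullet> j \<and>
            (?y + (t' - t) *\<^sub>R i) \<bullet> j \<le> (?y + r *\<^sub>R One) \<bullet> j"
          using \<open>j \<in> Basis\<close> by (simp add: inner_add_left inner_diff_left abs_le_iff)
      qed
      ultimately show ?thesis
        using t sub closure_subset by (auto simp: T_def)
    qed
    then show "\<exists>e>0. \<forall>t'. dist t' t < e \<longrightarrow> t' \<in> T"
      using r by blast
  qed
  ultimately have "T = {} \<or> T = UNIV"
    using clopen[of T] by blast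
  moreover have "0 \<in> T"
    using x closure_subset by (auto simp: T_def)
  ultimately have all: "x + t *\<^sub>R i \<in> \<Omega>" for t
    using inside by blast
  obtain C where C: "\<And>z. z \<in> \<Omega> \<Longrightarrow> norm z \<le> C"
    using \<Omega>(2) by (auto simp: bounded_iff)
  have "norm ((C + norm x + 1) *\<^sub>R i) \<le> norm (x + (C + norm x + 1) *\<^sub>R i) + norm x"
    using norm_triangle_ineq4[of "x + (C + norm x + 1) *\<^sub>R i" x] by simp
  then have "\<bar>C + norm x + 1\<bar> \<le> C + norm x"
    using C[OF all[of "C + norm x + 1"]] i by simp
  then show False
    by simp
qed


section \<open>Convex energies on a finite-dimensional space\<close>

text \<open>A family of energy densities \<open>\<Phi> x\<close> with fluxes \<open>A x\<close>, the gradients of \<open>\<Phi> x\<close>. Differentiability is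
  replaced by the strict subgradient inequality together with continuity of the flux: this
  suffices for the Euler-Lagrange equation and spares differentiation under the integral.\<close>

locale convex_density =
  fixes M :: "'a measure" and \<Phi> :: "'a \<Rightarrow> 'e::euclidean_space \<Rightarrow> real" and A :: "'a \<Rightarrow> 'e \<Rightarrow> 'e"
  assumes subgradient: "x \<in> space M \<Longrightarrow> z \<noteq> w \<Longrightarrow> \<Phi> x z + A x z \<bullet> (w - z) < \<Phi> x w"
    and continuous_flux: "x \<in> space M \<Longrightarrow> continuous_on UNIV (A x)"
    and measurable_density: "G \<in> borel_measurable M \<Longrightarrow> (\<lambda>x. \<Phi> x (G x)) \<in> borel_measurable M"
    and measurable_flux: "G \<in> borel_measurable M \<Longrightarrow> (\<lambda>x. A x (G x)) \<in> borel_measurable M"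
    and locally_bounded:
      "\<exists>K. \<forall>x\<in>space M. \<forall>z. norm z \<le> R \<longrightarrow> \<bar>\<Phi> x z\<bar> \<le> K \<and> norm (A x z) \<le> K"
    and superlinear: "\<exists>K. \<forall>x\<in>space M. \<forall>z. k * norm z - K \<le> \<Phi> x z"
begin

lemma subgradient_le: "x \<in> space M \<Longrightarrow> \<Phi> x z + A x z \<bullet> (w - z) \<le> \<Phi> x w"
  using subgradient[of x z w] by (cases "z = w") auto

lemma convex_combination:
  assumes x: "x \<in> space M" and t: "0 \<le> t" "t \<le> 1"
  shows "\<Phi> x ((1 - t) *\<^sub>R z + t *\<^sub>R w) \<le> (1 - t) * \<Phi> x z + t * \<Phi> x w"
proof -
  define v where "v = (1 - t) *\<^sub>R z + t *\<^sub>R w"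
  have "(1 - t) * (\<Phi> x v + A x v \<bullet> (z - v)) \<le> (1 - t) * \<Phi> x z"
    using t subgradient_le[OF x] by (intro mult_left_mono) auto
  moreover have "t * (\<Phi> x v + A x v \<bullet> (w - v)) \<le> t * \<Phi> x w"
    using t subgradient_le[OF x] by (intro mult_left_mono) auto
  moreover have "(1 - t) * (A x v \<bullet> (z - v)) + t * (A x v \<bullet> (w - v)) = 0"
  proof -
    have "(1 - t) *\<^sub>R (z - v) + t *\<^sub>R (w - v) = 0"
      unfolding v_def by (simp add: algebra_simps)
    then show ?thesis
      by (metis inner_add_right inner_scaleR_right inner_zero_right)
  qed
  ultimately show ?thesis
    unfolding v_def[symmetric] by (simp add: algebra_simps)
qed

end

text \<open>The functions \<open>g b\<close> stand for the gradients of the basis functions, and their linear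
  independence makes the size of a gradient comparable with that of its coefficients. Coefficient vectors are functions
  on the whole index type, of which only the values on \<open>B\<close> matter.\<close>

locale galerkin_space = finite_measure M for M :: "'a measure" +
  fixes B :: "'b set" and g :: "'b \<Rightarrow> 'a \<Rightarrow> 'e::euclidean_space" and C :: real
  assumes finite_B: "finite B"
    and measurable_g: "b \<in> B \<Longrightarrow> g b \<in> borel_measurable M"
    and bounded_g: "b \<in> B \<Longrightarrow> x \<in> space M \<Longrightarrow> norm (g b x) \<le> C"
    and C_nonneg: "0 \<le> C"
    and independent_g: "(AE x in M. (\<Sum>b\<in>B. c b *\<^sub>R g b x) = 0) \<Longrightarrow> b \<in> B \<Longrightarrow> c b = 0"
begin

definition comb :: "('b \<Rightarrow> real) \<Rightarrow> 'a \<Rightarrow> 'e" where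
  "comb c x = (\<Sum>b\<in>B. c b *\<^sub>R g b x)"

definition coeff_norm :: "('b \<Rightarrow> real) \<Rightarrow> real" where
  "coeff_norm c = (\<Sum>b\<in>B. \<bar>c b\<bar>)"

definition total_energy :: "('a \<Rightarrow> 'e \<Rightarrow> real) \<Rightarrow> ('b \<Rightarrow> real) \<Rightarrow> ('b \<Rightarrow> real) \<Rightarrow> real" where
  "total_energy \<Phi> l c = (\<integral>x. \<Phi> x (comb c x) \<partial>M) - (\<Sum>b\<in>B. c b * l b)"

definition galerkin_solution :: "('a \<Rightarrow> 'e \<Rightarrow> 'e) \<Rightarrow> ('b \<Rightarrow> real) \<Rightarrow> ('b \<Rightarrow> real) \<Rightarrow> bool" where
  "galerkin_solution A l c \<longleftrightarrow> (\<forall>b\<in>B. (\<integral>x. A x (comb c x) \<bullet> g b x \<partial>M) = l b)"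

lemma measurable_comb [measurable]: "comb c \<in> borel_measurable M"
  unfolding comb_def using measurable_g by measurable

lemma norm_comb: "x \<in> space M \<Longrightarrow> norm (comb c x) \<le> C * coeff_norm c"
  unfolding comb_def coeff_norm_def sum_distrib_left
  by (intro sum_norm_le) (simp add: mult.commute[of C] mult_left_mono bounded_g)

lemma comb_diff: "comb (\<lambda>b. c b - c' b) x = comb c x - comb c' x"
  unfolding comb_def by (simp add: scaleR_left_diff_distrib sum_subtractf)

lemma comb_add: "comb (\<lambda>b. c b + c' b) x = comb c x + comb c' x"
  unfolding comb_def by (simp add: scaleR_left_distrib sum.distrib)

lemma comb_scale: "comb (\<lambda>b. s * c b) x = s *\<^sub>R comb c x"
  unfolding comb_def by (simp add: scaleR_right.sum)

lemma coeff_norm_nonneg [simp]: "0 \<le> coeff_norm c"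
  unfolding coeff_norm_def by (simp add: sum_nonneg)

lemma coeff_norm_scale: "coeff_norm (\<lambda>b. s * c b) = \<bar>s\<bar> * coeff_norm c"
  unfolding coeff_norm_def by (simp add: abs_mult sum_distrib_left)

lemma coeff_norm_triangle: "coeff_norm (\<lambda>b. c b + c' b) \<le> coeff_norm c + coeff_norm c'"
  unfolding coeff_norm_def sum.distrib[symmetric] by (intro sum_mono) auto

lemma coeff_norm_eq_0: "coeff_norm c = 0 \<longleftrightarrow> (\<forall>b\<in>B. c b = 0)"
  unfolding coeff_norm_def using finite_B by (simp add: sum_nonneg_eq_0_iff)

text \<open>Lipschitz continuity on bounded sets also expresses that the functional does not see coefficients
  outside \<open>B\<close>, as \<open>coeff_norm\<close> is only a seminorm.\<close>

definition locally_lipschitz :: "(('b \<Rightarrow> real) \<Rightarrow> real) \<Rightarrow> bool" where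
  "locally_lipschitz L \<longleftrightarrow> (\<forall>R. \<exists>K. \<forall>c c'. coeff_norm c \<le> R \<longrightarrow> coeff_norm c' \<le> R \<longrightarrow>
      \<bar>L c - L c'\<bar> \<le> K * coeff_norm (\<lambda>b. c b - c' b))"

text \<open>Coefficient vectors that vanish outside \<open>B\<close> and are bounded form a compact set in the product
  topology, by Tychonoff's theorem.\<close>

lemma attains_min:
  assumes L: "locally_lipschitz L" and I: "closed I" "I \<subseteq> {..R}" and ne: "\<exists>c. coeff_norm c \<in> I"
  obtains c where "coeff_norm c \<in> I" "\<And>c'. coeff_norm c' \<in> I \<Longrightarrow> L c \<le> L c'"
proof -
  obtain K where K: "\<And>c c'. coeff_norm c \<le> R \<Longrightarrow> coeff_norm c' \<le> R \<Longrightarrow>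
      \<bar>L c - L c'\<bar> \<le> K * coeff_norm (\<lambda>b. c b - c' b)"
    using L unfolding locally_lipschitz_def by meson
  define Q where "Q = (PiE UNIV (\<lambda>b. if b \<in> B then {-R..R} else {0}) :: ('b \<Rightarrow> real) set)"
  define S where "S = Q \<inter> {c. coeff_norm c \<in> I}"
  (* Setting the coefficients outside B to zero changes neither the seminorm nor L. *)
  define cut where "cut c b = (if b \<in> B then c b else 0)" for c :: "'b \<Rightarrow> real" and b
  have cut_norm: "coeff_norm (cut c) = coeff_norm c" for c
    by (simp add: coeff_norm_def cut_def)
  have cut_L: "L (cut c) = L c" if "coeff_norm c \<in> I" for c
  proof -
    have "coeff_norm (\<lambda>b. cut c b - c b) = 0"
      unfolding coeff_norm_eq_0 by (simp add: cut_def)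
    then show ?thesis
      using K[of "cut c" c] that I(2) by (auto simp: cut_norm)
  qed
  have cut_S: "cut c \<in> S" if "coeff_norm c \<in> I" for c
  proof -
    have "\<bar>c b\<bar> \<le> R" if "b \<in> B" for b
    proof -
      have "\<bar>c b\<bar> \<le> coeff_norm c"
        unfolding coeff_norm_def using finite_B that by (intro member_le_sum) auto
      then show ?thesis
        using \<open>coeff_norm c \<in> I\<close> I(2) by auto
    qed
    then have "cut c b \<in> (if b \<in> B then {-R..R} else {0})" for b
      by (auto simp: cut_def abs_le_iff minus_le_iff)
    then show ?thesis
      using that by (auto simp: S_def Q_def cut_norm PiE_iff)
  qed
  have Q: "compact Q"
  proof -
    have "compactin (product_topology (\<lambda>i. euclidean) UNIV) Q"
      unfolding Q_def compactin_PiE by auto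
    then show ?thesis
      by (simp add: euclidean_product_topology)
  qed
  have coord: "continuous_on T (\<lambda>c. c b)" for T and b :: 'b
    by (rule continuous_on_subset[OF continuous_on_product_coordinates]) simp
  have cn: "continuous_on UNIV coeff_norm"
    unfolding coeff_norm_def by (intro continuous_intros coord)
  have "closed {c. coeff_norm c \<in> I}"
    using closed_vimage[OF I(1) cn] by (simp add: vimage_def)
  then have S: "compact S"
    unfolding S_def using Q by (simp add: compact_Int_closed)
  have "continuous_on S L"
    unfolding continuous_on_def
  proof
    fix c assume c: "c \<in> S"
    have "((\<lambda>c'. c' b) \<longlongrightarrow> c b) (at c within S)" for b
      using coord[of S b] c by (simp add: continuous_on_def)
    then have "((\<lambda>c'. K * (\<Sum>b\<in>B. \<bar>c' b - c b\<bar>)) \<longlongrightarrow> K * (\<Sum>b\<in>B. \<bar>c b - c b\<bar>))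
        (at c within S)"
      by (intro tendsto_intros)
    then have lim: "((\<lambda>c'. K * coeff_norm (\<lambda>b. c' b - c b)) \<longlongrightarrow> 0) (at c within S)"
      by (simp add: coeff_norm_def)
    have "\<forall>\<^sub>F c' in at c within S. norm (L c' - L c) \<le> K * coeff_norm (\<lambda>b. c' b - c b)"
      using c I(2) by (auto simp: eventually_at_filter S_def intro!: always_eventually K)
    then have "((\<lambda>c'. L c' - L c) \<longlongrightarrow> 0) (at c within S)"
      by (rule Lim_null_comparison[OF _ lim])
    then show "(L \<longlongrightarrow> L c) (at c within S)"
      by (simp add: LIM_zero_iff)
  qed
  moreover have "S \<noteq> {}"
    using ne cut_S by auto
  ultimately obtain c where c: "c \<in> S" "\<And>c'. c' \<in> S \<Longrightarrow> L c \<le> L c'"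
    using continuous_attains_inf[OF S] by blast
  show ?thesis
  proof (rule that)
    show "coeff_norm c \<in> I"
      using c(1) by (simp add: S_def)
    show "L c \<le> L c'" if "coeff_norm c' \<in> I" for c'
      using c(2)[OF cut_S[OF that]] cut_L[OF that] by simp
  qed
qed

lemma integrable_bounded:
  fixes h :: "'a \<Rightarrow> 'c::{banach, second_countable_topology}"
  assumes "h \<in> borel_measurable M" "\<And>x. x \<in> space M \<Longrightarrow> norm (h x) \<le> K"
  shows "integrable M h"
  by (rule integrable_const_bound[of _ K]) (use assms in auto)

lemma integrable_comb: "integrable M (\<lambda>x. norm (comb c x))"
  by (rule integrable_bounded[of _ "C * coeff_norm c"]) (auto simp: norm_comb)

text \<open>Equivalence of norms in finite dimension: by linear independence the integral is positive on the
  compact unit sphere.\<close>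

lemma integral_norm_comb_lower_bound:
  obtains m where "m > 0" "\<And>c. m * coeff_norm c \<le> (\<integral>x. norm (comb c x) \<partial>M)"
proof (cases "\<exists>c. coeff_norm c = 1")
  case False
  have "coeff_norm c = 0" for c
  proof (rule ccontr)
    assume "coeff_norm c \<noteq> 0"
    then have "coeff_norm (\<lambda>b. (1 / coeff_norm c) * c b) = 1"
      by (simp only: coeff_norm_scale) (simp add: abs_of_nonneg)
    then show False
      using False by blast
  qed
  then show ?thesis
    using that[of 1] by simp
next
  case True
  let ?N = "\<lambda>c. \<integral>x. norm (comb c x) \<partial>M"
  have "locally_lipschitz ?N"
    unfolding locally_lipschitz_def
  proof (intro allI exI impI)
    fix c c' :: "'b \<Rightarrow> real"
    have "\<bar>?N c - ?N c'\<bar> = \<bar>\<integral>x. norm (comb c x) - norm (comb c' x) \<partial>M\<bar>"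
      by (simp add: integrable_comb Bochner_Integration.integral_diff)
    also have "\<dots> \<le> (\<integral>x. \<bar>norm (comb c x) - norm (comb c' x)\<bar> \<partial>M)"
      by (rule integral_abs_bound)
    also have "\<dots> \<le> (\<integral>x. C * coeff_norm (\<lambda>b. c b - c' b) \<partial>M)"
    proof (rule integral_mono)
      show "\<bar>norm (comb c x) - norm (comb c' x)\<bar> \<le> C * coeff_norm (\<lambda>b. c b - c' b)"
        if "x \<in> space M" for x
        using norm_comb[OF that, of "\<lambda>b. c b - c' b"] norm_triangle_ineq3[of "comb c x" "comb c' x"]
        by (simp add: comb_diff)
    qed (auto intro!: integrable_comb integrable_abs Bochner_Integration.integrable_diff)
    finally show "\<bar>?N c - ?N c'\<bar> \<le> (measure M (space M) * C) * coeff_norm (\<lambda>b. c b - c' b)"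
      by simp
  qed
  then obtain c0 where c0: "coeff_norm c0 \<in> {1}" "\<And>c'. coeff_norm c' \<in> {1} \<Longrightarrow> ?N c0 \<le> ?N c'"
    using attains_min[of ?N "{1}" 1] True by auto
  have "?N c0 \<noteq> 0"
  proof
    assume "?N c0 = 0"
    then have "AE x in M. norm (comb c0 x) = 0"
      using integral_nonneg_eq_0_iff_AE[OF integrable_comb[of c0]] by simp
    then have "\<forall>b\<in>B. c0 b = 0"
      using independent_g[of c0] by (auto simp: comb_def)
    then show False
      using c0(1) coeff_norm_eq_0[of c0] by simp
  qed
  then have pos: "?N c0 > 0"
    by (simp add: order_less_le)
  moreover have "?N c0 * coeff_norm c \<le> ?N c" for c
  proof (cases "coeff_norm c = 0")
    case False
    define s where "s = 1 / coeff_norm c"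
    have s: "s > 0"
      using False by (simp add: s_def order_less_le)
    have "coeff_norm (\<lambda>b. s * c b) = 1"
      unfolding coeff_norm_scale using False s by (simp add: s_def)
    then have "?N c0 \<le> ?N (\<lambda>b. s * c b)"
      using c0(2) by simp
    also have "\<dots> = s * ?N c"
      using s by (simp add: comb_scale)
    finally have "?N c0 * coeff_norm c \<le> s * ?N c * coeff_norm c"
      by (simp add: mult_right_mono)
    then show ?thesis
      using False by (simp add: s_def)
  qed simp
  ultimately show ?thesis
    using that by blast
qed

context
  fixes \<Phi> :: "'a \<Rightarrow> 'e \<Rightarrow> real" and A :: "'a \<Rightarrow> 'e \<Rightarrow> 'e" and l :: "'b \<Rightarrow> real"
  assumes dens: "convex_density M \<Phi> A"
begin

interpretation convex_density M \<Phi> A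
  by (rule dens)

lemma integrable_density: "integrable M (\<lambda>x. \<Phi> x (comb c x))"
proof -
  obtain K where K: "\<forall>x\<in>space M. \<forall>z. norm z \<le> C * coeff_norm c \<longrightarrow> \<bar>\<Phi> x z\<bar> \<le> K \<and> norm (A x z) \<le> K"
    using locally_bounded by meson
  show ?thesis
    by (rule integrable_bounded[of _ K]) (use K norm_comb measurable_density in auto)
qed

lemma integrable_flux: "integrable M (\<lambda>x. A x (comb c x) \<bullet> comb c' x)"
proof -
  obtain K where K: "\<forall>x\<in>space M. \<forall>z. norm z \<le> C * coeff_norm c \<longrightarrow> \<bar>\<Phi> x z\<bar> \<le> K \<and> norm (A x z) \<le> K"
    using locally_bounded by meson
  show ?thesis
  proof (rule integrable_bounded)
    show "(\<lambda>x. A x (comb c x) \<bullet> comb c' x) \<in> borel_measurable M"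
      using measurable_flux[of "comb c"] by measurable
    fix x assume x: "x \<in> space M"
    have "norm (A x (comb c x) \<bullet> comb c' x) \<le> norm (A x (comb c x)) * norm (comb c' x)"
      by (simp add: Cauchy_Schwarz_ineq2)
    also have "\<dots> \<le> K * (C * coeff_norm c')"
      using K x norm_comb[OF x] order_trans[OF norm_ge_zero] by (intro mult_mono) blast+
    finally show "norm (A x (comb c x) \<bullet> comb c' x) \<le> K * (C * coeff_norm c')" .
  qed
qed

lemma comb_unit: "b \<in> B \<Longrightarrow> comb (\<lambda>a. if a = b then 1 else 0) x = g b x"
  unfolding comb_def using finite_B by (simp add: if_distrib[of "\<lambda>s. s *\<^sub>R _"] sum.delta cong: if_cong)

lemma integrable_flux_g: "b \<in> B \<Longrightarrow> integrable M (\<lambda>x. A x (comb c x) \<bullet> g b x)"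
  using integrable_flux[of c "\<lambda>a. if a = b then 1 else 0"] by (simp add: comb_unit)

lemma galerkin_solution_test:
  assumes "galerkin_solution A l c"
  shows "(\<integral>x. A x (comb c x) \<bullet> comb c' x \<partial>M) = (\<Sum>b\<in>B. c' b * l b)"
proof -
  have "(\<integral>x. A x (comb c x) \<bullet> comb c' x \<partial>M) = (\<integral>x. (\<Sum>b\<in>B. c' b * (A x (comb c x) \<bullet> g b x)) \<partial>M)"
    unfolding comb_def[of c'] by (simp add: inner_sum_right)
  also have "\<dots> = (\<Sum>b\<in>B. c' b * (\<integral>x. A x (comb c x) \<bullet> g b x \<partial>M))"
    by (subst Bochner_Integration.integral_sum) (auto simp: integrable_flux_g)
  also have "\<dots> = (\<Sum>b\<in>B. c' b * l b)"
    using assms by (simp add: galerkin_solution_def)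
  finally show ?thesis .
qed

text \<open>The integrated subgradient inequality at \<open>c\<close>.\<close>

lemma energy_diff_le:
  "total_energy \<Phi> l c - total_energy \<Phi> l c' \<le>
     (\<integral>x. A x (comb c x) \<bullet> comb (\<lambda>b. c b - c' b) x \<partial>M) - (\<Sum>b\<in>B. (c b - c' b) * l b)"
proof -
  have "(\<integral>x. \<Phi> x (comb c x) - \<Phi> x (comb c' x) \<partial>M) \<le>
      (\<integral>x. A x (comb c x) \<bullet> comb (\<lambda>b. c b - c' b) x \<partial>M)"
  proof (rule integral_mono)
    show "\<Phi> x (comb c x) - \<Phi> x (comb c' x) \<le> A x (comb c x) \<bullet> comb (\<lambda>b. c b - c' b) x"
      if "x \<in> space M" for x
      using subgradient_le[OF that, of "comb c x" "comb c' x"]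
      by (simp add: comb_diff inner_diff_right)
  qed (intro integrable_flux integrable_density Bochner_Integration.integrable_diff)+
  then show ?thesis
    unfolding total_energy_def
    by (simp add: integrable_density Bochner_Integration.integral_diff left_diff_distrib sum_subtractf)
qed

lemma galerkin_solution_imp_minimiser:
  assumes "galerkin_solution A l c"
  shows "total_energy \<Phi> l c \<le> total_energy \<Phi> l c'"
  using energy_diff_le[of c c'] galerkin_solution_test[OF assms, of "\<lambda>b. c b - c' b"] by simp

lemma galerkin_solution_strict_minimiser:
  assumes sol: "galerkin_solution A l c" and b: "b \<in> B" "c b \<noteq> c' b"
  shows "total_energy \<Phi> l c < total_energy \<Phi> l c'"
proof (rule ccontr)
  let ?d = "\<lambda>x. \<Phi> x (comb c' x) - \<Phi> x (comb c x) - A x (comb c x) \<bullet> comb (\<lambda>b. c' b - c b) x"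
  assume "\<not> ?thesis"
  then have le: "(\<integral>x. \<Phi> x (comb c' x) \<partial>M) - (\<integral>x. \<Phi> x (comb c x) \<partial>M) -
      (\<Sum>b\<in>B. (c' b - c b) * l b) \<le> 0"
    by (simp add: total_energy_def left_diff_distrib sum_subtractf)
  have int: "integrable M ?d"
    by (intro integrable_flux integrable_density Bochner_Integration.integrable_diff)
  have "(\<integral>x. ?d x \<partial>M) = (\<integral>x. \<Phi> x (comb c' x) \<partial>M) - (\<integral>x. \<Phi> x (comb c x) \<partial>M) -
      (\<Sum>b\<in>B. (c' b - c b) * l b)"
    by (simp add: integrable_flux integrable_density galerkin_solution_test[OF sol])
  with le have le0: "(\<integral>x. ?d x \<partial>M) \<le> 0"
    by simp
  have nonneg: "?d x \<ge> 0" if "x \<in> space M" for x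
    using subgradient_le[OF that, of "comb c x" "comb c' x"] by (simp add: comb_diff)
  have "(\<integral>x. ?d x \<partial>M) = 0"
    using le0 Bochner_Integration.integral_nonneg[of M ?d, OF nonneg] by (rule antisym)
  then have "AE x in M. ?d x = 0"
    using integral_nonneg_eq_0_iff_AE[OF int] nonneg by (auto simp: AE_I2)
  then have "AE x in M. comb (\<lambda>b. c' b - c b) x = 0"
  proof (rule AE_mp, intro AE_I2 impI)
    fix x assume "x \<in> space M" "?d x = 0"
    then show "comb (\<lambda>b. c' b - c b) x = 0"
      using subgradient[of x "comb c x" "comb c' x"] by (force simp: comb_diff)
  qed
  then have "c' b - c b = 0"
    using independent_g[of "\<lambda>b. c' b - c b"] b(1) unfolding comb_def by blast
  then show False
    using b(2) by simp
qed

lemma galerkin_solution_unique: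
  assumes "galerkin_solution A l c" "galerkin_solution A l c'" "b \<in> B"
  shows "c b = c' b"
  using galerkin_solution_strict_minimiser[OF assms(1,3), of c']
    galerkin_solution_imp_minimiser[OF assms(2), of c] by force

lemma linear_part_bound: "\<bar>\<Sum>b\<in>B. c b * l b\<bar> \<le> coeff_norm l * coeff_norm c"
proof -
  have "\<bar>\<Sum>b\<in>B. c b * l b\<bar> \<le> (\<Sum>b\<in>B. \<bar>c b\<bar> * \<bar>l b\<bar>)"
    by (rule order_trans[OF sum_abs]) (simp add: abs_mult)
  also have "\<dots> \<le> (\<Sum>b\<in>B. \<bar>c b\<bar> * coeff_norm l)"
    unfolding coeff_norm_def using finite_B by (intro sum_mono mult_left_mono member_le_sum) auto
  finally show ?thesis
    by (simp add: coeff_norm_def[of c] sum_distrib_left mult.commute)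
qed

text \<open>Fluxes are bounded on bounded sets, and a convex function is Lipschitz with its subgradients as
  constants.\<close>

lemma locally_lipschitz_energy: "locally_lipschitz (total_energy \<Phi> l)"
  unfolding locally_lipschitz_def
proof
  fix R :: real
  obtain K where K: "\<forall>x\<in>space M. \<forall>z. norm z \<le> C * R \<longrightarrow> \<bar>\<Phi> x z\<bar> \<le> K \<and> norm (A x z) \<le> K"
    using locally_bounded by meson
  define D where "D = measure M (space M) * (K * C) + coeff_norm l"
  have one: "total_energy \<Phi> l c - total_energy \<Phi> l c' \<le> D * coeff_norm (\<lambda>b. c b - c' b)"
    if "coeff_norm c \<le> R" for c c'
  proof -
    have "(\<integral>x. A x (comb c x) \<bullet> comb (\<lambda>b. c b - c' b) x \<partial>M) \<le>
        (\<integral>x. K * (C * coeff_norm (\<lambda>b. c b - c' b)) \<partial>M)"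
    proof (rule integral_mono)
      fix x assume x: "x \<in> space M"
      have "norm (comb c x) \<le> C * R"
        using norm_comb[OF x, of c] that C_nonneg by (meson mult_left_mono order_trans)
      then have "norm (A x (comb c x)) \<le> K"
        using K x by blast
      then have "norm (A x (comb c x)) * norm (comb (\<lambda>b. c b - c' b) x) \<le>
          K * (C * coeff_norm (\<lambda>b. c b - c' b))"
        using norm_comb[OF x] order_trans[OF norm_ge_zero] by (intro mult_mono) blast+
      then show "A x (comb c x) \<bullet> comb (\<lambda>b. c b - c' b) x \<le> K * (C * coeff_norm (\<lambda>b. c b - c' b))"
        using norm_cauchy_schwarz order_trans by blast
    qed (auto intro: integrable_flux)
    then show ?thesis
      using energy_diff_le[of c c'] linear_part_bound[of "\<lambda>b. c b - c' b"]
      by (simp add: D_def algebra_simps)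
  qed
  have sym: "coeff_norm (\<lambda>b. c' b - c b) = coeff_norm (\<lambda>b. c b - c' b)" for c c'
    by (simp add: coeff_norm_def abs_minus_commute)
  show "\<exists>K. \<forall>c c'. coeff_norm c \<le> R \<longrightarrow> coeff_norm c' \<le> R \<longrightarrow>
      \<bar>total_energy \<Phi> l c - total_energy \<Phi> l c'\<bar> \<le> K * coeff_norm (\<lambda>b. c b - c' b)"
  proof (intro exI[of _ D] allI impI)
    fix c c' :: "'b \<Rightarrow> real"
    assume "coeff_norm c \<le> R" "coeff_norm c' \<le> R"
    then show "\<bar>total_energy \<Phi> l c - total_energy \<Phi> l c'\<bar> \<le> D * coeff_norm (\<lambda>b. c b - c' b)"
      using one[of c c'] one[of c' c] sym[of c' c] by simp
  qed
qed

text \<open>The slope \<open>k\<close> of the linear lower bound of the density is chosen so large that it dominates the load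
  and leaves slope one.\<close>

lemma energy_coercive:
  obtains K where "\<And>c. coeff_norm c - K \<le> total_energy \<Phi> l c"
proof -
  obtain m where m: "m > 0" "\<And>c. m * coeff_norm c \<le> (\<integral>x. norm (comb c x) \<partial>M)"
    using integral_norm_comb_lower_bound by metis
  (* The load costs at most coeff_norm l times coeff_norm c; one more unit is left as growth. *)
  define k where "k = (coeff_norm l + 1) / m"
  have k: "k \<ge> 0" "k * m = coeff_norm l + 1"
    using m(1) by (auto simp: k_def)
  obtain K where K: "\<forall>x\<in>space M. \<forall>z. k * norm z - K \<le> \<Phi> x z"
    using superlinear by meson
  have "coeff_norm c - measure M (space M) * K \<le> total_energy \<Phi> l c" for c
  proof -
    have "(\<integral>x. k * norm (comb c x) - K \<partial>M) \<le> (\<integral>x. \<Phi> x (comb c x) \<partial>M)"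
      using K by (intro integral_mono integrable_density Bochner_Integration.integrable_diff
          integrable_mult_right integrable_comb) auto
    moreover have "(\<integral>x. k * norm (comb c x) - K \<partial>M) =
        k * (\<integral>x. norm (comb c x) \<partial>M) - measure M (space M) * K"
      by (simp add: integrable_comb)
    moreover have "k * (m * coeff_norm c) \<le> k * (\<integral>x. norm (comb c x) \<partial>M)"
      using k(1) m(2) by (intro mult_left_mono)
    moreover have "k * (m * coeff_norm c) = (coeff_norm l + 1) * coeff_norm c"
      using k(2) by (simp flip: mult.assoc)
    ultimately show ?thesis
      using linear_part_bound[of c] unfolding total_energy_def by (simp add: algebra_simps)
  qed
  then show ?thesis
    using that by blast
qed

lemma minimiser_exists:
  obtains c where "\<And>c'. total_energy \<Phi> l c \<le> total_energy \<Phi> l c'"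
proof -
  obtain K where K: "\<And>c. coeff_norm c - K \<le> total_energy \<Phi> l c"
    using energy_coercive by metis
  let ?z = "\<lambda>b. 0 :: real"
  define R where "R = max 0 (total_energy \<Phi> l ?z + K)"
  have z: "coeff_norm ?z \<in> {..R}"
    by (simp add: coeff_norm_def R_def)
  then obtain c where c: "\<And>c'. coeff_norm c' \<in> {..R} \<Longrightarrow> total_energy \<Phi> l c \<le> total_energy \<Phi> l c'"
    using attains_min[OF locally_lipschitz_energy closed_atMost order_refl] by metis
  have "total_energy \<Phi> l c \<le> total_energy \<Phi> l c'" for c'
  proof (cases "coeff_norm c' \<le> R")
    case False
    then have "total_energy \<Phi> l ?z \<le> total_energy \<Phi> l c'"
      using K[of c'] by (simp add: R_def)
    then show ?thesis
      using c[OF z] by simp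
  qed (use c in simp)
  then show ?thesis
    using that by blast
qed

lemma flux_tendsto:
  assumes t: "t \<longlonglongrightarrow> 0" "\<And>n. \<bar>t n\<bar> \<le> 1"
  shows "(\<lambda>n. \<integral>x. A x (comb (\<lambda>b. c b + t n * e b) x) \<bullet> comb e x \<partial>M)
      \<longlonglongrightarrow> (\<integral>x. A x (comb c x) \<bullet> comb e x \<partial>M)"
proof -
  define R where "R = C * (coeff_norm c + coeff_norm e)"
  obtain K where K: "\<forall>x\<in>space M. \<forall>z. norm z \<le> R \<longrightarrow> \<bar>\<Phi> x z\<bar> \<le> K \<and> norm (A x z) \<le> K"
    using locally_bounded by meson
  show ?thesis
  proof (rule integral_dominated_convergence[where w="\<lambda>x. K * (C * coeff_norm e)"])
    show "(\<lambda>x. A x (comb c x) \<bullet> comb e x) \<in> borel_measurable M"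
      using measurable_flux[of "comb c"] by measurable
    show "(\<lambda>x. A x (comb (\<lambda>b. c b + t n * e b) x) \<bullet> comb e x) \<in> borel_measurable M" for n
      using measurable_flux[of "comb (\<lambda>b. c b + t n * e b)"] by measurable
    show "AE x in M. (\<lambda>n. A x (comb (\<lambda>b. c b + t n * e b) x) \<bullet> comb e x)
        \<longlonglongrightarrow> A x (comb c x) \<bullet> comb e x"
    proof (rule AE_I2)
      fix x assume x: "x \<in> space M"
      have "(\<lambda>n. comb c x + t n *\<^sub>R comb e x) \<longlonglongrightarrow> comb c x + 0 *\<^sub>R comb e x"
        by (intro tendsto_intros t)
      then have "(\<lambda>n. comb (\<lambda>b. c b + t n * e b) x) \<longlonglongrightarrow> comb c x"
        by (simp add: comb_add comb_scale)
      then have "(\<lambda>n. A x (comb (\<lambda>b. c b + t n * e b) x)) \<longlonglongrightarrow> A x (comb c x)"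
        using continuous_on_tendsto_compose[OF continuous_flux[OF x]] by simp
      then show "(\<lambda>n. A x (comb (\<lambda>b. c b + t n * e b) x) \<bullet> comb e x)
          \<longlonglongrightarrow> A x (comb c x) \<bullet> comb e x"
        by (intro tendsto_intros)
    qed
    show "AE x in M. norm (A x (comb (\<lambda>b. c b + t n * e b) x) \<bullet> comb e x) \<le> K * (C * coeff_norm e)" for n
    proof (rule AE_I2)
      fix x assume x: "x \<in> space M"
      have "coeff_norm (\<lambda>b. c b + t n * e b) \<le> coeff_norm c + \<bar>t n\<bar> * coeff_norm e"
        using coeff_norm_triangle[of c "\<lambda>b. t n * e b"] by (simp add: coeff_norm_scale)
      also have "\<dots> \<le> coeff_norm c + coeff_norm e"
        using t(2)[of n] by (simp add: mult_left_le_one_le)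
      finally have "norm (comb (\<lambda>b. c b + t n * e b) x) \<le> R"
        using norm_comb[OF x, of "\<lambda>b. c b + t n * e b"] C_nonneg
        unfolding R_def by (meson mult_left_mono order_trans)
      then have "norm (A x (comb (\<lambda>b. c b + t n * e b) x)) \<le> K"
        using K x by blast
      then have "norm (A x (comb (\<lambda>b. c b + t n * e b) x)) * norm (comb e x) \<le> K * (C * coeff_norm e)"
        using norm_comb[OF x] order_trans[OF norm_ge_zero] by (intro mult_mono) blast+
      then show "norm (A x (comb (\<lambda>b. c b + t n * e b) x) \<bullet> comb e x) \<le> K * (C * coeff_norm e)"
        using Cauchy_Schwarz_ineq2 order_trans by (metis real_norm_def)
    qed
  qed auto
qed

text \<open>Moving from the minimiser by \<open>t e\<close> with \<open>t > 0\<close> raises the energy; the subgradient inequality at the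
  displaced point bounds this increase by \<open>t\<close> times the residual there, which is therefore
  nonnegative. As \<open>t\<close> tends to \<open>0\<close> the residual at the minimiser is nonnegative in every
  direction, so it vanishes.\<close>

lemma minimiser_imp_galerkin_solution:
  assumes min: "\<And>c'. total_energy \<Phi> l c \<le> total_energy \<Phi> l c'"
  shows "galerkin_solution A l c"
proof -
  have ge: "(\<Sum>b\<in>B. e b * l b) \<le> (\<integral>x. A x (comb c x) \<bullet> comb e x \<partial>M)" for e
  proof -
    define t where "t n = inverse (real (Suc n))" for n
    have t: "t \<longlonglongrightarrow> 0"
      unfolding t_def by (rule LIMSEQ_inverse_real_of_nat)
    have t01: "0 < t n" "\<bar>t n\<bar> \<le> 1" for n
      by (auto simp: t_def field_simps)
    show ?thesis
    proof (rule LIMSEQ_le_const[OF flux_tendsto[OF t t01(2)]], intro exI allI impI)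
      fix n
      let ?c = "\<lambda>b. c b + t n * e b"
      have "0 \<le> total_energy \<Phi> l ?c - total_energy \<Phi> l c"
        using min by simp
      also have "\<dots> \<le> (\<integral>x. A x (comb ?c x) \<bullet> comb (\<lambda>b. t n * e b) x \<partial>M) - (\<Sum>b\<in>B. t n * e b * l b)"
        using energy_diff_le[of ?c c] by simp
      also have "\<dots> = t n * ((\<integral>x. A x (comb ?c x) \<bullet> comb e x \<partial>M) - (\<Sum>b\<in>B. e b * l b))"
        unfolding comb_scale by (simp add: sum_distrib_left right_diff_distrib mult.assoc)
      finally show "(\<Sum>b\<in>B. e b * l b) \<le> (\<integral>x. A x (comb ?c x) \<bullet> comb e x \<partial>M)"
        using t01(1)[of n] by (simp add: zero_le_mult_iff)
    qed
  qed
  show ?thesis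
    unfolding galerkin_solution_def
  proof
    fix b assume b: "b \<in> B"
    let ?e = "\<lambda>a. if a = b then 1 else 0 :: real"
    have "(\<Sum>a\<in>B. ?e a * l a) = l b"
      using finite_B b by (simp add: if_distrib[of "\<lambda>s. s * _"] sum.delta cong: if_cong)
    moreover have "(\<Sum>a\<in>B. (-1) * ?e a * l a) = - l b"
      using calculation by (simp add: sum_negf)
    moreover have "comb (\<lambda>a. (-1) * ?e a) x = - g b x" for x
      by (simp only: comb_scale comb_unit[OF b]) simp
    ultimately show "(\<integral>x. A x (comb c x) \<bullet> g b x \<partial>M) = l b"
      using ge[of ?e] ge[of "\<lambda>a. (-1) * ?e a"] by (simp add: comb_unit[OF b])
  qed
qed

lemma galerkin_solution_exists: "\<exists>c. galerkin_solution A l c"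
  using minimiser_exists minimiser_imp_galerkin_solution by metis

lemma energy_convex:
  assumes t: "0 \<le> t" "t \<le> 1"
  shows "total_energy \<Phi> l (\<lambda>b. (1 - t) * c b + t * c' b) \<le>
    (1 - t) * total_energy \<Phi> l c + t * total_energy \<Phi> l c'"
proof -
  have "(\<integral>x. \<Phi> x (comb (\<lambda>b. (1 - t) * c b + t * c' b) x) \<partial>M) \<le>
      (\<integral>x. (1 - t) * \<Phi> x (comb c x) + t * \<Phi> x (comb c' x) \<partial>M)"
    using convex_combination[OF _ t]
    by (intro integral_mono integrable_density Bochner_Integration.integrable_add
        integrable_mult_right) (simp add: comb_add comb_scale)
  then show ?thesis
    unfolding total_energy_def
    by (simp add: integrable_density algebra_simps sum.distrib sum_distrib_left sum_subtractf)
qed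

end

lemma energy_close:
  assumes d: "convex_density M \<Phi> A" "convex_density M \<Psi> D"
    and close: "\<And>x z. x \<in> space M \<Longrightarrow> norm z \<le> C * coeff_norm c \<Longrightarrow> \<bar>\<Psi> x z - \<Phi> x z\<bar> \<le> \<eta>"
  shows "\<bar>total_energy \<Psi> l c - total_energy \<Phi> l c\<bar> \<le> measure M (space M) * \<eta>"
proof -
  note int = integrable_density[OF d(1)] integrable_density[OF d(2)]
  have "\<bar>total_energy \<Psi> l c - total_energy \<Phi> l c\<bar> = \<bar>\<integral>x. \<Psi> x (comb c x) - \<Phi> x (comb c x) \<partial>M\<bar>"
    by (simp add: total_energy_def int)
  also have "\<dots> \<le> (\<integral>x. \<bar>\<Psi> x (comb c x) - \<Phi> x (comb c x)\<bar> \<partial>M)"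
    by (rule integral_abs_bound)
  also have "\<dots> \<le> (\<integral>x. \<eta> \<partial>M)"
    using close norm_comb int by (intro integral_mono) auto
  finally show ?thesis
    by simp
qed

text \<open>With \<open>\<delta>\<close> the gap between the minimum of the limit energy and its values on the unit sphere
  around \<open>c\<close>, let the energies differ by less than \<open>\<delta> / 2\<close> on the unit ball. If \<open>cs n\<close> were outside
  the ball, convexity along the segment from \<open>c\<close> to \<open>cs n\<close> would give a point on the sphere where
  the approximating energy is at most its value at \<open>c\<close>, contradicting the gap. Inside the ball
  uniform closeness compares the two minima.\<close>

lemma minimal_energy_tendsto:
  assumes \<Phi>: "convex_density M \<Phi> A"
    and \<Psi>: "\<forall>\<^sub>F n in F. convex_density M (\<Psi> n) (D n)"
    and conv: "\<And>R \<eta>. 0 < \<eta> \<Longrightarrow>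
      \<forall>\<^sub>F n in F. \<forall>x\<in>space M. \<forall>z. norm z \<le> R \<longrightarrow> \<bar>\<Psi> n x z - \<Phi> x z\<bar> \<le> \<eta>"
    and sol: "galerkin_solution A l c" "\<forall>\<^sub>F n in F. galerkin_solution (D n) l (cs n)"
  shows "((\<lambda>n. total_energy (\<Psi> n) l (cs n)) \<longlongrightarrow> total_energy \<Phi> l c) F"
proof -
  let ?J = "total_energy \<Phi> l"
  obtain \<delta> where \<delta>: "\<delta> > 0"
    "\<And>e. coeff_norm e = 1 \<Longrightarrow> ?J c + \<delta> \<le> ?J (\<lambda>b. c b + e b)"
  proof (cases "\<exists>e. coeff_norm e = 1")
    case True
    have "locally_lipschitz (\<lambda>e. ?J (\<lambda>b. c b + e b))"
      unfolding locally_lipschitz_def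
    proof
      fix R
      obtain K where K: "\<forall>a a'. coeff_norm a \<le> coeff_norm c + R \<longrightarrow> coeff_norm a' \<le> coeff_norm c + R \<longrightarrow>
          \<bar>?J a - ?J a'\<bar> \<le> K * coeff_norm (\<lambda>b. a b - a' b)"
        using locally_lipschitz_energy[OF \<Phi>] unfolding locally_lipschitz_def by meson
      have shift: "coeff_norm (\<lambda>b. c b + e b) \<le> coeff_norm c + R" if "coeff_norm e \<le> R" for e
        using coeff_norm_triangle[of c e] that by simp
      show "\<exists>K. \<forall>a a'. coeff_norm a \<le> R \<longrightarrow> coeff_norm a' \<le> R \<longrightarrow>
          \<bar>?J (\<lambda>b. c b + a b) - ?J (\<lambda>b. c b + a' b)\<bar> \<le> K * coeff_norm (\<lambda>b. a b - a' b)"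
      proof (intro exI[of _ K] allI impI)
        fix a a' assume "coeff_norm a \<le> R" "coeff_norm a' \<le> R"
        then show "\<bar>?J (\<lambda>b. c b + a b) - ?J (\<lambda>b. c b + a' b)\<bar> \<le> K * coeff_norm (\<lambda>b. a b - a' b)"
          using K[rule_format, OF shift shift, of a a'] by simp
      qed
    qed
    then obtain e0 where e0: "coeff_norm e0 \<in> {1}"
      "\<And>e. coeff_norm e \<in> {1} \<Longrightarrow> ?J (\<lambda>b. c b + e0 b) \<le> ?J (\<lambda>b. c b + e b)"
      using attains_min[of "\<lambda>e. ?J (\<lambda>b. c b + e b)" "{1}" 1] True by auto
    obtain b where b: "b \<in> B" "e0 b \<noteq> 0"
      using e0(1) coeff_norm_eq_0[of e0] by auto
    have "?J c < ?J (\<lambda>b. c b + e0 b)"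
      by (rule galerkin_solution_strict_minimiser[OF \<Phi> sol(1) b(1)]) (use b(2) in simp)
    then show ?thesis
      using that[of "?J (\<lambda>b. c b + e0 b) - ?J c"] e0(2) by auto
  next
    case False
    then show ?thesis
      using that[of 1] by auto
  qed
  define m where "m = measure M (space M) + 1"
  have m: "m > 0" "measure M (space M) \<le> m"
    by (auto simp: m_def add_nonneg_pos)
  define R where "R = C * (coeff_norm c + 1)"
  show ?thesis
  proof (rule tendstoI)
    fix r :: real assume r: "r > 0"
    (* m exceeds the total mass, so densities closer than eta give energies closer than delta / 3
       and r / 2; adding one keeps m positive also for the zero measure. *)
    define \<eta> where "\<eta> = min (r / 2) (\<delta> / 3) / m"
    have \<eta>: "\<eta> > 0" "m * \<eta> < r" "2 * (m * \<eta>) < \<delta>"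
      using m r \<delta>(1) by (auto simp: \<eta>_def)
    show "\<forall>\<^sub>F n in F. dist (total_energy (\<Psi> n) l (cs n)) (?J c) < r"
      using \<Psi> sol(2) conv[OF \<eta>(1), of R]
    proof eventually_elim
      case (elim n)
      let ?E = "total_energy (\<Psi> n) l"
      have near: "\<bar>?E a - ?J a\<bar> \<le> m * \<eta>" if "coeff_norm (\<lambda>b. a b - c b) \<le> 1" for a
      proof -
        have "coeff_norm a \<le> coeff_norm c + coeff_norm (\<lambda>b. a b - c b)"
          using coeff_norm_triangle[of c "\<lambda>b. a b - c b"] by simp
        also have "\<dots> \<le> coeff_norm c + 1"
          using that by simp
        finally have "C * coeff_norm a \<le> R"
          unfolding R_def by (rule mult_left_mono[OF _ C_nonneg])
        then have "\<bar>?E a - ?J a\<bar> \<le> measure M (space M) * \<eta>"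
          using elim(3) by (intro energy_close[OF \<Phi> elim(1)]) force
        then show ?thesis
          using m(2) \<eta>(1) by (meson mult_right_mono order_trans less_imp_le)
      qed
      have zero: "coeff_norm (\<lambda>b. c b - c b) \<le> 1"
        by (simp add: coeff_norm_def)
      have min: "?E (cs n) \<le> ?E c"
        by (rule galerkin_solution_imp_minimiser[OF elim(1,2)])
      have "coeff_norm (\<lambda>b. cs n b - c b) \<le> 1"
      proof (rule ccontr)
        assume far: "\<not> coeff_norm (\<lambda>b. cs n b - c b) \<le> 1"
        define t where "t = 1 / coeff_norm (\<lambda>b. cs n b - c b)"
        have t: "0 \<le> t" "t \<le> 1" "t * coeff_norm (\<lambda>b. cs n b - c b) = 1"
          using far by (auto simp: t_def)
        define e where "e b = t * (cs n b - c b)" for b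
        have e1: "coeff_norm e = 1"
          using t unfolding e_def coeff_norm_scale by simp
        have "?E (\<lambda>b. c b + e b) = ?E (\<lambda>b. (1 - t) * c b + t * cs n b)"
          by (simp add: e_def algebra_simps)
        also have "\<dots> \<le> (1 - t) * ?E c + t * ?E (cs n)"
          by (rule energy_convex[OF elim(1) t(1,2)])
        also have "\<dots> \<le> (1 - t) * ?E c + t * ?E c"
          using min t by (simp add: mult_left_mono)
        finally have "?E (\<lambda>b. c b + e b) \<le> ?E c"
          by (simp add: algebra_simps)
        then show False
          using near[of "\<lambda>b. c b + e b"] near[of c] zero \<delta>(2)[OF e1] \<eta>(3) e1 by simp
      qed
      then have "\<bar>?E (cs n) - ?J (cs n)\<bar> \<le> m * \<eta>"
        by (rule near)
      moreover have "?J c \<le> ?J (cs n)"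
        by (rule galerkin_solution_imp_minimiser[OF \<Phi> sol(1)])
      ultimately show ?case
        using min near[OF zero] \<eta>(2) by (simp add: dist_real_def abs_less_iff abs_le_iff)
    qed
  qed
qed

end


section \<open>Power-law and cut-off energy densities\<close>

text \<open>Strict convexity through supporting lines with slope \<open>a\<close>. This form glues at a common point of two
  intervals without differentiating there.\<close>

definition strictly_convex_slope :: "(real \<Rightarrow> real) \<Rightarrow> (real \<Rightarrow> real) \<Rightarrow> real set \<Rightarrow> bool" where
  "strictly_convex_slope F a S \<longleftrightarrow> (\<forall>s\<in>S. \<forall>t\<in>S. s \<noteq> t \<longrightarrow> F s + a s * (t - s) < F t)"

lemma strictly_convex_slope_mono:
  assumes "strictly_convex_slope F a S" "s \<in> S" "t \<in> S" "s < t"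
  shows "a s < a t"
proof -
  have "F s + a s * (t - s) < F t" "F t + a t * (s - t) < F s"
    using assms unfolding strictly_convex_slope_def by force+
  then have "0 < (a t - a s) * (t - s)"
    by (simp add: algebra_simps)
  then show ?thesis
    using assms(4) by (simp add: zero_less_mult_iff)
qed

lemma strictly_convex_slope_glue:
  assumes S: "strictly_convex_slope F a S" "\<And>s. s \<in> S \<Longrightarrow> s \<le> m" "m \<in> S"
    and T: "strictly_convex_slope F a T" "\<And>t. t \<in> T \<Longrightarrow> m \<le> t" "m \<in> T"
  shows "strictly_convex_slope F a (S \<union> T)"
proof -
  have up: "F s + a s * (t - s) < F t" if "s \<in> S" "t \<in> T" "s \<noteq> t" for s t
  proof (cases "s = m \<or> t = m")
    case True
    then show ?thesis
      using that S T unfolding strictly_convex_slope_def by auto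
  next
    case False
    then have lt: "s < m" "m < t"
      using that S(2) T(2) by force+
    have "F s + a s * (m - s) < F m" "F m + a m * (t - m) < F t"
      using that S T lt unfolding strictly_convex_slope_def by force+
    moreover have "a s * (t - m) < a m * (t - m)"
      using strictly_convex_slope_mono[OF S(1) that(1) S(3) lt(1)] lt(2) by simp
    ultimately show ?thesis
      by (simp add: algebra_simps)
  qed
  have down: "F t + a t * (s - t) < F s" if "s \<in> S" "t \<in> T" "s \<noteq> t" for s t
  proof (cases "s = m \<or> t = m")
    case True
    then show ?thesis
      using that S T unfolding strictly_convex_slope_def by auto
  next
    case False
    then have lt: "s < m" "m < t"
      using that S(2) T(2) by force+
    have "F t + a t * (m - t) < F m" "F m + a m * (s - m) < F s"
      using that S T lt unfolding strictly_convex_slope_def by force+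
    moreover have "a m * (m - s) < a t * (m - s)"
      using strictly_convex_slope_mono[OF T(1) T(3) that(2) lt(2)] lt(1) by simp
    ultimately show ?thesis
      by (simp add: algebra_simps)
  qed
  show ?thesis
    using S(1) T(1) up down unfolding strictly_convex_slope_def by (metis UnE)
qed

lemma strictly_convex_slope_quadratic:
  assumes "k > 0"
  shows "strictly_convex_slope (\<lambda>s. 1 / 2 * k * s\<^sup>2 + c) (\<lambda>s. k * s) S"
  unfolding strictly_convex_slope_def
proof (intro ballI impI)
  fix s t :: real assume "s \<noteq> t"
  then have "0 < 1 / 2 * k * (t - s)\<^sup>2"
    using assms by simp
  also have "\<dots> = (1 / 2 * k * t\<^sup>2 + c) - (1 / 2 * k * s\<^sup>2 + c + k * s * (t - s))"
    by (simp add: power2_eq_square field_simps)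
  finally show "1 / 2 * k * s\<^sup>2 + c + k * s * (t - s) < 1 / 2 * k * t\<^sup>2 + c"
    by simp
qed

lemma strictly_convex_slope_powr:
  assumes q: "q > 1"
  shows "strictly_convex_slope (\<lambda>s. 1 / q * s powr q) (\<lambda>s. s powr (q - 1)) {0..}"
  unfolding strictly_convex_slope_def
proof (intro ballI impI)
  fix s t :: real assume st: "s \<in> {0..}" "t \<in> {0..}" "s \<noteq> t"
  have cont: "continuous_on {a..b} (\<lambda>s. 1 / q * s powr q)" if "0 \<le> a" for a b
    using q that by (intro continuous_intros continuous_on_powr') auto
  have der: "((\<lambda>s. 1 / q * s powr q) has_real_derivative r powr (q - 1)) (at r)" if "r > 0" for r
    using q that by (auto intro!: derivative_eq_intros)
  have mvt: "\<exists>r. a < r \<and> r < b \<and> 1 / q * b powr q - 1 / q * a powr q = (b - a) * r powr (q - 1)"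
    if "0 \<le> a" "a < b" for a b
  proof -
    have "(\<lambda>s. 1 / q * s powr q) differentiable (at r)" if "a < r" "r < b" for r
      using der[of r] that \<open>0 \<le> a\<close> real_differentiable_def by force
    from MVT[OF \<open>a < b\<close> cont[OF \<open>0 \<le> a\<close>] this]
    obtain l r where r: "a < r" "r < b" "((\<lambda>s. 1 / q * s powr q) has_real_derivative l) (at r)"
      "1 / q * b powr q - 1 / q * a powr q = (b - a) * l"
      by blast
    have "l = r powr (q - 1)"
      by (rule DERIV_unique[OF r(3) der]) (use r(1) that(1) in simp)
    then show ?thesis
      using r by blast
  qed
  show "1 / q * s powr q + s powr (q - 1) * (t - s) < 1 / q * t powr q"
  proof (cases "s < t")
    case True
    obtain r where r: "s < r" "r < t" "1 / q * t powr q - 1 / q * s powr q = (t - s) * r powr (q - 1)"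
      using mvt[of s t] True st by auto
    have "s powr (q - 1) < r powr (q - 1)"
      using r st q by (intro powr_less_mono2) auto
    then have "(t - s) * s powr (q - 1) < (t - s) * r powr (q - 1)"
      using True by simp
    then show ?thesis
      using r(3) by (simp add: mult.commute)
  next
    case False
    then have "t < s"
      using st by simp
    obtain r where r: "t < r" "r < s" "1 / q * s powr q - 1 / q * t powr q = (s - t) * r powr (q - 1)"
      using mvt[of t s] \<open>t < s\<close> st by auto
    have "r powr (q - 1) < s powr (q - 1)"
      using r st q by (intro powr_less_mono2) auto
    then have "(s - t) * r powr (q - 1) < (s - t) * s powr (q - 1)"
      using \<open>t < s\<close> by simp
    then show ?thesis
      using r(3) by (simp add: algebra_simps)
  qed
qed


lemma strictly_convex_slope_cong:
  assumes "\<And>s. s \<in> S \<Longrightarrow> F s = F' s" "\<And>s. s \<in> S \<Longrightarrow> a s = a' s"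
  shows "strictly_convex_slope F a S \<longleftrightarrow> strictly_convex_slope F' a' S"
  using assms unfolding strictly_convex_slope_def by simp

text \<open>If the norms of \<open>z\<close> and \<open>w\<close> differ, strictness comes from the profile; if they agree, it comes from
  the strict Cauchy-Schwarz inequality, for which the slope must be positive at \<open>norm z\<close>.\<close>

lemma radial_subgradient:
  fixes z w :: "'e::euclidean_space"
  assumes slope: "strictly_convex_slope F (\<lambda>s. k s * s) {0..}" and ne: "z \<noteq> w"
  shows "F (norm z) + (k (norm z) *\<^sub>R z) \<bullet> (w - z) < F (norm w)"
proof (cases "z = 0")
  case True
  then show ?thesis
    using slope ne unfolding strictly_convex_slope_def by (force dest: bspec[of _ _ 0])
next
  case False
  have "0 < k (norm z) * norm z"
    using strictly_convex_slope_mono[OF slope, of 0 "norm z"] False by simp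
  then have k: "0 < k (norm z)"
    using False by (simp add: zero_less_mult_iff)
  have eq: "(k (norm z) *\<^sub>R z) \<bullet> (w - z) =
      k (norm z) * norm z * (norm w - norm z) - k (norm z) * (norm z * norm w - z \<bullet> w)"
    by (simp add: inner_diff_right algebra_simps power2_norm_eq_inner flip: power2_eq_square)
  have cs: "z \<bullet> w \<le> norm z * norm w"
    by (rule norm_cauchy_schwarz)
  show ?thesis
  proof (cases "norm z = norm w")
    case True
    then have "z \<bullet> w \<noteq> norm z * norm w"
      using ne False norm_cauchy_schwarz_eq[of z w] by auto
    with cs k have "0 < k (norm z) * (norm z * norm w - z \<bullet> w)"
      by simp
    then show ?thesis
      using True unfolding eq by simp
  next
    case ne: False
    have "F (norm z) + k (norm z) * norm z * (norm w - norm z) < F (norm w)"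
      using slope ne unfolding strictly_convex_slope_def by simp
    moreover have "0 \<le> k (norm z) * (norm z * norm w - z \<bullet> w)"
      using k cs by simp
    ultimately show ?thesis
      unfolding eq by linarith
  qed
qed

lemma power2_powr: "0 \<le> s \<Longrightarrow> (s\<^sup>2) powr (r / 2) = s powr r" for s :: real
  by (cases "s = 0") (simp_all add: powr_powr flip: powr_numeral)

lemma powr_minus_2_mult: "0 \<le> s \<Longrightarrow> s powr (q - 2) * s\<^sup>2 = s powr q" for s :: real
  by (cases "s = 0") (simp_all flip: powr_add powr_numeral)

lemma powr_minus_2_mult1: "0 \<le> s \<Longrightarrow> s powr (q - 2) * s = s powr (q - 1)" for s :: real
  using powr_add[of s "q - 2" 1] by (cases "s = 0") simp_all

text \<open>With the gradient clamped to the cut-off interval, the three cases in the definitions of \<open>mu\<close> and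
  \<open>varphi\<close> become one formula, from which continuity, measurability and bounds are immediate.\<close>

definition clamp_gradient :: "real \<times> real \<Rightarrow> real \<Rightarrow> real" where
  "clamp_gradient \<epsilon> s = max (fst \<epsilon>) (min s (snd \<epsilon>))"

lemma square_less_iff: "0 \<le> a \<Longrightarrow> 0 \<le> b \<Longrightarrow> a\<^sup>2 < b\<^sup>2 \<longleftrightarrow> a < b" for a b :: real
  using power_mono_iff[of b a 2] by (simp add: linorder_not_le[symmetric])

lemma mu_clamp:
  assumes "\<epsilon> \<in> cutoffs" "0 \<le> s"
  shows "mu p \<epsilon> x (s\<^sup>2) = clamp_gradient \<epsilon> s powr (p x - 2)"
  using assms unfolding mu_def clamp_gradient_def cutoffs_def
  by (auto simp: square_less_iff power2_powr linorder_not_less max_def min_def)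

lemma varphi_clamp:
  assumes "\<epsilon> \<in> cutoffs" "0 \<le> s"
  shows "varphi p \<epsilon> x (s\<^sup>2) = 1 / 2 * clamp_gradient \<epsilon> s powr (p x - 2) * s\<^sup>2 +
    (1 / p x - 1 / 2) * clamp_gradient \<epsilon> s powr p x"
proof -
  have "1 / 2 * s powr (p x - 2) * s\<^sup>2 + (1 / p x - 1 / 2) * s powr p x = 1 / p x * s powr p x"
    using powr_minus_2_mult[OF assms(2), of "p x"] by (simp add: algebra_simps)
  then show ?thesis
    using assms unfolding varphi_def clamp_gradient_def cutoffs_def
    by (auto simp: square_less_iff power2_powr linorder_not_less max_def min_def)
qed

lemma strictly_convex_slope_varphi:
  assumes \<epsilon>: "\<epsilon> \<in> cutoffs" and q: "1 < p x"
  shows "strictly_convex_slope (\<lambda>s. varphi p \<epsilon> x (s\<^sup>2)) (\<lambda>s. mu p \<epsilon> x (s\<^sup>2) * s) {0..}"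
proof -
  obtain a b where ab: "fst \<epsilon> = a" "snd \<epsilon> = b" "0 < a" "a < 1" "1 < b"
    using \<epsilon> by (cases \<epsilon>) (auto simp: cutoffs_def)
  let ?S = "\<lambda>T. strictly_convex_slope (\<lambda>s. varphi p \<epsilon> x (s\<^sup>2)) (\<lambda>s. mu p \<epsilon> x (s\<^sup>2) * s) T"
  have low: "?S {0..a}"
    using strictly_convex_slope_quadratic[of "a powr (p x - 2)" "(1 / p x - 1 / 2) * a powr p x" "{0..a}"] ab
    by (subst strictly_convex_slope_cong[where F'="\<lambda>s. 1 / 2 * a powr (p x - 2) * s\<^sup>2 + (1 / p x - 1 / 2) * a powr p x"
          and a'="\<lambda>s. a powr (p x - 2) * s"])
      (auto simp: varphi_clamp[OF \<epsilon>] mu_clamp[OF \<epsilon>] clamp_gradient_def)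
  have mid: "?S {a..b}"
  proof (subst strictly_convex_slope_cong[where F'="\<lambda>s. 1 / p x * s powr p x" and a'="\<lambda>s. s powr (p x - 1)"])
    show "strictly_convex_slope (\<lambda>s. 1 / p x * s powr p x) (\<lambda>s. s powr (p x - 1)) {a..b}"
      using strictly_convex_slope_powr[OF q] ab(3) unfolding strictly_convex_slope_def by auto
    fix s assume s: "s \<in> {a..b}"
    then have "clamp_gradient \<epsilon> s = s" "0 \<le> s"
      using ab by (auto simp: clamp_gradient_def)
    then show "varphi p \<epsilon> x (s\<^sup>2) = 1 / p x * s powr p x" "mu p \<epsilon> x (s\<^sup>2) * s = s powr (p x - 1)"
      using powr_minus_2_mult[of s "p x"] powr_minus_2_mult1[of s "p x"]
      by (simp_all add: varphi_clamp[OF \<epsilon>] mu_clamp[OF \<epsilon>] algebra_simps)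
  qed
  have high: "?S {b..}"
    using strictly_convex_slope_quadratic[of "b powr (p x - 2)" "(1 / p x - 1 / 2) * b powr p x" "{b..}"] ab
    by (subst strictly_convex_slope_cong[where F'="\<lambda>s. 1 / 2 * b powr (p x - 2) * s\<^sup>2 + (1 / p x - 1 / 2) * b powr p x"
          and a'="\<lambda>s. b powr (p x - 2) * s"])
      (auto simp: varphi_clamp[OF \<epsilon>] mu_clamp[OF \<epsilon>] clamp_gradient_def)
  have "?S ({0..a} \<union> {a..b})"
    by (rule strictly_convex_slope_glue[OF low _ _ mid, of a]) (use ab in auto)
  then have "?S ({0..a} \<union> {a..b} \<union> {b..})"
    by (rule strictly_convex_slope_glue[OF _ _ _ high, of _ b]) (use ab in auto)
  moreover have "{0..a} \<union> {a..b} \<union> {b..} = {0..}"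
    using ab by auto
  ultimately show ?thesis
    by simp
qed

text \<open>The exponents \<open>p x\<close> and \<open>p x - 2\<close> range over a bounded interval above \<open>- 1\<close>; this bound and the
  next are uniform in them.\<close>

lemma clamped_powr_le:
  fixes a b m r P :: real
  assumes "0 < a" "a \<le> 1" "1 \<le> b" "a \<le> m" "m \<le> b" "-1 \<le> r" "r \<le> P" "0 \<le> P"
  shows "m powr r \<le> b powr P + 1 / a"
proof (cases "1 \<le> m")
  case True
  then have "m powr r \<le> m powr P"
    using assms by (intro powr_mono)
  also have "\<dots> \<le> b powr P"
    using assms by (intro powr_mono2) auto
  finally show ?thesis
    using assms by (simp add: add_increasing2)
next
  case False
  then have "m powr r \<le> m powr (-1)"
    using assms by (intro powr_mono') auto
  also have "\<dots> \<le> 1 / a"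
    using assms by (simp add: powr_minus_divide frac_le)
  finally show ?thesis
    by (simp add: add_increasing)
qed

lemma clamped_powr_ge:
  fixes a b m r P :: real
  assumes "0 < a" "a \<le> 1" "1 \<le> b" "a \<le> m" "m \<le> b" "-1 \<le> r" "r \<le> P"  "0 \<le> P"
  shows "inverse (b + a powr (- P)) \<le> m powr r"
proof -
  have m: "m > 0"
    using assms by simp
  have "m powr (- r) \<le> b + a powr (- P)"
  proof (cases "1 \<le> m")
    case True
    then have "m powr (- r) \<le> m powr 1"
      using assms by (intro powr_mono) auto
    then show ?thesis
      using assms m by (simp add: add_increasing2)
  next
    case False
    then have "m powr (- r) \<le> m powr (- P)"
      using assms by (intro powr_mono') auto
    also have "\<dots> \<le> a powr (- P)"
      using assms by (simp add: powr_mono2')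
    finally show ?thesis
      using assms by (simp add: add_increasing)
  qed
  then have "inverse (b + a powr (- P)) \<le> inverse (m powr (- r))"
    using m by (intro le_imp_inverse_le) auto
  then show ?thesis
    by (simp add: powr_minus)
qed

context
  fixes M :: "'a measure" and p :: "'a \<Rightarrow> real" and p_min p_max :: real
  assumes p_measurable [measurable]: "p \<in> borel_measurable M"
    and p_min: "1 < p_min" and p_range: "\<And>x. x \<in> space M \<Longrightarrow> p_min \<le> p x \<and> p x \<le> p_max"
begin

lemma p_gt_1: "x \<in> space M \<Longrightarrow> 1 < p x"
  using p_min p_range by force

text \<open>Up to the constant \<open>K0\<close> the density dominates \<open>\<kappa> / 2\<close> times the square of \<open>norm z\<close>, so it is
  superlinear for each fixed cut-off pair.\<close>

lemma convex_density_relaxed: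
  assumes \<epsilon>: "\<epsilon> \<in> cutoffs"
  shows "convex_density M (\<lambda>x (z::'e::euclidean_space). varphi p \<epsilon> x ((norm z)\<^sup>2))
    (\<lambda>x z. mu p \<epsilon> x ((norm z)\<^sup>2) *\<^sub>R z)"
proof -
  obtain a b where ab: "fst \<epsilon> = a" "snd \<epsilon> = b" "0 < a" "a < 1" "1 < b"
    using \<epsilon> by (cases \<epsilon>) (auto simp: cutoffs_def)
  let ?m = "\<lambda>z::'e. clamp_gradient \<epsilon> (norm z)"
  have m: "a \<le> ?m z" "?m z \<le> b" "0 < ?m z" for z
    using ab by (auto simp: clamp_gradient_def)
  define P where "P = max 0 p_max"
  define K0 where "K0 = b powr P + 1 / a"
  have K0: "0 \<le> K0"
    using ab by (simp add: K0_def)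
  define \<kappa> where "\<kappa> = inverse (b + a powr (- P))"
  have \<kappa>: "0 < \<kappa>"
    unfolding \<kappa>_def using ab by (simp add: add_pos_nonneg)
  have up: "?m z powr r \<le> K0" if "-1 \<le> r" "r \<le> P" for z r
    unfolding K0_def by (rule clamped_powr_le) (use ab m that in \<open>auto simp: P_def\<close>)
  have dn: "\<kappa> \<le> ?m z powr r" if "-1 \<le> r" "r \<le> P" for z r
    unfolding \<kappa>_def by (rule clamped_powr_ge) (use ab m that in \<open>auto simp: P_def\<close>)
  have expo: "-1 \<le> p x - 2" "p x - 2 \<le> P" "-1 \<le> p x" "p x \<le> P" if "x \<in> space M" for x
    using p_gt_1[OF that] p_range[OF that] by (auto simp: P_def)
  have co: "\<bar>(1 / p x - 1 / 2) * ?m z powr p x\<bar> \<le> K0" if "x \<in> space M" for x z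
  proof -
    have "\<bar>1 / p x - 1 / 2\<bar> \<le> 1"
      using p_gt_1[OF that] by (auto simp: abs_le_iff field_simps)
    then have "\<bar>1 / p x - 1 / 2\<bar> * \<bar>?m z powr p x\<bar> \<le> 1 * K0"
      using up expo[OF that] K0 by (intro mult_mono) auto
    then show ?thesis
      by (simp add: abs_mult)
  qed
  have rw: "varphi p \<epsilon> x ((norm z)\<^sup>2) = 1 / 2 * ?m z powr (p x - 2) * (norm z)\<^sup>2 + (1 / p x - 1 / 2) * ?m z powr p x"
    "mu p \<epsilon> x ((norm z)\<^sup>2) = ?m z powr (p x - 2)" for x z
    by (simp_all add: varphi_clamp[OF \<epsilon>] mu_clamp[OF \<epsilon>])
  have [measurable]: "(\<lambda>x. ?m (G x)) \<in> borel_measurable M" if [measurable]: "G \<in> borel_measurable M" for G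
    unfolding clamp_gradient_def by measurable
  show ?thesis
  proof
    fix x and z w :: 'e assume x: "x \<in> space M" "z \<noteq> w"
    have "strictly_convex_slope (\<lambda>s. varphi p \<epsilon> x (s\<^sup>2)) (\<lambda>s. mu p \<epsilon> x (s\<^sup>2) * s) {0..}"
      by (rule strictly_convex_slope_varphi[where p=p, OF \<epsilon> p_gt_1[OF x(1)]])
    from radial_subgradient[OF this x(2)]
    show "varphi p \<epsilon> x ((norm z)\<^sup>2) + (mu p \<epsilon> x ((norm z)\<^sup>2) *\<^sub>R z) \<bullet> (w - z) < varphi p \<epsilon> x ((norm w)\<^sup>2)" .
  next
    fix x assume "x \<in> space M"
    show "continuous_on UNIV (\<lambda>z::'e. mu p \<epsilon> x ((norm z)\<^sup>2) *\<^sub>R z)"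
      unfolding rw clamp_gradient_def
      by (intro continuous_intros) (use ab in auto)
  next
    fix G :: "'a \<Rightarrow> 'e" assume [measurable]: "G \<in> borel_measurable M"
    show "(\<lambda>x. varphi p \<epsilon> x ((norm (G x))\<^sup>2)) \<in> borel_measurable M"
      unfolding rw by measurable
    show "(\<lambda>x. mu p \<epsilon> x ((norm (G x))\<^sup>2) *\<^sub>R G x) \<in> borel_measurable M"
      unfolding rw by measurable
  next
    fix R :: real
    show "\<exists>K. \<forall>x\<in>space M. \<forall>z::'e. norm z \<le> R \<longrightarrow>
        \<bar>varphi p \<epsilon> x ((norm z)\<^sup>2)\<bar> \<le> K \<and> norm (mu p \<epsilon> x ((norm z)\<^sup>2) *\<^sub>R z) \<le> K"
    proof (intro exI[of _ "K0 * R\<^sup>2 + K0 * \<bar>R\<bar> + K0"] ballI allI impI conjI)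
      fix x and z :: 'e assume x: "x \<in> space M" and z: "norm z \<le> R"
      have s: "(norm z)\<^sup>2 \<le> R\<^sup>2"
        using z by (intro power_mono) auto
      have "?m z powr (p x - 2) * (norm z)\<^sup>2 \<le> K0 * R\<^sup>2"
        using up expo[OF x] s K0 by (intro mult_mono) auto
      moreover have "0 \<le> ?m z powr (p x - 2) * (norm z)\<^sup>2" "0 \<le> K0 * \<bar>R\<bar>" "0 \<le> K0 * R\<^sup>2"
        using K0 by auto
      ultimately show "\<bar>varphi p \<epsilon> x ((norm z)\<^sup>2)\<bar> \<le> K0 * R\<^sup>2 + K0 * \<bar>R\<bar> + K0"
        using co[OF x, of z] unfolding rw mult.assoc abs_le_iff by linarith
      have "?m z powr (p x - 2) * norm z \<le> K0 * \<bar>R\<bar>"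
        using up expo[OF x] z K0 by (intro mult_mono) auto
      then show "norm (mu p \<epsilon> x ((norm z)\<^sup>2) *\<^sub>R z) \<le> K0 * R\<^sup>2 + K0 * \<bar>R\<bar> + K0"
        using K0 \<open>0 \<le> K0 * R\<^sup>2\<close> unfolding rw norm_scaleR real_norm_def abs_of_nonneg[OF powr_ge_zero]
        by linarith
    qed
  next
    fix k :: real
    show "\<exists>K. \<forall>x\<in>space M. \<forall>z::'e. k * norm z - K \<le> varphi p \<epsilon> x ((norm z)\<^sup>2)"
    proof (intro exI[of _ "k\<^sup>2 / (2 * \<kappa>) + K0"] ballI allI)
      fix x and z :: 'e assume x: "x \<in> space M"
      have "k * norm z - k\<^sup>2 / (2 * \<kappa>) \<le> 1 / 2 * \<kappa> * (norm z)\<^sup>2"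
      proof -
        have "0 \<le> (\<kappa> * norm z - k)\<^sup>2 / (2 * \<kappa>)"
          using \<kappa> by simp
        also have "\<dots> = 1 / 2 * \<kappa> * (norm z)\<^sup>2 - k * norm z + k\<^sup>2 / (2 * \<kappa>)"
          using \<kappa> by (simp add: field_simps power2_eq_square)
        finally show ?thesis
          by simp
      qed
      also have "\<dots> \<le> 1 / 2 * ?m z powr (p x - 2) * (norm z)\<^sup>2"
        using dn expo[OF x] by (intro mult_right_mono mult_left_mono) auto
      finally show "k * norm z - (k\<^sup>2 / (2 * \<kappa>) + K0) \<le> varphi p \<epsilon> x ((norm z)\<^sup>2)"
        using co[OF x, of z] unfolding rw by (simp add: abs_le_iff)
    qed
  qed
qed

text \<open>At the origin the norm of the flux is a positive power of \<open>norm z\<close>, which covers the singular case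
  \<open>q < 2\<close>.\<close>

lemma continuous_power_flux:
  assumes "1 < q"
  shows "continuous_on UNIV (\<lambda>z::'e::euclidean_space. norm z powr (q - 2) *\<^sub>R z)"
proof (intro continuous_at_imp_continuous_on ballI)
  fix z :: 'e
  show "isCont (\<lambda>z::'e. norm z powr (q - 2) *\<^sub>R z) z"
  proof (cases "z = 0")
    case False
    then show ?thesis
      by (intro continuous_intros) auto
  next
    case True
    have "((\<lambda>z::'e. norm z powr (q - 1)) \<longlongrightarrow> 0 powr (q - 1)) (at 0)"
      using assms by (intro tendsto_powr' tendsto_norm_zero tendsto_const tendsto_ident_at) auto
    then have "((\<lambda>z::'e. norm (norm z powr (q - 2) *\<^sub>R z)) \<longlongrightarrow> 0) (at 0)"
      by (simp add: powr_minus_2_mult1)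
    then have "((\<lambda>z::'e. norm z powr (q - 2) *\<^sub>R z) \<longlongrightarrow> 0) (at 0)"
      by (rule tendsto_norm_zero_cancel)
    then show ?thesis
      by (simp add: True isCont_def)
  qed
qed

text \<open>Superlinear growth is uniform in \<open>x\<close> because the exponents are bounded away from \<open>1\<close>: beyond the
  radius \<open>R\<close> the slope of the density exceeds \<open>k\<close>.\<close>

lemma convex_density_unrelaxed:
  "convex_density M (\<lambda>x (z::'e::euclidean_space). 1 / p x * norm z powr p x)
    (\<lambda>x z. norm z powr (p x - 2) *\<^sub>R z)"
proof
  fix x and z w :: 'e assume x: "x \<in> space M" "z \<noteq> w"
  have "strictly_convex_slope (\<lambda>s. 1 / p x * s powr p x) (\<lambda>s. s powr (p x - 2) * s) {0..}"
    using strictly_convex_slope_powr[OF p_gt_1[OF x(1)]]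
    by (subst strictly_convex_slope_cong[where a'="\<lambda>s. s powr (p x - 1)", OF refl])
      (simp_all add: powr_minus_2_mult1)
  from radial_subgradient[OF this x(2)]
  show "1 / p x * norm z powr p x + (norm z powr (p x - 2) *\<^sub>R z) \<bullet> (w - z) < 1 / p x * norm w powr p x" .
next
  fix x assume "x \<in> space M"
  then show "continuous_on UNIV (\<lambda>z::'e. norm z powr (p x - 2) *\<^sub>R z)"
    using continuous_power_flux p_gt_1 by blast
next
  fix G :: "'a \<Rightarrow> 'e" assume [measurable]: "G \<in> borel_measurable M"
  show "(\<lambda>x. 1 / p x * norm (G x) powr p x) \<in> borel_measurable M"
    by measurable
  show "(\<lambda>x. norm (G x) powr (p x - 2) *\<^sub>R G x) \<in> borel_measurable M"
    by measurable
next
  fix R :: real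
  show "\<exists>K. \<forall>x\<in>space M. \<forall>z::'e. norm z \<le> R \<longrightarrow>
      \<bar>1 / p x * norm z powr p x\<bar> \<le> K \<and> norm (norm z powr (p x - 2) *\<^sub>R z) \<le> K"
  proof (intro exI[of _ "(1 + \<bar>R\<bar>) powr p_max"] ballI allI impI conjI)
    fix x and z :: 'e assume x: "x \<in> space M" and z: "norm z \<le> R"
    have le: "norm z powr r \<le> (1 + \<bar>R\<bar>) powr p_max" if "0 \<le> r" "r \<le> p_max" for r
    proof -
      have "norm z powr r \<le> (1 + \<bar>R\<bar>) powr r"
        using z that by (intro powr_mono2) auto
      also have "\<dots> \<le> (1 + \<bar>R\<bar>) powr p_max"
        using that by (intro powr_mono) auto
      finally show ?thesis .
    qed
    have "1 / p x * norm z powr p x \<le> 1 * norm z powr p x"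
      using p_gt_1[OF x] by (intro mult_right_mono) auto
    then show "\<bar>1 / p x * norm z powr p x\<bar> \<le> (1 + \<bar>R\<bar>) powr p_max"
      using le[of "p x"] p_gt_1[OF x] p_range[OF x] by simp
    show "norm (norm z powr (p x - 2) *\<^sub>R z) \<le> (1 + \<bar>R\<bar>) powr p_max"
      using le[of "p x - 1"] p_gt_1[OF x] p_range[OF x] by (simp add: powr_minus_2_mult1)
  qed
next
  fix k :: real
  define R where "R = max 1 ((\<bar>k\<bar> * p_max) powr (1 / (p_min - 1)))"
  show "\<exists>K. \<forall>x\<in>space M. \<forall>z::'e. k * norm z - K \<le> 1 / p x * norm z powr p x"
  proof (intro exI[of _ "\<bar>k\<bar> * R"] ballI allI)
    fix x and z :: 'e assume x: "x \<in> space M"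
    note p = p_gt_1[OF x] p_range[OF x]
    show "k * norm z - \<bar>k\<bar> * R \<le> 1 / p x * norm z powr p x"
    proof (cases "norm z \<le> R")
      case True
      have "k * norm z \<le> \<bar>k\<bar> * norm z"
        by (simp add: mult_right_mono)
      also have "\<dots> \<le> \<bar>k\<bar> * R"
        using True by (simp add: mult_left_mono)
      finally show ?thesis
        using p(1) by (simp add: order_trans[of _ 0])
    next
      case False
      then have s: "1 \<le> norm z" "(\<bar>k\<bar> * p_max) powr (1 / (p_min - 1)) \<le> norm z"
        by (auto simp: R_def)
      have "\<bar>k\<bar> * p x \<le> \<bar>k\<bar> * p_max"
        using p by (intro mult_left_mono) auto
      also have "\<dots> = ((\<bar>k\<bar> * p_max) powr (1 / (p_min - 1))) powr (p_min - 1)"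
        using p p_min by (simp add: powr_powr)
      also have "\<dots> \<le> norm z powr (p_min - 1)"
        using s p_min by (intro powr_mono2) auto
      also have "\<dots> \<le> norm z powr (p x - 1)"
        using s p by (intro powr_mono) auto
      finally have "\<bar>k\<bar> * p x * norm z \<le> norm z powr (p x - 1) * norm z"
        by (simp add: mult_right_mono)
      also have "\<dots> = norm z powr p x"
        using s(1) powr_minus_2_mult1[of "norm z" "p x + 1"] by simp
      finally have "\<bar>k\<bar> * norm z \<le> 1 / p x * norm z powr p x"
        using p(1) by (simp add: field_simps)
      moreover have "k * norm z \<le> \<bar>k\<bar> * norm z"
        by (simp add: mult_right_mono)
      moreover have "0 \<le> \<bar>k\<bar> * R"
        by (simp add: R_def)
      ultimately show ?thesis
        by linarith
    qed
  qed
qed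

text \<open>Within the upper cut-off the densities differ only where \<open>norm z < fst \<epsilon>\<close>, and there both are of order
  \<open>fst \<epsilon> powr p x\<close>, which is at most \<open>fst \<epsilon>\<close>.\<close>

lemma relaxed_density_close:
  assumes \<epsilon>: "\<epsilon> \<in> cutoffs" and x: "x \<in> space M" and z: "norm z \<le> snd \<epsilon>"
  shows "\<bar>varphi p \<epsilon> x ((norm z)\<^sup>2) - 1 / p x * norm z powr p x\<bar> \<le> 2 * fst \<epsilon>"
proof -
  obtain a b where ab: "fst \<epsilon> = a" "snd \<epsilon> = b" "0 < a" "a < 1" "1 < b"
    using \<epsilon> by (cases \<epsilon>) (auto simp: cutoffs_def)
  note p = p_gt_1[OF x]
  show ?thesis
  proof (cases "norm z < a")
    case False
    then have "clamp_gradient \<epsilon> (norm z) = norm z"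
      using z ab by (auto simp: clamp_gradient_def)
    then show ?thesis
      using powr_minus_2_mult[of "norm z" "p x"] ab
      by (simp add: varphi_clamp[OF \<epsilon>] algebra_simps)
  next
    case True
    then have c: "clamp_gradient \<epsilon> (norm z) = a"
      using ab by (auto simp: clamp_gradient_def)
    have "(norm z)\<^sup>2 \<le> a\<^sup>2"
      using True by (intro power_mono) auto
    then have "a powr (p x - 2) * (norm z)\<^sup>2 \<le> a powr (p x - 2) * a\<^sup>2"
      by (intro mult_left_mono) auto
    then have 1: "a powr (p x - 2) * (norm z)\<^sup>2 \<le> a powr p x" "0 \<le> a powr (p x - 2) * (norm z)\<^sup>2"
      using ab powr_minus_2_mult[of a "p x"] by auto
    have "\<bar>1 / p x - 1 / 2\<bar> * a powr p x \<le> 1 / 2 * a powr p x"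
      using p by (intro mult_right_mono) (auto simp: abs_le_iff field_simps)
    then have 2: "\<bar>(1 / p x - 1 / 2) * a powr p x\<bar> \<le> 1 / 2 * a powr p x"
      by (simp add: abs_mult)
    have "1 / p x * norm z powr p x \<le> 1 * a powr p x"
      using p True by (intro mult_mono powr_mono2) auto
    then have 3: "1 / p x * norm z powr p x \<le> a powr p x" "0 \<le> 1 / p x * norm z powr p x"
      using p by auto
    have "a powr p x \<le> a powr 1"
      using ab p by (intro powr_mono') auto
    then have "a powr p x \<le> a"
      using ab by simp
    then show ?thesis
      using 1 2 3 ab(1) unfolding varphi_clamp[OF \<epsilon> norm_ge_zero] c mult.assoc abs_le_iff by linarith
  qed
qed

end

lemma eventually_cutoff_net_small_large:
  assumes "0 < \<eta>"
  shows "\<forall>\<^sub>F \<epsilon> in cutoff_net. \<epsilon> \<in> cutoffs \<and> fst \<epsilon> \<le> \<eta> \<and> R \<le> snd \<epsilon>"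
  unfolding eventually_cutoff_net
proof (intro bexI ballI impI)
  show "(min \<eta> (1 / 2), max R 2) \<in> cutoffs"
    using assms by (auto simp: cutoffs_def)
  fix \<epsilon> assume "\<epsilon> \<in> cutoffs" "cutoff_le (min \<eta> (1 / 2), max R 2) \<epsilon>"
  then show "\<epsilon> \<in> cutoffs \<and> fst \<epsilon> \<le> \<eta> \<and> R \<le> snd \<epsilon>"
    by (auto simp: cutoff_le_def)
qed


section \<open>The discrete problem on a domain\<close>

lemma Linf_AE_bounded:
  assumes "u \<in> Linf \<Omega>"
  obtains C where "0 \<le> C" "AE x in lebesgue_on \<Omega>. norm (u x) \<le> C"
proof -
  have ae: "AE x in lebesgue_on \<Omega>. ereal (norm (u x)) \<le> Linf_norm \<Omega> u"
    unfolding Linf_norm_def by (rule esssup_AE)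
  have "Linf_norm \<Omega> u < \<infinity>"
    using assms by (simp add: Linf_def)
  then obtain r where "Linf_norm \<Omega> u \<le> ereal r"
    by (cases "Linf_norm \<Omega> u") auto
  then have "AE x in lebesgue_on \<Omega>. norm (u x) \<le> max 0 r"
    using ae by (auto elim!: eventually_mono dest: order_trans)
  then show ?thesis
    using that[of "max 0 r"] by simp
qed

lemma locally_integrable_cong_ae:
  fixes u v :: "'a::euclidean_space \<Rightarrow> 'b::euclidean_space"
  assumes \<Omega>: "open \<Omega>" and u: "locally_integrable \<Omega> u" and ae: "ae_eq \<Omega> u v"
  shows "locally_integrable \<Omega> v"
  unfolding locally_integrable_def
proof (intro allI impI)
  fix K assume K: "compact K \<and> K \<subseteq> \<Omega>"
  then have sets: "K \<in> sets lebesgue"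
    by (auto intro: lmeasurable_compact fmeasurableD)
  have int: "integrable (lebesgue_on K) u"
    using u K by (simp add: locally_integrable_def)
  have "AE x in lebesgue. x \<in> \<Omega> \<longrightarrow> u x = v x"
    using ae \<Omega> by (simp add: ae_eq_def AE_lebesgue_on_iff)
  then have aeK: "AE x in lebesgue_on K. u x = v x"
    unfolding AE_lebesgue_on_iff[OF sets] by eventually_elim (use K in auto)
  have v: "v \<in> borel_measurable (lebesgue_on K)"
    by (rule ae_eq_borel_measurable[OF sets borel_measurable_integrable[OF int] aeK])
  show "integrable (lebesgue_on K) v"
    using integrable_cong_AE[OF borel_measurable_integrable[OF int] v aeK] int by simp
qed

lemma has_weak_gradient_cong_ae:
  assumes \<Omega>: "open \<Omega>" and u: "has_weak_gradient \<Omega> u g" and ae: "ae_eq \<Omega> u v"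
  shows "has_weak_gradient \<Omega> v g"
proof -
  have loc: "locally_integrable \<Omega> u"
    using u by (simp add: has_weak_gradient_def)
  have locv: "locally_integrable \<Omega> v"
    by (rule locally_integrable_cong_ae[OF \<Omega> loc ae])
  have "(\<integral>x. u x * frechet_derivative \<phi> (at x) i \<partial>lebesgue_on \<Omega>) =
      (\<integral>x. v x * frechet_derivative \<phi> (at x) i \<partial>lebesgue_on \<Omega>)"
    if "\<phi> \<in> test_functions \<Omega>" "i \<in> Basis" for \<phi> i
    using ae unfolding ae_eq_def
    by (intro integral_cong_AE borel_measurable_integrable integrable_test_function(2) \<Omega> loc locv that)
      (auto elim: eventually_mono)
  then show ?thesis
    using u locv by (simp add: has_weak_gradient_def)
qed

lemma weak_grad_W1inf:
  assumes \<Omega>: "open \<Omega>" and u: "u \<in> W1inf \<Omega>"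
  shows "has_weak_gradient \<Omega> u (weak_grad \<Omega> u)"
    and "weak_grad \<Omega> u \<in> borel_measurable (lebesgue_on \<Omega>)"
    and "\<exists>C\<ge>0. AE x in lebesgue_on \<Omega>. norm (weak_grad \<Omega> u x) \<le> C"
proof -
  obtain g where g: "has_weak_gradient \<Omega> u g" "g \<in> Linf \<Omega>"
    using u by (auto simp: W1inf_def)
  show grad: "has_weak_gradient \<Omega> u (weak_grad \<Omega> u)"
    unfolding weak_grad_def by (rule someI[of "has_weak_gradient \<Omega> u", OF g(1)])
  have eq: "AE x in lebesgue_on \<Omega>. g x = weak_grad \<Omega> u x"
    by (rule weak_gradient_unique[OF \<Omega> g(1) grad])
  have sets: "\<Omega> \<in> sets lebesgue"
    using \<Omega> by simp
  have "g \<in> borel_measurable (lebesgue_on \<Omega>)"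
    using g(2) by (simp add: Linf_def)
  then show "weak_grad \<Omega> u \<in> borel_measurable (lebesgue_on \<Omega>)"
    using eq by (rule ae_eq_borel_measurable[OF sets])
  obtain C where C: "0 \<le> C" "AE x in lebesgue_on \<Omega>. norm (g x) \<le> C"
    using Linf_AE_bounded[OF g(2)] .
  have "AE x in lebesgue_on \<Omega>. norm (weak_grad \<Omega> u x) \<le> C"
    using C(2) eq by eventually_elim simp
  then show "\<exists>C\<ge>0. AE x in lebesgue_on \<Omega>. norm (weak_grad \<Omega> u x) \<le> C"
    using C(1) by blast
qed

text \<open>The continuous representative that defines the trace has the same weak gradient.\<close>

lemma W01inf_zero_gradient_imp_zero:
  assumes \<Omega>: "open \<Omega>" "bounded \<Omega>" and u: "u \<in> W01inf \<Omega>" and grad: "has_weak_gradient \<Omega> u (\<lambda>_. 0)"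
  shows "ae_eq \<Omega> u (\<lambda>_. 0)"
proof -
  obtain w where w: "continuous_on (closure \<Omega>) w" "ae_eq \<Omega> w u" "\<And>x. x \<in> frontier \<Omega> \<Longrightarrow> w x = 0"
    using u by (auto simp: W01inf_def has_trace_def)
  have "ae_eq \<Omega> u w"
    using w(2) by (auto simp: ae_eq_def elim: eventually_mono)
  then have "has_weak_gradient \<Omega> w (\<lambda>_. 0)"
    by (rule has_weak_gradient_cong_ae[OF \<Omega>(1) grad])
  then have zero: "w x = 0" if "x \<in> \<Omega>" for x
    using zero_gradient_zero_boundary_imp_zero[OF \<Omega> w(1) _ w(3) that] by simp
  have "AE x in lebesgue_on \<Omega>. x \<in> \<Omega>"
    by (rule AE_I2) simp
  then show ?thesis
    using w(2) unfolding ae_eq_def by eventually_elim (use zero in force)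
qed

lemma linear_subspace_sum:
  assumes "linear_subspace X" "B \<subseteq> X"
  shows "(\<lambda>x. \<Sum>b\<in>B. c b * b x) \<in> X"
  using assms(2)
proof (induction B rule: infinite_finite_induct)
  case (insert b B)
  then have "(\<lambda>x. c b * b x) \<in> X" "(\<lambda>x. \<Sum>b\<in>B. c b * b x) \<in> X"
    using assms(1) by (auto simp: linear_subspace_def)
  then have "(\<lambda>x. c b * b x + (\<Sum>b\<in>B. c b * b x)) \<in> X"
    using assms(1) by (auto simp: linear_subspace_def)
  then show ?case
    using insert by simp
qed (use assms(1) in \<open>auto simp: linear_subspace_def\<close>)

text \<open>A spanning set of least cardinality is independent, for a nontrivial relation would allow one of its
  elements to be dropped.\<close>

lemma finite_dim_independent_basis:
  assumes "finite_dim \<Omega> X"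
  shows "\<exists>B. finite B \<and> B \<subseteq> X \<and>
    (\<forall>u\<in>X. \<exists>c. ae_eq \<Omega> u (\<lambda>x. \<Sum>b\<in>B. c b * b x)) \<and>
    (\<forall>c. ae_eq \<Omega> (\<lambda>x. \<Sum>b\<in>B. c b * b x) (\<lambda>_. 0) \<longrightarrow> (\<forall>b\<in>B. c b = 0))"
proof -
  define spanning where "spanning B \<longleftrightarrow> finite B \<and> B \<subseteq> X \<and>
      (\<forall>u\<in>X. \<exists>c. ae_eq \<Omega> u (\<lambda>x. \<Sum>b\<in>B. c b * b x))" for B
  have "\<exists>B. spanning B"
    using assms by (simp add: finite_dim_def spanning_def)
  then obtain B where B: "spanning B" "\<And>B'. spanning B' \<Longrightarrow> card B \<le> card B'"
    using ex_has_least_nat[of spanning _ card] by blast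
  have fin: "finite B"
    using B(1) by (simp add: spanning_def)
  have "c a = 0" if ae: "ae_eq \<Omega> (\<lambda>x. \<Sum>b\<in>B. c b * b x) (\<lambda>_. 0)" and a: "a \<in> B" for c a
  proof (rule ccontr)
    assume nz: "c a \<noteq> 0"
    have "spanning (B - {a})"
      unfolding spanning_def
    proof (intro conjI ballI)
      show "finite (B - {a})" "B - {a} \<subseteq> X"
        using B(1) by (auto simp: spanning_def)
      fix u assume "u \<in> X"
      then obtain d where d: "ae_eq \<Omega> u (\<lambda>x. \<Sum>b\<in>B. d b * b x)"
        using B(1) by (auto simp: spanning_def)
      let ?d = "\<lambda>b. d b - d a / c a * c b"
      have "AE x in lebesgue_on \<Omega>. u x = (\<Sum>b\<in>B - {a}. ?d b * b x)"
        using d ae unfolding ae_eq_def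
      proof eventually_elim
        case (elim x)
        have "(\<Sum>b\<in>B. ?d b * b x) = (\<Sum>b\<in>B. d b * b x) - d a / c a * (\<Sum>b\<in>B. c b * b x)"
          by (simp add: left_diff_distrib sum_subtractf sum_distrib_left mult.assoc)
        moreover have "(\<Sum>b\<in>B. ?d b * b x) = (\<Sum>b\<in>B - {a}. ?d b * b x)"
          using nz by (simp add: sum.remove[OF fin a])
        ultimately show ?case
          using elim by simp
      qed
      then show "\<exists>e. ae_eq \<Omega> u (\<lambda>x. \<Sum>b\<in>B - {a}. e b * b x)"
        unfolding ae_eq_def by (intro exI[of _ ?d])
    qed
    from B(2)[OF this] show False
      using card_Diff1_less[OF fin a] by simp
  qed
  with B(1) show ?thesis
    unfolding spanning_def by blast
qed

text \<open>The space \<open>X\<close> in coordinates: up to null sets its elements are combinations of the basis \<open>B\<close>, and their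
  gradients and loads are those of the coordinates.\<close>

locale discrete_problem = galerkin_space "lebesgue_on \<Omega>" B g C
  for \<Omega> :: "'a::euclidean_space set" and B :: "('a \<Rightarrow> real) set"
    and g :: "('a \<Rightarrow> real) \<Rightarrow> 'a \<Rightarrow> 'a" and C +
  fixes X :: "('a \<Rightarrow> real) set" and f :: "'a \<Rightarrow> real"
  assumes lebesgue_\<Omega>: "\<Omega> \<in> sets lebesgue"
    and subspace_X: "linear_subspace X" and B_sub: "B \<subseteq> X"
    and spanning: "u \<in> X \<Longrightarrow> \<exists>c. ae_eq \<Omega> u (\<lambda>x. \<Sum>b\<in>B. c b * b x)"
    and gradient: "u \<in> X \<Longrightarrow> ae_eq \<Omega> u (\<lambda>x. \<Sum>b\<in>B. c b * b x) \<Longrightarrow>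
      AE x in lebesgue_on \<Omega>. weak_grad \<Omega> u x = comb c x"
    and load: "u \<in> X \<Longrightarrow> ae_eq \<Omega> u (\<lambda>x. \<Sum>b\<in>B. c b * b x) \<Longrightarrow>
      (\<integral>x. f x * u x \<partial>lebesgue_on \<Omega>) = (\<Sum>b\<in>B. c b * (\<integral>x. f x * b x \<partial>lebesgue_on \<Omega>))"
begin

definition load_vector :: "('a \<Rightarrow> real) \<Rightarrow> real" where
  "load_vector b = (\<integral>x. f x * b x \<partial>lebesgue_on \<Omega>)"

definition weak_solution :: "('a \<Rightarrow> 'a \<Rightarrow> 'a) \<Rightarrow> ('a \<Rightarrow> real) \<Rightarrow> bool" where
  "weak_solution A u \<longleftrightarrow> u \<in> X \<and> (\<forall>v\<in>X. (\<integral>x. A x (weak_grad \<Omega> u x) \<bullet> weak_grad \<Omega> v x \<partial>lebesgue_on \<Omega>) =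
      (\<integral>x. f x * v x \<partial>lebesgue_on \<Omega>))"

lemma measurable_weak_grad: "u \<in> X \<Longrightarrow> weak_grad \<Omega> u \<in> borel_measurable (lebesgue_on \<Omega>)"
proof -
  assume u: "u \<in> X"
  then obtain c where "ae_eq \<Omega> u (\<lambda>x. \<Sum>b\<in>B. c b * b x)"
    using spanning by blast
  from gradient[OF u this] have "AE x in lebesgue_on \<Omega>. comb c x = weak_grad \<Omega> u x"
    by (auto elim: eventually_mono)
  then show ?thesis
    by (rule ae_eq_borel_measurable[OF lebesgue_\<Omega> measurable_comb])
qed

lemma weak_solution_iff:
  assumes dens: "convex_density (lebesgue_on \<Omega>) \<Phi> A"
    and u: "u \<in> X" "ae_eq \<Omega> u (\<lambda>x. \<Sum>b\<in>B. c b * b x)"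
  shows "weak_solution A u \<longleftrightarrow> galerkin_solution A load_vector c"
proof -
  interpret convex_density "lebesgue_on \<Omega>" \<Phi> A
    by (rule dens)
  have eq: "(\<integral>x. A x (weak_grad \<Omega> u x) \<bullet> weak_grad \<Omega> v x \<partial>lebesgue_on \<Omega>) =
      (\<integral>x. A x (comb c x) \<bullet> comb d x \<partial>lebesgue_on \<Omega>)"
    if v: "v \<in> X" "ae_eq \<Omega> v (\<lambda>x. \<Sum>b\<in>B. d b * b x)" for v d
  proof (rule integral_cong_AE)
    show "(\<lambda>x. A x (weak_grad \<Omega> u x) \<bullet> weak_grad \<Omega> v x) \<in> borel_measurable (lebesgue_on \<Omega>)"
      by (intro borel_measurable_inner measurable_flux measurable_weak_grad u v)
    show "(\<lambda>x. A x (comb c x) \<bullet> comb d x) \<in> borel_measurable (lebesgue_on \<Omega>)"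
      by (intro borel_measurable_inner measurable_flux measurable_comb)
    show "AE x in lebesgue_on \<Omega>. A x (weak_grad \<Omega> u x) \<bullet> weak_grad \<Omega> v x = A x (comb c x) \<bullet> comb d x"
      using gradient[OF u] gradient[OF v] by eventually_elim simp
  qed
  show ?thesis
  proof
    assume sol: "weak_solution A u"
    show "galerkin_solution A load_vector c"
      unfolding galerkin_solution_def
    proof
      fix b assume b: "b \<in> B"
      let ?e = "\<lambda>a. if a = b then 1 else 0 :: real"
      have "(\<Sum>a\<in>B. ?e a * a x) = b x" for x
        using finite_B b by (simp add: if_distrib[of "\<lambda>s. s * _"] sum.delta cong: if_cong)
      then have "ae_eq \<Omega> b (\<lambda>x. \<Sum>a\<in>B. ?e a * a x)"
        by (simp add: ae_eq_def)
      then have "(\<integral>x. A x (comb c x) \<bullet> comb ?e x \<partial>lebesgue_on \<Omega>) = (\<integral>x. f x * b x \<partial>lebesgue_on \<Omega>)"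
        using eq[of b ?e] sol b B_sub by (auto simp: weak_solution_def)
      then show "(\<integral>x. A x (comb c x) \<bullet> g b x \<partial>lebesgue_on \<Omega>) = load_vector b"
        by (simp add: comb_unit[OF dens b] load_vector_def)
    qed
  next
    assume sol: "galerkin_solution A load_vector c"
    show "weak_solution A u"
      unfolding weak_solution_def
    proof (intro conjI ballI u(1))
      fix v assume v: "v \<in> X"
      then obtain d where d: "ae_eq \<Omega> v (\<lambda>x. \<Sum>b\<in>B. d b * b x)"
        using spanning by blast
      show "(\<integral>x. A x (weak_grad \<Omega> u x) \<bullet> weak_grad \<Omega> v x \<partial>lebesgue_on \<Omega>) = (\<integral>x. f x * v x \<partial>lebesgue_on \<Omega>)"
        using eq[OF v d] load[OF v d] galerkin_solution_test[OF dens sol, of d]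
        by (simp add: load_vector_def)
    qed
  qed
qed

lemma weak_solution_ex1:
  assumes dens: "convex_density (lebesgue_on \<Omega>) \<Phi> A"
  shows "ex1_ae \<Omega> (weak_solution A)"
proof -
  obtain c where c: "galerkin_solution A load_vector c"
    using galerkin_solution_exists[OF dens] by blast
  let ?u = "\<lambda>x. \<Sum>b\<in>B. c b * b x"
  have u: "?u \<in> X"
    by (rule linear_subspace_sum[OF subspace_X B_sub])
  have "weak_solution A ?u"
    using weak_solution_iff[OF dens u, of c] c by (simp add: ae_eq_def)
  moreover have "ae_eq \<Omega> v ?u" if v: "weak_solution A v" for v
  proof -
    have vX: "v \<in> X"
      using v by (simp add: weak_solution_def)
    then obtain d where d: "ae_eq \<Omega> v (\<lambda>x. \<Sum>b\<in>B. d b * b x)"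
      using spanning by blast
    have "galerkin_solution A load_vector d"
      using weak_solution_iff[OF dens vX d] v by simp
    then have "d b = c b" if "b \<in> B" for b
      using galerkin_solution_unique[OF dens _ c that] by blast
    then have "(\<lambda>x. \<Sum>b\<in>B. d b * b x) = ?u"
      by (simp cong: sum.cong)
    then show ?thesis
      using d by simp
  qed
  ultimately show ?thesis
    unfolding ex1_ae_def by blast
qed

lemma energy_eq:
  assumes dens: "convex_density (lebesgue_on \<Omega>) \<Phi> A"
    and u: "u \<in> X" "ae_eq \<Omega> u (\<lambda>x. \<Sum>b\<in>B. c b * b x)"
  shows "(\<integral>x. \<Phi> x (weak_grad \<Omega> u x) \<partial>lebesgue_on \<Omega>) - (\<integral>x. f x * u x \<partial>lebesgue_on \<Omega>) =
    total_energy \<Phi> load_vector c"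
proof -
  interpret convex_density "lebesgue_on \<Omega>" \<Phi> A
    by (rule dens)
  have "(\<integral>x. \<Phi> x (weak_grad \<Omega> u x) \<partial>lebesgue_on \<Omega>) = (\<integral>x. \<Phi> x (comb c x) \<partial>lebesgue_on \<Omega>)"
  proof (rule integral_cong_AE)
    show "AE x in lebesgue_on \<Omega>. \<Phi> x (weak_grad \<Omega> u x) = \<Phi> x (comb c x)"
      using gradient[OF u] by eventually_elim simp
  qed (intro measurable_density measurable_weak_grad u measurable_comb)+
  then show ?thesis
    using load[OF u] by (simp add: total_energy_def load_vector_def)
qed

end

text \<open>Since \<open>\<bar>t\<bar> \<le> 1 + \<bar>t\<bar> powr r\<close> for \<open>r \<ge> 1\<close>, a finite modular implies integrability on a set of finite
  measure.\<close>

lemma Lvar_integrable: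
  assumes \<Omega>: "open \<Omega>" "bounded \<Omega>" and f: "f \<in> Lvar \<Omega> \<alpha>"
    and \<alpha>: "continuous_on \<Omega> \<alpha>" "\<And>x. x \<in> \<Omega> \<Longrightarrow> 1 \<le> \<alpha> x"
  shows "integrable (lebesgue_on \<Omega>) f"
proof (rule integrableI_bounded)
  let ?M = "lebesgue_on \<Omega>"
  show f_meas [measurable]: "f \<in> borel_measurable ?M"
    using f by (simp add: Lvar_def)
  have [measurable]: "\<alpha> \<in> borel_measurable ?M"
    using \<alpha>(1) \<Omega>(1) by (simp add: continuous_imp_measurable_on_sets_lebesgue)
  have le: "\<bar>t\<bar> \<le> 1 + \<bar>t\<bar> powr r" if "1 \<le> r" for t r :: real
  proof (cases "\<bar>t\<bar> \<le> 1")
    case False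
    then have "\<bar>t\<bar> powr 1 \<le> \<bar>t\<bar> powr r"
      using that by (intro powr_mono) auto
    then show ?thesis
      using False by simp
  qed (simp add: add_increasing2)
  have "(\<integral>\<^sup>+x. ennreal (norm (f x)) \<partial>?M) \<le> (\<integral>\<^sup>+x. 1 + ennreal (\<bar>f x\<bar> powr \<alpha> x) \<partial>?M)"
  proof (rule nn_integral_mono)
    fix x assume "x \<in> space ?M"
    then have "ennreal (norm (f x)) \<le> ennreal (1 + \<bar>f x\<bar> powr \<alpha> x)"
      using \<alpha>(2) le by (intro ennreal_leI) simp
    then show "ennreal (norm (f x)) \<le> 1 + ennreal (\<bar>f x\<bar> powr \<alpha> x)"
      by simp
  qed
  also have "\<dots> = emeasure ?M (space ?M) + (\<integral>\<^sup>+x. ennreal (\<bar>f x\<bar> powr \<alpha> x) \<partial>?M)"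
    by (subst nn_integral_add) auto
  also have "\<dots> < \<infinity>"
  proof -
    have "finite_measure ?M"
      using \<Omega> by (intro finite_measure_lebesgue_on lmeasurable_open)
    then have "emeasure ?M (space ?M) \<noteq> \<infinity>"
      by (simp add: finite_measure.emeasure_finite infinity_ennreal_def del: space_lebesgue_on space_restrict_space)
    then show ?thesis
      using f by (simp add: Lvar_def less_top)
  qed
  finally show "(\<integral>\<^sup>+x. ennreal (norm (f x)) \<partial>?M) < \<infinity>" .
qed

lemma C_plus_bounds:
  assumes \<Omega>: "bounded \<Omega>" and p: "p \<in> C_plus \<Omega>"
  obtains p_min p_max where "1 < p_min" "\<And>x. x \<in> \<Omega> \<Longrightarrow> p_min \<le> p x \<and> p x \<le> p_max"
proof (cases "\<Omega> = {}")
  case False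
  have comp: "compact (p ` closure \<Omega>)"
    using p \<Omega> by (intro compact_continuous_image) (auto simp: C_plus_def)
  then have bd: "bdd_below (p ` closure \<Omega>)" "bdd_above (p ` closure \<Omega>)"
    using compact_imp_bounded[OF comp] by (auto intro: bounded_imp_bdd_below bounded_imp_bdd_above)
  show ?thesis
  proof (rule that)
    show "1 < (INF x\<in>closure \<Omega>. p x)"
      using p by (simp add: C_plus_def)
    fix x assume "x \<in> \<Omega>"
    then have "x \<in> closure \<Omega>"
      using closure_subset by blast
    then show "(INF x\<in>closure \<Omega>. p x) \<le> p x \<and> p x \<le> (SUP x\<in>closure \<Omega>. p x)"
      using bd by (auto intro: cINF_lower cSUP_upper)
  qed
qed (use that[of 2] in simp)

text \<open>The gradients of the basis functions are cut off on a null set, so that their bound holds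
  everywhere. They are linearly independent since a combination of the basis with vanishing gradient
  is zero by its boundary values.\<close>

lemma discrete_problem_exists:
  fixes \<Omega> :: "'a::euclidean_space set"
  assumes \<Omega>: "open \<Omega>" "bounded \<Omega>" and f: "integrable (lebesgue_on \<Omega>) f"
    and X: "closed_fin_dim_subspace \<Omega> X"
  obtains B g C where "discrete_problem \<Omega> B g C X f"
proof -
  let ?M = "lebesgue_on \<Omega>"
  have XW: "X \<subseteq> W01inf \<Omega>" and lin: "linear_subspace X" and fd: "finite_dim \<Omega> X"
    using X by (auto simp: closed_fin_dim_subspace_def)
  have sets: "\<Omega> \<in> sets lebesgue"
    using \<Omega> by simp
  obtain B where B: "finite B" "B \<subseteq> X"
    "\<forall>u\<in>X. \<exists>c. ae_eq \<Omega> u (\<lambda>x. \<Sum>b\<in>B. c b * b x)"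
    "\<forall>c. ae_eq \<Omega> (\<lambda>x. \<Sum>b\<in>B. c b * b x) (\<lambda>_. 0) \<longrightarrow> (\<forall>b\<in>B. c b = 0)"
    using finite_dim_independent_basis[OF fd] by (elim exE conjE)
  have W1: "u \<in> W1inf \<Omega>" if "u \<in> X" for u
    using that XW by (auto simp: W01inf_def)
  note wg = weak_grad_W1inf[OF \<Omega>(1) W1]
  have "\<forall>b\<in>B. \<exists>C\<ge>0. AE x in ?M. norm (weak_grad \<Omega> b x) \<le> C"
    using wg(3) B(2) by blast
  from bchoice[OF this]
  obtain Cb where Cb: "\<And>b. b \<in> B \<Longrightarrow> 0 \<le> Cb b"
    "\<And>b. b \<in> B \<Longrightarrow> AE x in ?M. norm (weak_grad \<Omega> b x) \<le> Cb b"
    by blast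
  define C where "C = (\<Sum>b\<in>B. Cb b)"
  have C: "0 \<le> C" "\<And>b. b \<in> B \<Longrightarrow> Cb b \<le> C"
    unfolding C_def using Cb(1) B(1) by (auto intro: sum_nonneg member_le_sum)
  define g where "g b x = (if norm (weak_grad \<Omega> b x) \<le> C then weak_grad \<Omega> b x else 0)" for b x
  have g_eq: "AE x in ?M. \<forall>b\<in>B. weak_grad \<Omega> b x = g b x"
  proof (subst AE_ball_countable)
    show "countable B"
      using B(1) by (rule countable_finite)
    show "\<forall>b\<in>B. AE x in ?M. weak_grad \<Omega> b x = g b x"
    proof
      fix b assume b: "b \<in> B"
      show "AE x in ?M. weak_grad \<Omega> b x = g b x"
        using Cb(2)[OF b] by eventually_elim (use C(2)[OF b] in \<open>simp add: g_def\<close>)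
    qed
  qed
  have g_meas: "g b \<in> borel_measurable ?M" if "b \<in> B" for b
  proof (rule ae_eq_borel_measurable[OF sets])
    show "weak_grad \<Omega> b \<in> borel_measurable ?M"
      using wg(2) that B(2) by blast
    show "AE x in ?M. weak_grad \<Omega> b x = g b x"
      using g_eq by eventually_elim (use that in simp)
  qed
  have sum_grad: "has_weak_gradient \<Omega> (\<lambda>x. \<Sum>b\<in>B. c b * b x) (\<lambda>x. \<Sum>b\<in>B. c b *\<^sub>R weak_grad \<Omega> b x)" for c
    using wg(1) B(2) by (intro has_weak_gradient_sum[OF \<Omega>(1)]) blast
  interpret galerkin_space ?M B g C
  proof (intro galerkin_space.intro galerkin_space_axioms.intro)
    show "finite_measure ?M"
      using \<Omega> by (intro finite_measure_lebesgue_on lmeasurable_open)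
    fix c b assume ae: "AE x in ?M. (\<Sum>b\<in>B. c b *\<^sub>R g b x) = 0" and b: "b \<in> B"
    let ?u = "\<lambda>x. \<Sum>b\<in>B. c b * b x"
    have u: "?u \<in> X"
      by (rule linear_subspace_sum[OF lin B(2)])
    have zero: "AE x in ?M. (\<Sum>b\<in>B. c b *\<^sub>R weak_grad \<Omega> b x) = 0"
      using ae g_eq by eventually_elim (simp cong: sum.cong)
    have "(\<integral>x. ?u x * frechet_derivative \<phi> (at x) i \<partial>?M) = 0"
      if "\<phi> \<in> test_functions \<Omega>" "i \<in> Basis" for \<phi> i
    proof -
      have "(\<integral>x. ((\<Sum>b\<in>B. c b *\<^sub>R weak_grad \<Omega> b x) \<bullet> i) * \<phi> x \<partial>?M) = 0"
        by (rule integral_eq_zero_AE) (use zero in \<open>eventually_elim, simp\<close>)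
      then show ?thesis
        using sum_grad[of c] that by (simp add: has_weak_gradient_def)
    qed
    then have "has_weak_gradient \<Omega> ?u (\<lambda>_. 0)"
      using sum_grad[of c] by (simp add: has_weak_gradient_def locally_integrable_def)
    then have "ae_eq \<Omega> ?u (\<lambda>_. 0)"
      using W01inf_zero_gradient_imp_zero[OF \<Omega>] u XW by blast
    then show "c b = 0"
      using B(4) b by blast
  qed (use B(1) C(1) g_meas in \<open>auto simp: g_def\<close>)
  have "discrete_problem \<Omega> B g C X f"
  proof unfold_locales
    show "\<Omega> \<in> sets lebesgue" "linear_subspace X" "B \<subseteq> X"
      by (fact sets lin B(2))+
    show "\<exists>c. ae_eq \<Omega> u (\<lambda>x. \<Sum>b\<in>B. c b * b x)" if "u \<in> X" for u
      using B(3) that by blast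
    fix u c assume u: "u \<in> X" "ae_eq \<Omega> u (\<lambda>x. \<Sum>b\<in>B. c b * b x)"
    have ae: "AE x in ?M. (\<Sum>b\<in>B. c b * b x) = u x"
      using u(2) by (auto simp: ae_eq_def elim: eventually_mono)
    have "has_weak_gradient \<Omega> u (\<lambda>x. \<Sum>b\<in>B. c b *\<^sub>R weak_grad \<Omega> b x)"
      by (rule has_weak_gradient_cong_ae[OF \<Omega>(1) sum_grad]) (use ae in \<open>simp add: ae_eq_def\<close>)
    from weak_gradient_unique[OF \<Omega>(1) wg(1)[OF u(1)] this]
    show "AE x in ?M. weak_grad \<Omega> u x = comb c x"
      using g_eq by eventually_elim (simp add: comb_def cong: sum.cong)
    have b_meas: "b \<in> borel_measurable ?M" if "b \<in> X" for b
      using W1[OF that] by (simp add: W1inf_def Linf_def)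
    have fb: "integrable ?M (\<lambda>x. f x * b x)" if b: "b \<in> X" for b
    proof -
      have "b \<in> Linf \<Omega>"
        using W1[OF b] by (simp add: W1inf_def)
      then obtain K where K: "0 \<le> K" "AE x in ?M. norm (b x) \<le> K"
        using Linf_AE_bounded by blast
      show ?thesis
      proof (rule Bochner_Integration.integrable_bound)
        show "integrable ?M (\<lambda>x. K * f x)"
          using f by simp
        show "(\<lambda>x. f x * b x) \<in> borel_measurable ?M"
          by (intro borel_measurable_times borel_measurable_integrable[OF f] b_meas b)
        show "AE x in ?M. norm (f x * b x) \<le> norm (K * f x)"
          using K(2) by eventually_elim (use K(1) in \<open>simp add: abs_mult mult.commute mult_right_mono\<close>)
      qed
    qed
    have "(\<integral>x. f x * u x \<partial>?M) = (\<integral>x. f x * (\<Sum>b\<in>B. c b * b x) \<partial>?M)"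
    proof (rule integral_cong_AE)
      show "(\<lambda>x. f x * u x) \<in> borel_measurable ?M"
        by (rule borel_measurable_integrable[OF fb[OF u(1)]])
      show "(\<lambda>x. f x * (\<Sum>b\<in>B. c b * b x)) \<in> borel_measurable ?M"
        by (rule borel_measurable_integrable[OF fb[OF linear_subspace_sum[OF lin B(2)]]])
      show "AE x in ?M. f x * u x = f x * (\<Sum>b\<in>B. c b * b x)"
        using ae by eventually_elim simp
    qed
    also have "\<dots> = (\<integral>x. (\<Sum>b\<in>B. c b * (f x * b x)) \<partial>?M)"
      by (simp add: sum_distrib_left mult.left_commute)
    also have "\<dots> = (\<Sum>b\<in>B. c b * (\<integral>x. f x * b x \<partial>?M))"
      using fb B(2) by (subst Bochner_Integration.integral_sum) auto
    finally show "(\<integral>x. f x * u x \<partial>?M) = (\<Sum>b\<in>B. c b * (\<integral>x. f x * b x \<partial>?M))" .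
  qed
  then show ?thesis
    by (rule that)
qed

theorem theorem4p2:
  fixes \<Omega> :: "(real ^ 'd) set" and p \<alpha> f :: "real ^ 'd \<Rightarrow> real" and X :: "(real ^ 'd \<Rightarrow> real) set"
  assumes dim: "CARD('d) \<in> {2, 3}"
    and dom: "open \<Omega>" "bounded \<Omega>" "lipschitz_boundary \<Omega>"
    and p: "p \<in> C_plus \<Omega>"
    and f: "f \<in> Lvar \<Omega> \<alpha>"
    and \<alpha>: "\<alpha> \<in> C_plus \<Omega>"
    and \<alpha>_p: "\<forall>x\<in>\<Omega>. 1 / ereal (\<alpha> x) + 1 / sobolev_conjugate p x < 1"
    and \<alpha>_2: "CARD('d) = 2 \<Longrightarrow> (INF x\<in>closure \<Omega>. \<alpha> x) > 1"
    and \<alpha>_3: "CARD('d) = 3 \<Longrightarrow> (INF x\<in>closure \<Omega>. \<alpha> x) \<ge> 6 / 5"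
    and X: "closed_fin_dim_subspace \<Omega> X"
  shows "(\<forall>\<epsilon>\<in>cutoffs. ex1_ae \<Omega> (relaxed_solution \<Omega> p f X \<epsilon>)) \<and>
    ex1_ae \<Omega> (unrelaxed_solution \<Omega> p f X) \<and>
    (\<forall>u_eps u. (\<forall>\<epsilon>\<in>cutoffs. relaxed_solution \<Omega> p f X \<epsilon> (u_eps \<epsilon>)) \<and>
       unrelaxed_solution \<Omega> p f X u \<longrightarrow>
       ((\<lambda>\<epsilon>. relaxed_energy \<Omega> p f \<epsilon> (u_eps \<epsilon>)) \<longlongrightarrow> energy \<Omega> p f u) cutoff_net)"
proof -
  let ?M = "lebesgue_on \<Omega>"
  obtain \<alpha>_min \<alpha>_max where \<alpha>_bd: "1 < \<alpha>_min" "\<And>x. x \<in> \<Omega> \<Longrightarrow> \<alpha>_min \<le> \<alpha> x \<and> \<alpha> x \<le> \<alpha>_max"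
    using C_plus_bounds[OF dom(2) \<alpha>] by metis
  obtain p_min p_max where p_bd: "1 < p_min" "\<And>x. x \<in> \<Omega> \<Longrightarrow> p_min \<le> p x \<and> p x \<le> p_max"
    using C_plus_bounds[OF dom(2) p] by metis
  have cont: "continuous_on \<Omega> p" "continuous_on \<Omega> \<alpha>"
    using p \<alpha> continuous_on_subset[OF _ closure_subset] by (auto simp: C_plus_def)
  have "integrable ?M f"
    using \<alpha>_bd by (intro Lvar_integrable[OF dom(1,2) f cont(2)]) force
  then obtain B g C where "discrete_problem \<Omega> B g C X f"
    using discrete_problem_exists[OF dom(1,2) _ X] by blast
  then interpret discrete_problem \<Omega> B g C X f .
  have p_meas: "p \<in> borel_measurable ?M"
    using cont(1) lebesgue_\<Omega> by (rule continuous_imp_measurable_on_sets_lebesgue)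
  have range: "p_min \<le> p x \<and> p x \<le> p_max" if "x \<in> space ?M" for x
    using p_bd(2) that by simp
  define \<Phi> where "\<Phi> x z = 1 / p x * norm z powr p x" for x and z :: "real ^ 'd"
  define A where "A x z = norm z powr (p x - 2) *\<^sub>R z" for x and z :: "real ^ 'd"
  define \<Psi> where "\<Psi> \<epsilon> x z = varphi p \<epsilon> x ((norm z)\<^sup>2)" for \<epsilon> x and z :: "real ^ 'd"
  define D where "D \<epsilon> x z = mu p \<epsilon> x ((norm z)\<^sup>2) *\<^sub>R z" for \<epsilon> x and z :: "real ^ 'd"
  have dens: "convex_density ?M \<Phi> A"
    unfolding \<Phi>_def A_def by (rule convex_density_unrelaxed[OF p_meas p_bd(1) range])
  have rdens: "convex_density ?M (\<Psi> \<epsilon>) (D \<epsilon>)" if "\<epsilon> \<in> cutoffs" for \<epsilon>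
    unfolding \<Psi>_def D_def by (rule convex_density_relaxed[OF p_meas p_bd(1) range that])
  have unrelaxed_iff: "unrelaxed_solution \<Omega> p f X = weak_solution A"
    by (simp add: fun_eq_iff unrelaxed_solution_def weak_solution_def A_def)
  have relaxed_iff: "relaxed_solution \<Omega> p f X \<epsilon> = weak_solution (D \<epsilon>)" for \<epsilon>
    by (simp add: fun_eq_iff relaxed_solution_def weak_solution_def D_def)
  have "((\<lambda>\<epsilon>. relaxed_energy \<Omega> p f \<epsilon> (u_eps \<epsilon>)) \<longlongrightarrow> energy \<Omega> p f u) cutoff_net"
    if sol: "\<forall>\<epsilon>\<in>cutoffs. relaxed_solution \<Omega> p f X \<epsilon> (u_eps \<epsilon>)" "unrelaxed_solution \<Omega> p f X u" for u_eps u
  proof -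
    have uX: "u \<in> X" "\<And>\<epsilon>. \<epsilon> \<in> cutoffs \<Longrightarrow> u_eps \<epsilon> \<in> X"
      using sol by (auto simp: relaxed_solution_def unrelaxed_solution_def)
    obtain c where c: "ae_eq \<Omega> u (\<lambda>x. \<Sum>b\<in>B. c b * b x)"
      using spanning uX(1) by blast
    have "\<forall>\<epsilon>\<in>cutoffs. \<exists>c. ae_eq \<Omega> (u_eps \<epsilon>) (\<lambda>x. \<Sum>b\<in>B. c b * b x)"
      using spanning uX(2) by blast
    from bchoice[OF this]
    obtain cs where cs: "\<And>\<epsilon>. \<epsilon> \<in> cutoffs \<Longrightarrow> ae_eq \<Omega> (u_eps \<epsilon>) (\<lambda>x. \<Sum>b\<in>B. cs \<epsilon> b * b x)"
      by blast
    have E: "energy \<Omega> p f u = total_energy \<Phi> load_vector c"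
      using energy_eq[OF dens uX(1) c] by (simp add: energy_def \<Phi>_def)
    have E\<epsilon>: "relaxed_energy \<Omega> p f \<epsilon> (u_eps \<epsilon>) = total_energy (\<Psi> \<epsilon>) load_vector (cs \<epsilon>)" if "\<epsilon> \<in> cutoffs" for \<epsilon>
      using energy_eq[OF rdens uX(2) cs] that by (simp add: relaxed_energy_def \<Psi>_def)
    have ev: "\<forall>\<^sub>F \<epsilon> in cutoff_net. \<epsilon> \<in> cutoffs"
      using eventually_cutoff_net_small_large[of 1 0] by (auto elim: eventually_mono)
    have "((\<lambda>\<epsilon>. total_energy (\<Psi> \<epsilon>) load_vector (cs \<epsilon>)) \<longlongrightarrow> total_energy \<Phi> load_vector c) cutoff_net"
    proof (rule minimal_energy_tendsto[OF dens])
      show "\<forall>\<^sub>F \<epsilon> in cutoff_net. convex_density ?M (\<Psi> \<epsilon>) (D \<epsilon>)"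
        using ev by eventually_elim (rule rdens)
      show "galerkin_solution A load_vector c"
        using weak_solution_iff[OF dens uX(1) c] sol(2) by (simp add: unrelaxed_iff)
      show "\<forall>\<^sub>F \<epsilon> in cutoff_net. galerkin_solution (D \<epsilon>) load_vector (cs \<epsilon>)"
        using ev by eventually_elim (use weak_solution_iff[OF rdens uX(2) cs] sol(1) in \<open>auto simp: relaxed_iff\<close>)
      fix R \<eta> :: real assume \<eta>: "0 < \<eta>"
      have "\<forall>\<^sub>F \<epsilon> in cutoff_net. \<epsilon> \<in> cutoffs \<and> fst \<epsilon> \<le> \<eta> / 2 \<and> R \<le> snd \<epsilon>"
        using \<eta> by (intro eventually_cutoff_net_small_large) simp
      then show "\<forall>\<^sub>F \<epsilon> in cutoff_net. \<forall>x\<in>space ?M. \<forall>z. norm z \<le> R \<longrightarrow> \<bar>\<Psi> \<epsilon> x z - \<Phi> x z\<bar> \<le> \<eta>"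
      proof eventually_elim
        case (elim \<epsilon>)
        show ?case
        proof (intro ballI allI impI)
          fix x and z :: "real ^ 'd" assume "x \<in> space ?M" "norm z \<le> R"
          then have "\<bar>\<Psi> \<epsilon> x z - \<Phi> x z\<bar> \<le> 2 * fst \<epsilon>"
            unfolding \<Psi>_def \<Phi>_def using elim
            by (intro relaxed_density_close[OF p_meas p_bd(1) range]) auto
          then show "\<bar>\<Psi> \<epsilon> x z - \<Phi> x z\<bar> \<le> \<eta>"
            using elim by simp
        qed
      qed
    qed
    moreover have "\<forall>\<^sub>F \<epsilon> in cutoff_net.
        total_energy (\<Psi> \<epsilon>) load_vector (cs \<epsilon>) = relaxed_energy \<Omega> p f \<epsilon> (u_eps \<epsilon>)"
      using ev by eventually_elim (simp add: E\<epsilon>)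
    ultimately show ?thesis
      unfolding E by (rule Lim_transform_eventually)
  qed
  then show ?thesis
    using weak_solution_ex1[OF dens] weak_solution_ex1[OF rdens]
    by (auto simp: unrelaxed_iff relaxed_iff)
qed

end
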